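(* Consider algorithm iRPMVR with one of the four estimators SVRG, SARAH/SPIDER, SAGA, SAG, with the variance-reduction state initialized at $x^0$ so that $u^0=\operatorname{grad}F(x^0)$, and with $\bar m^0=\operatorname{grad}F(x^0)$. Suppose the inner tolerances satisfy, with $\eta^{-1}:=0$, some $\kappa\ge0$ and a deterministic sequence $\{\varsigma_k\}\subseteq[0,\bar\Delta]$, $$\Delta_k=\min\bigl\{\bar\Delta,\max\{\kappa\|\eta^{k-1}\|^2,\varsigma_k\}\bigr\},\qquad k\in\mathbb N,$$ and that $\sum_{k=0}^\infty\varsigma_k\le C_{\rm sum}$, where $C_{\rm sum}$ and $\kappa$ are independent of $n$ and $\epsilon$. Choose the parameters - SVRG: $q_{\rm ep}=\lceil n^{1/3}\rceil$, $b=\lceil n^{2/3}\rceil$; - SARAH/SPIDER: $q_{\rm ep}=\lceil n^{1/2}\rceil$, $b=\lceil n^{1/2}\rceil$; - SAGA: $b=\lceil n^{2/3}\rceil$; - SAG: $b=\lceil\kappa_bn\rceil$, with $\kappa_b\in(0,1)$ a fixed constant independent of $n$ and $\epsilon$. Then there exists $\alpha_0>0$, independent of $n$, such that, for every fixed $0<\alpha\le\bar\alpha\le\alpha_0$, the algorithm produces an iterate satisfying $\mathbb E[\Theta_k^2]\le\epsilon^2$ within the following outer-iteration and IFO complexities: - SVRG: outer $O(\epsilon^{-2})$, IFO $O(n+n^{2/3}\epsilon^{-2})$; - SARAH/SPIDER: outer $O(\epsilon^{-2})$, IFO $O(n+n^{1/2}\epsilon^{-2})$; - SAGA: outer $O(\epsilon^{-2})$,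 IFO $O(n+n^{2/3}\epsilon^{-2})$; - SAG: outer $O(\epsilon^{-2})$, IFO $O(n+n\epsilon^{-2})$.
   Context: Setting. $\mathcal M\subseteq\mathbb R^d$ is a compact embedded Riemannian submanifold (induced Euclidean metric) of dimension $d-p$, with tangent spaces $T_x\mathcal M$, normal spaces $N_x\mathcal M=(T_x\mathcal M)^\perp$, tangent bundle $T\mathcal M=\{(x,\eta):x\in\mathcal M,\eta\in T_x\mathcal M\}$; $P_S$ is Euclidean projection onto a closed convex set $S$. $\Phi=F+R$, $F=\frac1n\sum_{j=1}^nf_j$. Each $f_j:\mathbb R^d\to\mathbb R$ is $C^1$; there is an open neighborhood $U$ of $\mathcal M$ on which every $\nabla f_j$ is Lipschitz with common constant $\ell_f$; $\|\nabla f_j(x)\|\le M_f$ for all $x\in\mathcal M$ and all $j$ ($M_f>0$ independent of $n$); $R:\mathbb R^d\to\mathbb R$ is convex and $\ell_R$-Lipschitz. $\operatorname{grad}h(x)=P_{T_x\mathcal M}\nabla h(x)$. $\operatorname{Retr}:T\mathcal M\to\mathcal M$ is a retraction (smooth, $\operatorname{Retr}_x(0)=x$, $D\operatorname{Retr}_x(0)=\mathrm{Id}$). $\mathcal M$ is covered by finitely many open sets $V_\ell$ with $\overline{V_\ell}\subseteq U_\ell$, $U_\ell$ open carrying smooth local defining functions $\psi_\ell:U_\ell\to\mathbb R^p$ of $\mathcal M$ whose differential has full row rank on $U_\ell\cap\mathcal M$; for $x\in\mathcal M$ pick $\ell(x)$ with $x\in V_{\ell(x)}$ and set $B_x:=D\psi_{\ell(x)}(x)$,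 so $\ker B_x=T_x\mathcal M$. Algorithm iRPMVR. Choose $x^0\in\mathcal M$, stepsize $0<\alpha\le\bar\alpha$, $0<\gamma\le1$, $\bar\Delta\ge0$, $0\le\bar\chi<1$, $M_u:=c_fM_f$ with $c_f\ge1$. Parameters $\gamma_k\in[\gamma,1]$, $\Delta_k\in[0,\bar\Delta]$, $\chi_k\in[0,\bar\chi]$ are chosen before sampling the $k$-th batch using only available history. Initialize $u^0=\hat u^0=\bar m^0=\operatorname{grad}F(x^0)$. For $k=0,1,\dots$ (outer iterations): (a) if $k\ne0$, sample a random batch $\mathcal B_k$ of size $b\in\{1,\dots,n\}$ uniformly from $\{1,\dots,n\}$ (with or without replacement; sums over $\mathcal B_k$ count multiplicity), form the estimator $u^k\in T_{x^k}\mathcal M$, and set $\hat u^k=P_{\overline B(0,M_u)}u^k$; (b) $m^k=\chi_k\bar m^k+(1-\chi_k)\hat u^k$; (c) with $F_k(\eta):=\langle m^k,\eta\rangle+\frac1{2\alpha}\|\eta\|^2+R(x^k+\eta)$ and $G_k(\lambda):=F_k^*(-B_{x^k}^\top\lambda)$ ($F_k^*$ the Fenchel conjugate) find $\lambda^k\in\mathbb R^p$ with $\|\nabla G_k(\lambda^k)\|\le\Delta_k$; (d) $w^k=\operatorname{prox}_{\alpha R}(x^k-\alpha(m^k+B_{x^k}^\top\lambda^k))-x^k$, $\eta^k=P_{T_{x^k}\mathcal M}w^k$; (e) $x^{k+1}=\operatorname{Retr}_{x^k}(\gamma_k\eta^k)$; (f) $\bar m^{k+1}=P_{T_{x^{k+1}}\mathcal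 M}m^k$. The exact tangent step is $\hat\eta^k:=\arg\min_{\eta\in T_{x^k}\mathcal M}F_k(\eta)$. Estimators ($q_{\rm ep}$ is the epoch length, used only for SVRG and SARAH/SPIDER). SVRG: at the start of epoch $s$ set $\widetilde x^s:=x^{sq_{\rm ep}}$ and compute $\operatorname{grad}F(\widetilde x^s)$; for $k=sq_{\rm ep},\dots,(s+1)q_{\rm ep}-1$, $u^k:=P_{T_{x^k}\mathcal M}\operatorname{grad}F(\widetilde x^s)+\frac1b\sum_{j\in\mathcal B_k}(\operatorname{grad}f_j(x^k)-P_{T_{x^k}\mathcal M}\operatorname{grad}f_j(\widetilde x^s))$. SARAH/SPIDER: $u^{sq_{\rm ep}}:=\operatorname{grad}F(x^{sq_{\rm ep}})$, and for $k=sq_{\rm ep}+1,\dots,(s+1)q_{\rm ep}-1$, $u^k:=P_{T_{x^k}\mathcal M}u^{k-1}+\frac1b\sum_{j\in\mathcal B_k}(\operatorname{grad}f_j(x^k)-P_{T_{x^k}\mathcal M}\operatorname{grad}f_j(x^{k-1}))$. SAGA: with stored points $z_j^k\in\mathcal M$, $y_j^k:=\nabla f_j(z_j^k)$, $\bar y^k:=\frac1n\sum_jy_j^k$, set $u^k:=P_{T_{x^k}\mathcal M}\bigl[\frac1b\sum_{j\in\mathcal B_k}(\nabla f_j(x^k)-y_j^k)+\bar y^k\bigr]$, then $z_j^{k+1}:=x^k$, $y_j^{k+1}:=\nabla f_j(x^k)$ for $j\in\mathcal B_k$, other entries unchanged; the table is initialized by $z_j^0=x^0$, $y_j^0=\nabla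 f_j(x^0)$ for all $j$. SAG: the same table, initialization and refresh, with $u^k:=P_{T_{x^k}\mathcal M}\bigl[\bar y^k+\frac1n\sum_{j\in\mathcal B_k}(\nabla f_j(x^k)-y_j^k)\bigr]$. Criticality measure: for $x\in\mathcal M$, $\eta\in T_x\mathcal M$, $\Theta(x,\eta):=\sqrt{\operatorname{dist}^2(0,\nabla F(x+\eta)+\partial R(x+\eta)+N_x\mathcal M)+\|\eta\|^2}$, and $\Theta_k:=\Theta(x^k,\hat\eta^k)$. One IFO (incremental first-order oracle) call returns first-order information of one component $f_j$; a full gradient costs $n$ IFO calls. IFO complexity is the total number of IFO calls. *)

theory Defs
  imports "HOL-Analysis.Analysis" "HOL-Probability.Probability"
begin

section \<open>Smooth maps and embedded submanifolds\<close>

primrec Ck_on :: "nat \<Rightarrow> 'a::real_normed_vector set \<Rightarrow> ('a \<Rightarrow> 'b::real_normed_vector) \<Rightarrow> bool" where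
  "Ck_on 0 S f \<longleftrightarrow> continuous_on S f"
| "Ck_on (Suc k) S f \<longleftrightarrow> (\<forall>x\<in>S. f differentiable (at x)) \<and>
     (\<forall>v. Ck_on k S (\<lambda>x. frechet_derivative f (at x) v))"

definition smooth_on :: "'a::real_normed_vector set \<Rightarrow> ('a \<Rightarrow> 'b::real_normed_vector) \<Rightarrow> bool" where
  "smooth_on S f \<longleftrightarrow> (\<forall>k. Ck_on k S f)"

text \<open>Smoothness of a map on a set that need not be open (here: the tangent bundle), by local
  smooth extension. The predicate \<open>smooth_on\<close> itself is only used on open sets.\<close>

definition locally_smooth_on :: "'a::real_normed_vector set \<Rightarrow> ('a \<Rightarrow> 'b::real_normed_vector) \<Rightarrow> bool" where
  "locally_smooth_on S f \<longleftrightarrow>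
     (\<forall>s\<in>S. \<exists>W g. open W \<and> s \<in> W \<and> smooth_on W g \<and> (\<forall>y\<in>W \<inter> S. g y = f y))"

definition local_defining_function ::
  "(real^'d) set \<Rightarrow> (real^'d) set \<Rightarrow> (real^'d \<Rightarrow> real^'p) \<Rightarrow> bool" where
  "local_defining_function M W \<psi> \<longleftrightarrow> open W \<and> smooth_on W \<psi> \<and> M \<inter> W = {x \<in> W. \<psi> x = 0} \<and>
     (\<forall>x\<in>M \<inter> W. surj (frechet_derivative \<psi> (at x)))"

text \<open>A finite cover of \<open>M\<close> by sets carrying local defining functions. Being covered by domains of
  local defining functions with values in \<open>\<real>\<^sup>p\<close> is exactly the definition of an embedded submanifold
  of dimension \<open>d - p\<close>, so this also expresses that \<open>M\<close> is one.\<close>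

definition defining_cover :: "(real^'d) set \<Rightarrow> nat set \<Rightarrow> (nat \<Rightarrow> (real^'d) set) \<Rightarrow>
    (nat \<Rightarrow> (real^'d) set) \<Rightarrow> (nat \<Rightarrow> real^'d \<Rightarrow> real^'p) \<Rightarrow> bool" where
  "defining_cover M I V W \<psi> \<longleftrightarrow> finite I \<and> M \<subseteq> (\<Union>i\<in>I. V i) \<and>
     (\<forall>i\<in>I. open (V i) \<and> closure (V i) \<subseteq> W i \<and> local_defining_function M (W i) (\<psi> i))"

text \<open>Velocities at \<open>x\<close> of curves that stay in \<open>M\<close> and are differentiable at the base point.\<close>

definition tangent_space :: "'a::real_normed_vector set \<Rightarrow> 'a \<Rightarrow> 'a set" where
  "tangent_space M x = {v. \<exists>c :: real \<Rightarrow> 'a. c 0 = x \<and> (\<forall>\<^sub>F t in at 0. c t \<in> M) \<and>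
     (c has_vector_derivative v) (at 0)}"

definition normal_space :: "'a::euclidean_space set \<Rightarrow> 'a \<Rightarrow> 'a set" where
  "normal_space M x = orthogonal_comp (tangent_space M x)"

definition tangent_bundle :: "'a::real_normed_vector set \<Rightarrow> ('a \<times> 'a) set" where
  "tangent_bundle M = {(x, \<eta>). x \<in> M \<and> \<eta> \<in> tangent_space M x}"

definition manifold_retraction :: "'a::real_normed_vector set \<Rightarrow> ('a \<Rightarrow> 'a \<Rightarrow> 'a) \<Rightarrow> bool" where
  "manifold_retraction M retr \<longleftrightarrow>
     (\<forall>(x, \<eta>)\<in>tangent_bundle M. retr x \<eta> \<in> M) \<and>
     locally_smooth_on (tangent_bundle M) (\<lambda>(x, \<eta>). retr x \<eta>) \<and>
     (\<forall>x\<in>M. retr x 0 = x \<and> (retr x has_derivative id) (at 0 within tangent_space M x))"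


section \<open>Gradients and convex analysis\<close>

definition gradient :: "('a::real_inner \<Rightarrow> real) \<Rightarrow> 'a \<Rightarrow> 'a" where
  "gradient f x = (THE D. GDERIV f x :> D)"

definition tangent_proj :: "'a::euclidean_space set \<Rightarrow> 'a \<Rightarrow> 'a \<Rightarrow> 'a" where
  "tangent_proj M x = closest_point (tangent_space M x)"

definition rgrad :: "'a::euclidean_space set \<Rightarrow> ('a \<Rightarrow> real) \<Rightarrow> 'a \<Rightarrow> 'a" where
  "rgrad M h x = tangent_proj M x (gradient h x)"

definition subdifferential :: "('a::real_inner \<Rightarrow> real) \<Rightarrow> 'a \<Rightarrow> 'a set" where
  "subdifferential h y = {g. \<forall>z. h y + g \<bullet> (z - y) \<le> h z}"

definition fenchel_conjugate :: "('a::real_inner \<Rightarrow> real) \<Rightarrow> 'a \<Rightarrow> real" where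
  "fenchel_conjugate h y = (SUP v. y \<bullet> v - h v)"

definition prox :: "('a::real_inner \<Rightarrow> real) \<Rightarrow> 'a \<Rightarrow> 'a" where
  "prox h y = (ARG_MIN (\<lambda>z. h z + (norm (z - y))\<^sup>2 / 2) z. True)"

definition finite_avg :: "nat \<Rightarrow> (nat \<Rightarrow> 'a \<Rightarrow> real) \<Rightarrow> 'a \<Rightarrow> real" where
  "finite_avg n f x = (\<Sum>j=1..n. f j x) / real n"

definition admissible_components ::
  "(real^'d) set \<Rightarrow> (real^'d) set \<Rightarrow> real \<Rightarrow> real \<Rightarrow> nat \<Rightarrow> (nat \<Rightarrow> real^'d \<Rightarrow> real) \<Rightarrow> bool" where
  "admissible_components M U Lf Mf n f \<longleftrightarrow> (\<forall>j\<in>{1..n}. Ck_on 1 UNIV (f j) \<and>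
     Lf-lipschitz_on U (gradient (f j)) \<and> (\<forall>x\<in>M. norm (gradient (f j) x) \<le> Mf))"

text \<open>The strongly convex model \<open>F\<^sub>k\<close>, its dual \<open>G\<^sub>k\<close> and the exact tangent step.\<close>

definition model :: "real \<Rightarrow> ('a::real_inner \<Rightarrow> real) \<Rightarrow> 'a \<Rightarrow> 'a \<Rightarrow> 'a \<Rightarrow> real" where
  "model \<alpha> R x m \<eta> = m \<bullet> \<eta> + (norm \<eta>)\<^sup>2 / (2 * \<alpha>) + R (x + \<eta>)"

definition dual_model :: "real \<Rightarrow> ('a::euclidean_space \<Rightarrow> real) \<Rightarrow> ('a \<Rightarrow> 'b::euclidean_space) \<Rightarrow>
    'a \<Rightarrow> 'a \<Rightarrow> 'b \<Rightarrow> real" where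
  "dual_model \<alpha> R B x m \<xi> = fenchel_conjugate (model \<alpha> R x m) (- adjoint B \<xi>)"

definition exact_step :: "'a::euclidean_space set \<Rightarrow> real \<Rightarrow> ('a \<Rightarrow> real) \<Rightarrow> 'a \<Rightarrow> 'a \<Rightarrow> 'a" where
  "exact_step M \<alpha> R x m = (ARG_MIN (model \<alpha> R x m) \<eta>. \<eta> \<in> tangent_space M x)"

definition Theta :: "'a::euclidean_space set \<Rightarrow> ('a \<Rightarrow> real) \<Rightarrow> ('a \<Rightarrow> real) \<Rightarrow> 'a \<Rightarrow> 'a \<Rightarrow> real" where
  "Theta M F R x \<eta> = sqrt ((infdist 0 {gradient F (x + \<eta>) + g + \<nu> | g \<nu>.
       g \<in> subdifferential R (x + \<eta>) \<and> \<nu> \<in> normal_space M x})\<^sup>2 + (norm \<eta>)\<^sup>2)"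


section \<open>Sampling\<close>

text \<open>A batch is the list of the \<open>b\<close> drawn indices, so that sums over it count multiplicity.
  A point \<open>\<omega>\<close> of the sample space is a sequence of batches. No batch is drawn at iteration 0, so
  \<open>\<omega> 0\<close> is never used.\<close>

datatype sampling = With_Replacement | Without_Replacement

primrec batches :: "sampling \<Rightarrow> nat \<Rightarrow> nat \<Rightarrow> nat list set" where
  "batches With_Replacement n b = {js. length js = b \<and> set js \<subseteq> {1..n}}"
| "batches Without_Replacement n b = {js. length js = b \<and> set js \<subseteq> {1..n} \<and> distinct js}"

text \<open>The joint law of the independent uniform batches \<open>\<omega> 1, \<dots>, \<omega> k\<close>; the quantities of
  iteration \<open>k\<close> depend on no other entry of \<open>\<omega>\<close>.\<close>

definition batch_law :: "sampling \<Rightarrow> nat \<Rightarrow> nat \<Rightarrow> nat \<Rightarrow> (nat \<Rightarrow> nat list) pmf" where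
  "batch_law smp n b k = Pi_pmf {1..k} [] (\<lambda>_. pmf_of_set (batches smp n b))"


section \<open>Estimators\<close>

datatype estimator = SVRG | SARAH | SAGA | SAG

text \<open>The stored points \<open>z\<^sub>j\<^sup>k\<close> of SAGA and SAG along the iterates \<open>x\<close> and batches \<open>B\<close>.\<close>

primrec table :: "(nat \<Rightarrow> 'a) \<Rightarrow> (nat \<Rightarrow> nat list) \<Rightarrow> nat \<Rightarrow> nat \<Rightarrow> 'a" where
  "table x B 0 j = x 0"
| "table x B (Suc k) j = (if k \<noteq> 0 \<and> j \<in> set (B k) then x k else table x B k j)"

text \<open>The value prescribed for \<open>u\<^sup>k\<close>, \<open>k \<ge> 1\<close>, in terms of the iterates \<open>x\<close>, the earlier estimates
  \<open>u\<close> and the batches \<open>B\<close>; \<open>b\<close> is the batch size and \<open>q\<close> the epoch length.\<close>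

primrec vr_estimate :: "estimator \<Rightarrow> 'a::euclidean_space set \<Rightarrow> nat \<Rightarrow> (nat \<Rightarrow> 'a \<Rightarrow> real) \<Rightarrow>
    nat \<Rightarrow> nat \<Rightarrow> (nat \<Rightarrow> 'a) \<Rightarrow> (nat \<Rightarrow> 'a) \<Rightarrow> (nat \<Rightarrow> nat list) \<Rightarrow> nat \<Rightarrow> 'a" where
  "vr_estimate SVRG M n f b q x u B k =
     (let P = tangent_proj M (x k); xs = x (k div q * q) in
        P (rgrad M (finite_avg n f) xs) +
        (1 / real b) *\<^sub>R (\<Sum>j\<leftarrow>B k. rgrad M (f j) (x k) - P (rgrad M (f j) xs)))"
| "vr_estimate SARAH M n f b q x u B k =
     (let P = tangent_proj M (x k) in
        if q dvd k then rgrad M (finite_avg n f) (x k)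
        else P (u (k - 1)) +
          (1 / real b) *\<^sub>R (\<Sum>j\<leftarrow>B k. rgrad M (f j) (x k) - P (rgrad M (f j) (x (k - 1)))))"
| "vr_estimate SAGA M n f b q x u B k =
     (let y = (\<lambda>j. gradient (f j) (table x B k j)) in
        tangent_proj M (x k)
          ((1 / real b) *\<^sub>R (\<Sum>j\<leftarrow>B k. gradient (f j) (x k) - y j) +
           (1 / real n) *\<^sub>R (\<Sum>j=1..n. y j)))"
| "vr_estimate SAG M n f b q x u B k =
     (let y = (\<lambda>j. gradient (f j) (table x B k j)) in
        tangent_proj M (x k)
          ((1 / real n) *\<^sub>R (\<Sum>j=1..n. y j) +
           (1 / real n) *\<^sub>R (\<Sum>j\<leftarrow>B k. gradient (f j) (x k) - y j)))"

text \<open>Batch sizes (\<open>\<kappa>b\<close> is used by SAG only) and epoch lengths (used by SVRG and SARAH only).\<close>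

primrec batch_size :: "estimator \<Rightarrow> real \<Rightarrow> nat \<Rightarrow> nat" where
  "batch_size SVRG \<kappa>b n = nat \<lceil>real n powr (2/3)\<rceil>"
| "batch_size SARAH \<kappa>b n = nat \<lceil>real n powr (1/2)\<rceil>"
| "batch_size SAGA \<kappa>b n = nat \<lceil>real n powr (2/3)\<rceil>"
| "batch_size SAG \<kappa>b n = nat \<lceil>\<kappa>b * real n\<rceil>"

primrec epoch_length :: "estimator \<Rightarrow> nat \<Rightarrow> nat" where
  "epoch_length SVRG n = nat \<lceil>real n powr (1/3)\<rceil>"
| "epoch_length SARAH n = nat \<lceil>real n powr (1/2)\<rceil>"
| "epoch_length SAGA n = 1"
| "epoch_length SAG n = 1"

text \<open>IFO calls made in iteration \<open>k\<close>, counting repeated evaluations again: a full gradient costs \<open>n\<close> calls, and a batch of size \<open>b\<close>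
  costs \<open>2 b\<close> calls when the components are evaluated at two points (SVRG, SARAH), and \<open>b\<close> calls
  when the second gradient is read off the table (SAGA, SAG). Iteration 0 evaluates
  \<open>u\<^sup>0 = grad F (x\<^sup>0)\<close> and, for SAGA and SAG, thereby also fills the table. The batch drawn at the start of a SARAH epoch is not evaluated.\<close>

primrec ifo_calls :: "estimator \<Rightarrow> nat \<Rightarrow> nat \<Rightarrow> nat \<Rightarrow> nat \<Rightarrow> nat" where
  "ifo_calls SVRG n b q k = (if q dvd k then n else 0) + (if k = 0 then 0 else 2 * b)"
| "ifo_calls SARAH n b q k = (if q dvd k then n else 2 * b)"
| "ifo_calls SAGA n b q k = (if k = 0 then n else b)"
| "ifo_calls SAG n b q k = (if k = 0 then n else b)"

text \<open>The factor of \<open>\<epsilon>\<^sup>-\<^sup>2\<close> in the IFO complexity.\<close>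

primrec ifo_rate :: "estimator \<Rightarrow> nat \<Rightarrow> real" where
  "ifo_rate SVRG n = real n powr (2/3)"
| "ifo_rate SARAH n = real n powr (1/2)"
| "ifo_rate SAGA n = real n powr (2/3)"
| "ifo_rate SAG n = real n"


section \<open>The algorithm\<close>

text \<open>All quantities of one outer iteration: \<open>x\<^sup>k\<close>, \<open>u\<^sup>k\<close>, the truncated estimate, the transported
  momentum, \<open>m\<^sup>k\<close>, the multiplier, \<open>w\<^sup>k\<close>, \<open>\<eta>\<^sup>k\<close> and the parameters \<open>\<gamma>\<^sub>k\<close>, \<open>\<Delta>\<^sub>k\<close>, \<open>\<chi>\<^sub>k\<close>.\<close>

record ('x, 'l) iterate =
  pt :: 'x
  estim :: 'x
  trunc :: 'x
  mbar :: 'x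
  mom :: 'x
  mult :: 'l
  wvec :: 'x
  tstep :: 'x
  gam :: real
  tol :: real
  chi :: real

text \<open>\<open>B x\<close> is the linear map \<open>B\<^sub>x\<close>. The process \<open>Y k \<omega>\<close> is a run of the algorithm if the equations
  of iteration \<open>k\<close> hold along every possible realization \<open>\<omega> 1, \<dots>, \<omega> k\<close> of the batches. The free
  choices are constrained by the information available when they are made: \<open>\<gamma>\<^sub>k\<close>, \<open>\<Delta>\<^sub>k\<close>, \<open>\<chi>\<^sub>k\<close> may
  depend on \<open>\<omega> 1, \<dots>, \<omega> (k - 1)\<close>, the multiplier also on \<open>\<omega> k\<close>.\<close>

definition iRPMVR_run :: "estimator \<Rightarrow> sampling \<Rightarrow> (real^'d) set \<Rightarrow> (real^'d \<Rightarrow> real^'d \<Rightarrow> real^'p) \<Rightarrow>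
    (real^'d \<Rightarrow> real^'d \<Rightarrow> real^'d) \<Rightarrow> (real^'d \<Rightarrow> real) \<Rightarrow> nat \<Rightarrow> (nat \<Rightarrow> real^'d \<Rightarrow> real) \<Rightarrow> nat \<Rightarrow> nat \<Rightarrow>
    real \<Rightarrow> real \<Rightarrow> real \<Rightarrow> real \<Rightarrow> real \<Rightarrow> real^'d \<Rightarrow>
    (nat \<Rightarrow> (nat \<Rightarrow> nat list) \<Rightarrow> (real^'d, real^'p) iterate) \<Rightarrow> bool" where
  "iRPMVR_run est smp M B retr R n f b q \<alpha> \<gamma> \<Delta>bar \<chi>bar Mu x0 Y \<longleftrightarrow>
     (\<forall>k \<omega> \<omega>'. (\<forall>i\<in>{1..<k}. \<omega> i = \<omega>' i) \<longrightarrow>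
        gam (Y k \<omega>) = gam (Y k \<omega>') \<and> tol (Y k \<omega>) = tol (Y k \<omega>') \<and> chi (Y k \<omega>) = chi (Y k \<omega>')) \<and>
     (\<forall>k \<omega> \<omega>'. (\<forall>i\<in>{1..k}. \<omega> i = \<omega>' i) \<longrightarrow> mult (Y k \<omega>) = mult (Y k \<omega>')) \<and>
     (\<forall>\<omega>. pt (Y 0 \<omega>) = x0 \<and> estim (Y 0 \<omega>) = rgrad M (finite_avg n f) x0 \<and>
        trunc (Y 0 \<omega>) = rgrad M (finite_avg n f) x0 \<and> mbar (Y 0 \<omega>) = rgrad M (finite_avg n f) x0) \<and>
     (\<forall>k \<omega>. (\<forall>i\<in>{1..k}. \<omega> i \<in> batches smp n b) \<longrightarrow>
        (let y = Y k \<omega>; y' = Y (Suc k) \<omega> in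
          gam y \<in> {\<gamma>..1} \<and> tol y \<in> {0..\<Delta>bar} \<and> chi y \<in> {0..\<chi>bar} \<and>
          (k \<noteq> 0 \<longrightarrow>
             estim y = vr_estimate est M n f b q (\<lambda>i. pt (Y i \<omega>)) (\<lambda>i. estim (Y i \<omega>)) \<omega> k \<and>
             trunc y = closest_point (cball 0 Mu) (estim y)) \<and>
          mom y = chi y *\<^sub>R mbar y + (1 - chi y) *\<^sub>R trunc y \<and>
          norm (gradient (dual_model \<alpha> R (B (pt y)) (pt y) (mom y)) (mult y)) \<le> tol y \<and>
          wvec y = prox (\<lambda>z. \<alpha> * R z)
                     (pt y - \<alpha> *\<^sub>R (mom y + adjoint (B (pt y)) (mult y))) - pt y \<and>
          tstep y = tangent_proj M (pt y) (wvec y) \<and>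
          pt y' = retr (pt y) (gam y *\<^sub>R tstep y) \<and>
          mbar y' = tangent_proj M (pt y') (mom y)))"

text \<open>The inner tolerance rule, with \<open>\<eta>\<^sup>-\<^sup>1 = 0\<close>.\<close>

definition tolerance_rule :: "sampling \<Rightarrow> nat \<Rightarrow> nat \<Rightarrow> real \<Rightarrow> real \<Rightarrow> (nat \<Rightarrow> real) \<Rightarrow>
    (nat \<Rightarrow> (nat \<Rightarrow> nat list) \<Rightarrow> ('x::real_normed_vector, 'l) iterate) \<Rightarrow> bool" where
  "tolerance_rule smp n b \<Delta>bar \<kappa> \<sigma> Y \<longleftrightarrow>
     (\<forall>k \<omega>. (\<forall>i\<in>{1..k}. \<omega> i \<in> batches smp n b) \<longrightarrow>
        tol (Y k \<omega>) = min \<Delta>bar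
          (max (\<kappa> * (norm (if k = 0 then 0 else tstep (Y (k - 1) \<omega>)))\<^sup>2) (\<sigma> k)))"

definition expected_Theta_sq :: "sampling \<Rightarrow> (real^'d) set \<Rightarrow> (real^'d \<Rightarrow> real) \<Rightarrow> nat \<Rightarrow>
    (nat \<Rightarrow> real^'d \<Rightarrow> real) \<Rightarrow> nat \<Rightarrow> real \<Rightarrow>
    (nat \<Rightarrow> (nat \<Rightarrow> nat list) \<Rightarrow> (real^'d, 'l) iterate) \<Rightarrow> nat \<Rightarrow> real" where
  "expected_Theta_sq smp M R n f b \<alpha> Y k =
     measure_pmf.expectation (batch_law smp n b k) (\<lambda>\<omega>.
       (Theta M (finite_avg n f) R (pt (Y k \<omega>))
          (exact_step M \<alpha> R (pt (Y k \<omega>)) (mom (Y k \<omega>))))\<^sup>2)"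

end

theory Submission
  imports Defs
begin

text \<open>Each iteration is a descent step for \<open>F + R\<close>: up to the retraction error, the tangent step
  \<open>\<eta>\<^sup>k\<close> lowers the objective by a multiple of \<open>\<parallel>\<eta>\<^sup>k\<parallel>\<^sup>2 / \<alpha>\<close>, at the price of the momentum
  error \<open>\<alpha> \<parallel>m\<^sup>k - grad F(x\<^sup>k)\<parallel>\<^sup>2\<close> and of a term linear in the inner tolerance. The tolerance rule
  bounds the latter by \<open>\<kappa> \<parallel>\<eta>\<^bsup>k-1\<^esup>\<parallel>\<^sup>2 + \<sigma>\<^sub>k\<close>. The momentum contracts its own error by a factor less than
  one and adds the error of the estimator, whose expected sum is, with the prescribed batch sizes and
  epoch lengths, at most a constant independent of \<open>n\<close> times \<open>\<Sum>\<^sub>k E \<parallel>\<eta>\<^sup>k\<parallel>\<^sup>2\<close>. For small \<open>\<alpha>\<close> the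
  descent absorbs all of this, so \<open>\<Sum>\<^sub>k E \<parallel>\<eta>\<^sup>k\<parallel>\<^sup>2\<close>, and with it \<open>\<Sum>\<^sub>k E \<Theta>\<^sub>k\<^sup>2\<close>, is bounded
  uniformly in \<open>n\<close>; the best of the first \<open>K\<close> iterates therefore has \<open>E \<Theta>\<^sub>k\<^sup>2 = O(1/K)\<close>.\<close>

section \<open>Convex subproblems and their duals\<close>

text \<open>Uniformity in \<open>n\<close> dictates the order of quantifiers: every geometric
  constant comes from compactness of \<open>M\<close>, before the components, the estimator and the
  run are fixed. Three obstacles shape the rest. First, the computed step \<open>w\<close> is not
  tangent. The stopping test controls it only through the dual gradient, which is minus
  \<open>B w\<close>; since \<open>B\<close> is bounded below on normal spaces uniformly over
  \<open>M\<close>, the normal part of \<open>w\<close> is of the order of the tolerance. Second,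
  the manifold estimates are local. Truncation bounds the momentum on every path, not merely in
  mean, so a small \<alpha> keeps every step within their range. Third, the bounds on the components
  do not in general control the values of \<open>F\<close> on different connected components of
  \<open>M\<close>, so there is no uniform lower bound for the objective; only its oscillation along
  a path of short steps is bounded. Expectations are finite averages over batch sequences, and
  conditioning on the past becomes redrawing a single batch, which is legitimate because
  \<open>x k\<close> does not depend on batch k.\<close>

lemma closest_point_subspace_in:
  fixes S :: "'a::euclidean_space set"
  assumes "subspace S" shows "closest_point S v \<in> S"
  using assms by (intro closest_point_in_set closed_subspace) (auto dest: subspace_0)

lemma closest_point_subspace_orthogonal:
  fixes S :: "'a::euclidean_space set"
  assumes "subspace S" "y \<in> S" shows "(v - closest_point S v) \<bullet> y = 0"
proof -
  let ?p = "closest_point S v"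
  have p: "?p \<in> S" by (rule closest_point_subspace_in[OF assms(1)])
  have "(v - ?p) \<bullet> (z - ?p) \<le> 0" if "z \<in> S" for z
    by (rule closest_point_dot) (auto simp: assms that subspace_imp_convex closed_subspace)
  from this[of "?p + y"] this[of "?p - y"] show ?thesis
    using p assms by (auto simp: subspace_add subspace_diff)
qed

lemma closest_point_subspace_inner:
  fixes S :: "'a::euclidean_space set"
  assumes "subspace S" "y \<in> S" shows "closest_point S v \<bullet> y = v \<bullet> y"
  using closest_point_subspace_orthogonal[OF assms, of v] by (simp add: inner_diff_left)

lemma closest_point_subspace_unique:
  fixes S :: "'a::euclidean_space set"
  assumes S: "subspace S" and p: "p \<in> S" and o: "\<And>y. y \<in> S \<Longrightarrow> (v - p) \<bullet> y = 0"
  shows "closest_point S v = p"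
proof -
  let ?d = "closest_point S v - p"
  have d: "?d \<in> S" by (simp add: S p closest_point_subspace_in subspace_diff)
  have "?d \<bullet> ?d = (v - p) \<bullet> ?d - (v - closest_point S v) \<bullet> ?d"
    by (simp add: inner_diff_left)
  then show ?thesis using o[OF d] closest_point_subspace_orthogonal[OF S d] by simp
qed

lemma linear_closest_point_subspace:
  fixes S :: "'a::euclidean_space set"
  assumes S: "subspace S" shows "linear (closest_point S)"
proof (rule linearI)
  fix u v show "closest_point S (u + v) = closest_point S u + closest_point S v"
    by (rule closest_point_subspace_unique)
       (auto simp: S closest_point_subspace_in subspace_add inner_diff_left inner_add_left
         closest_point_subspace_inner)
next
  fix r v show "closest_point S (r *\<^sub>R v) = r *\<^sub>R closest_point S v"
    by (rule closest_point_subspace_unique)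
       (auto simp: S closest_point_subspace_in subspace_scale inner_diff_left
         closest_point_subspace_inner)
qed

lemma closest_point_subspace_comp_in:
  fixes S :: "'a::euclidean_space set"
  assumes S: "subspace S" shows "v - closest_point S v \<in> orthogonal_comp S"
  using closest_point_subspace_orthogonal[OF S]
  by (auto simp: orthogonal_comp_def orthogonal_def inner_commute)

lemma closest_point_subspace_pythagoras:
  fixes S :: "'a::euclidean_space set"
  assumes S: "subspace S"
  shows "(norm v)\<^sup>2 = (norm (closest_point S v))\<^sup>2 + (norm (v - closest_point S v))\<^sup>2"
proof -
  have "(v - closest_point S v) \<bullet> closest_point S v = 0"
    by (rule closest_point_subspace_orthogonal[OF S closest_point_subspace_in[OF S]])
  then show ?thesis
    by (simp add: power2_norm_eq_inner inner_diff_left inner_diff_right inner_commute)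
qed

lemma norm_closest_point_subspace_le:
  fixes S :: "'a::euclidean_space set"
  assumes S: "subspace S" shows "norm (closest_point S v) \<le> norm v"
    and "norm (v - closest_point S v) \<le> norm v"
proof -
  have "(norm (closest_point S v))\<^sup>2 \<le> (norm v)\<^sup>2" "(norm (v - closest_point S v))\<^sup>2 \<le> (norm v)\<^sup>2"
    using closest_point_subspace_pythagoras[OF S, of v] by simp_all
  from this[THEN power2_le_imp_le, OF norm_ge_zero]
  show "norm (closest_point S v) \<le> norm v" "norm (v - closest_point S v) \<le> norm v" .
qed

text \<open>The limit as t tends to 0 from the right. It removes the quadratic term from a
  minimality inequality that has been divided by t, and lowers strict epigraph points onto the
  graph.\<close>

lemma nonneg_of_affine_nonneg:
  fixes D c :: real
  assumes "\<And>t. 0 < t \<Longrightarrow> t \<le> 1 \<Longrightarrow> 0 \<le> D + t * c"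
  shows "0 \<le> D"
proof (rule tendsto_lowerbound)
  show "((\<lambda>t. D + t * c) \<longlongrightarrow> D) (at_right 0)"
    by (auto intro!: tendsto_eq_intros)
  show "\<forall>\<^sub>F t in at_right 0. 0 \<le> D + t * c"
    using eventually_at_right_real[of 0 1] by (auto elim!: eventually_mono intro!: assms)
qed simp

section \<open>Optimality conditions and minimizers of the tangent model\<close>

lemma norm_add_scaleR_sq:
  "(norm (w + t *\<^sub>R h))\<^sup>2 = (norm w)\<^sup>2 + 2 * t * (w \<bullet> h) + t\<^sup>2 * (norm (h::'a::real_inner))\<^sup>2"
  unfolding power2_norm_eq_inner
  by (simp add: inner_add_left inner_add_right inner_commute power2_eq_square algebra_simps)

text \<open>The subgradient comes from separating the strict epigraph of \<open>R\<close> from the graph of the affine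
  minorant that minimality provides on the translated subspace.\<close>

lemma subspace_minimizer_kkt:
  fixes R :: "'a::euclidean_space \<Rightarrow> real"
  assumes R: "convex_on UNIV R" and S: "subspace S" and w: "w \<in> S" and \<alpha>: "0 < \<alpha>"
    and min: "\<And>v. v \<in> S \<Longrightarrow> model \<alpha> R x m w \<le> model \<alpha> R x m v"
  obtains g \<nu> where "g \<in> subdifferential R (x + w)" "\<nu> \<in> orthogonal_comp S"
    "m + (1 / \<alpha>) *\<^sub>R w + g + \<nu> = 0"
proof -
  define a where "a = m + (1 / \<alpha>) *\<^sub>R w"
  define z0 where "z0 = x + w"
  \<comment> \<open>Compare \<open>w\<close> with \<open>w + t *\<^sub>R h\<close>: convexity makes
    the change of \<open>R\<close> at most linear in t, and after division by t only the first-order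
    part survives the limit.\<close>
  have minor: "R z0 - a \<bullet> h \<le> R (z0 + h)" if h: "h \<in> S" for h
  proof -
    have "0 \<le> (R (z0 + h) - R z0 + a \<bullet> h) + t * ((norm h)\<^sup>2 / (2 * \<alpha>))" if t: "0 < t" "t \<le> 1" for t
    proof -
      have "w + t *\<^sub>R h \<in> S" using w h S by (simp add: subspace_add subspace_scale)
      from min[OF this] have "m \<bullet> w + (norm w)\<^sup>2 / (2*\<alpha>) + R z0 \<le>
          m \<bullet> (w + t *\<^sub>R h) + (norm (w + t *\<^sub>R h))\<^sup>2 / (2*\<alpha>) + R (z0 + t *\<^sub>R h)"
        by (simp add: model_def z0_def add.assoc)
      moreover have "R (z0 + t *\<^sub>R h) \<le> (1 - t) * R z0 + t * R (z0 + h)"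
      proof -
        have "z0 + t *\<^sub>R h = (1 - t) *\<^sub>R z0 + t *\<^sub>R (z0 + h)" by (simp add: algebra_simps)
        then show ?thesis using convex_onD[OF R, of t z0 "z0 + h"] t by simp
      qed
      moreover have "(norm (w + t *\<^sub>R h))\<^sup>2 / (2*\<alpha>) = (norm w)\<^sup>2 / (2*\<alpha>) + t * ((1/\<alpha>) * (w \<bullet> h))
          + t * (t * ((norm h)\<^sup>2 / (2*\<alpha>)))"
        unfolding norm_add_scaleR_sq using \<alpha> by (simp add: power2_eq_square[of t] field_simps)
      ultimately have "0 \<le> t * (m \<bullet> h) + t * ((1/\<alpha>) * (w \<bullet> h)) + t * (t * ((norm h)\<^sup>2 / (2*\<alpha>)))
          + t * R (z0 + h) - t * R z0"
        by (simp add: inner_add_right left_diff_distrib)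
      also have "\<dots> = t * ((R (z0 + h) - R z0 + a \<bullet> h) + t * ((norm h)\<^sup>2 / (2 * \<alpha>)))"
        by (simp add: a_def inner_add_left distrib_left right_diff_distrib)
      finally show ?thesis using t by (simp add: zero_le_mult_iff)
    qed
    from nonneg_of_affine_nonneg[OF this] show ?thesis by simp
  qed
  define A where "A = {(z, t). R z < t}"
  define C where "C = (\<lambda>h. (z0 + h, R z0 - a \<bullet> h)) ` S"
  have "convex A"
  proof (rule convexI)
    fix p q :: "'a \<times> real" and u v :: real
    assume p: "p \<in> A" and q: "q \<in> A" and uv: "0 \<le> u" "0 \<le> v" "u + v = 1"
    have "R (u *\<^sub>R fst p + v *\<^sub>R fst q) \<le> u * R (fst p) + v * R (fst q)"
      using R uv unfolding convex_on_def by auto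
    also have "\<dots> < u * snd p + v * snd q"
    proof (cases "u = 0")
      case True then show ?thesis using uv q by (auto simp: A_def)
    next
      case False
      then have "u * R (fst p) < u * snd p" using uv p by (auto simp: A_def)
      moreover have "v * R (fst q) \<le> v * snd q" using uv q by (auto simp: A_def intro!: mult_left_mono)
      ultimately show ?thesis by simp
    qed
    finally show "u *\<^sub>R p + v *\<^sub>R q \<in> A" by (cases p; cases q) (simp add: A_def)
  qed
  moreover have "convex C"
  proof -
    have "C = (\<lambda>y. (z0, R z0) + y) ` ((\<lambda>h. (h, - (a \<bullet> h))) ` S)"
      by (auto simp: C_def image_image)
    moreover have "linear (\<lambda>h. (h, - (a \<bullet> h)))"
      by (rule linearI) (auto simp: inner_add_right)
    ultimately show ?thesis
      by (simp add: convex_translation_eq convex_linear_image subspace_imp_convex S)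
  qed
  moreover have "(0, R 0 + 1) \<in> A" by (simp add: A_def)
  then have "A \<noteq> {}" by blast
  moreover have "C \<noteq> {}" using w by (auto simp: C_def)
  moreover have "A \<inter> C = {}" by (auto simp: A_def C_def dest!: minor)
  ultimately obtain P b where P: "P \<noteq> 0" "\<forall>y\<in>A. P \<bullet> y \<le> b" "\<forall>y\<in>C. P \<bullet> y \<ge> b"
    using separating_hyperplane_sets[of A C] by auto
  obtain p \<tau> where pt: "P = (p, \<tau>)" by (cases P)
  have up: "p \<bullet> z + \<tau> * t \<le> b" if "R z < t" for z t
    using P(2) that by (auto simp: A_def pt)
  have lo: "p \<bullet> (z0 + h) + \<tau> * (R z0 - a \<bullet> h) \<ge> b" if "h \<in> S" for h
    using P(3) that by (auto simp: C_def pt)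
  \<comment> \<open>The epigraph is unbounded upwards, so a positive vertical component would exceed
    the separating level \<open>b\<close> above \<open>z0\<close>.\<close>
  have "\<tau> \<le> 0"
  proof (rule ccontr)
    assume "\<not> \<tau> \<le> 0"
    then have "\<tau> > 0" by simp
    define t where "t = \<bar>b - p \<bullet> z0\<bar> / \<tau> + \<bar>R z0\<bar> + 1"
    have "p \<bullet> z0 + \<tau> * t \<le> b"
    proof (rule up)
      have "0 \<le> \<bar>b - p \<bullet> z0\<bar> / \<tau>" using \<open>\<tau> > 0\<close> by simp
      then show "R z0 < t" unfolding t_def by linarith
    qed
    moreover have "\<tau> * t = \<bar>b - p \<bullet> z0\<bar> + \<tau> * (\<bar>R z0\<bar> + 1)"
      using \<open>\<tau> > 0\<close> by (simp add: t_def field_simps)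
    moreover have "\<tau> * (\<bar>R z0\<bar> + 1) > 0" using \<open>\<tau> > 0\<close> by (simp add: add_nonneg_pos)
    ultimately show False by linarith
  qed
  \<comment> \<open>A vertical hyperplane is impossible because \<open>R\<close> is finite
    everywhere: a nonzero linear functional would be bounded on the whole space.\<close>
  moreover have "\<tau> \<noteq> 0"
  proof
    assume "\<tau> = 0"
    then have pb: "p \<bullet> z \<le> b" for z using up[of z "R z + 1"] by simp
    have "p \<bullet> p > 0" using P(1) pt \<open>\<tau> = 0\<close> by (simp add: zero_prod_def)
    then show False using pb[of "((\<bar>b\<bar> + 1) / (p \<bullet> p)) *\<^sub>R p"] by simp
  qed
  ultimately have \<tau>: "\<tau> < 0" by simp
  define g where "g = (1 / (-\<tau>)) *\<^sub>R p"
  have p: "p = (-\<tau>) *\<^sub>R g" using \<tau> by (simp add: g_def)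
  have up': "p \<bullet> z + \<tau> * R z \<le> b" for z
  proof -
    have "0 \<le> (b - p \<bullet> z - \<tau> * R z) + t * (-\<tau>)" if "0 < t" for t
      using up[of z "R z + t"] that by (simp add: algebra_simps)
    then show ?thesis using nonneg_of_affine_nonneg[of "b - p \<bullet> z - \<tau> * R z" "-\<tau>"] by auto
  qed
  have "p \<bullet> z0 + \<tau> * R z0 \<ge> b" using lo[of 0] S by (simp add: subspace_0)
  from order_trans[OF up' this]
  have "p \<bullet> z + \<tau> * R z \<le> p \<bullet> z0 + \<tau> * R z0" for z .
  then have "(-\<tau>) * (g \<bullet> z - R z) \<le> (-\<tau>) * (g \<bullet> z0 - R z0)" for z
    unfolding p by (simp add: algebra_simps)
  then have "g \<bullet> z - R z \<le> g \<bullet> z0 - R z0" for z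
    using \<tau> by (simp only: mult_le_cancel_left_pos neg_0_less_iff_less)
  then have sub: "g \<in> subdifferential R (x + w)"
    unfolding subdifferential_def z0_def[symmetric] by (auto simp: inner_diff_right algebra_simps)
  have ge: "(g + a) \<bullet> h \<ge> 0" if "h \<in> S" for h
  proof -
    have "p \<bullet> (z0 + h) + \<tau> * (R z0 - a \<bullet> h) \<ge> p \<bullet> z0 + \<tau> * R z0"
      using lo[OF that] up'[of z0] by simp
    then have "(-\<tau>) * ((g + a) \<bullet> h) \<ge> 0"
      unfolding p by (simp add: algebra_simps inner_add_left)
    then show ?thesis using \<tau> by (simp add: mult_le_0_iff)
  qed
  have ort: "(g + a) \<bullet> h = 0" if "h \<in> S" for h
    using ge[OF that] ge[OF subspace_neg[OF S that]] by simp
  show ?thesis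
  proof (rule that[OF sub])
    show "- (g + a) \<in> orthogonal_comp S"
      unfolding orthogonal_comp_def orthogonal_def
      using ort by (auto simp: inner_commute[of _ "g + a"] simp del: minus_add_distrib)
    show "m + (1 / \<alpha>) *\<^sub>R w + g + - (g + a) = 0" by (simp add: a_def)
  qed
qed

text \<open>Test the subgradient inequality at \<open>z + g\<close>, where the Lipschitz bound caps
  the increase of \<open>R\<close>.\<close>

lemma norm_subgradient_le:
  fixes R :: "'a::euclidean_space \<Rightarrow> real"
  assumes "LR-lipschitz_on UNIV R" "g \<in> subdifferential R z"
  shows "norm g \<le> LR"
proof (cases "g = 0")
  case True then show ?thesis using assms by (simp add: lipschitz_on_nonneg)
next
  case False
  have "R z + g \<bullet> g \<le> R (z + g)" using assms(2) by (auto simp: subdifferential_def dest: spec[of _ "z+g"])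
  moreover have "\<bar>R (z + g) - R z\<bar> \<le> LR * norm g"
    using lipschitz_onD[OF assms(1), of "z+g" z] by (simp add: dist_norm)
  ultimately have "norm g * norm g \<le> LR * norm g"
    by (simp add: dot_square_norm power2_eq_square)
  then show ?thesis using False by simp
qed

lemma model_minimizer_exists:
  fixes R :: "'a::euclidean_space \<Rightarrow> real"
  assumes R: "LR-lipschitz_on UNIV R" and S: "subspace S" and \<alpha>: "0 < \<alpha>"
  obtains w where "w \<in> S" "\<And>v. v \<in> S \<Longrightarrow> model \<alpha> R x m w \<le> model \<alpha> R x m v"
proof -
  \<comment> \<open>Beyond this radius the quadratic term beats
    \<open>(norm m + LR) * norm v\<close>, so the model is at least \<open>R x\<close>, its value at
    0, and only a compact set has to be searched.\<close>
  define \<rho> where "\<rho> = 2 * \<alpha> * (norm m + LR)"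
  have LR: "0 \<le> LR" using R by (rule lipschitz_on_nonneg)
  have \<rho>: "0 \<le> \<rho>" using \<alpha> LR by (simp add: \<rho>_def)
  have contR: "continuous_on UNIV R" by (rule lipschitz_on_continuous_on[OF R])
  have "continuous_on (S \<inter> cball 0 \<rho>) (\<lambda>v. R (x + v))"
    by (rule continuous_on_compose2[OF contR]) (auto intro!: continuous_intros)
  then have cont: "continuous_on (S \<inter> cball 0 \<rho>) (model \<alpha> R x m)"
    using \<alpha> unfolding model_def by (auto intro!: continuous_intros)
  have comp: "compact (S \<inter> cball 0 \<rho>)" by (simp add: S closed_Int_compact closed_subspace)
  have z: "0 \<in> S \<inter> cball 0 \<rho>" using S \<rho> by (simp add: subspace_0)
  then have ne: "S \<inter> cball 0 \<rho> \<noteq> {}" by blast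
  obtain w where w: "w \<in> S \<inter> cball 0 \<rho>"
    "\<forall>v\<in>S \<inter> cball 0 \<rho>. model \<alpha> R x m w \<le> model \<alpha> R x m v"
    using continuous_attains_inf[OF comp ne cont] by blast
  have "model \<alpha> R x m w \<le> model \<alpha> R x m v" if v: "v \<in> S" for v
  proof (cases "norm v \<le> \<rho>")
    case True then show ?thesis using w v by auto
  next
    case False
    have "\<bar>R (x + v) - R x\<bar> \<le> LR * norm v"
      using lipschitz_onD[OF R, of "x+v" x] by (simp add: dist_norm)
    moreover have "- (m \<bullet> v) \<le> norm m * norm v" using norm_cauchy_schwarz[of "-m" v] by simp
    moreover have "(norm m + LR) * norm v \<le> (norm v)\<^sup>2 / (2*\<alpha>)"
    proof -
      have "2 * \<alpha> * (norm m + LR) * norm v \<le> norm v * norm v"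
        using False unfolding \<rho>_def by (intro mult_right_mono) auto
      then show ?thesis using \<alpha> by (simp add: power2_eq_square field_simps)
    qed
    ultimately have "R x \<le> model \<alpha> R x m v" by (simp add: model_def algebra_simps)
    moreover have "model \<alpha> R x m w \<le> R x"
      using bspec[OF w(2) z] by (simp add: model_def)
    ultimately show ?thesis by simp
  qed
  then show ?thesis using w that by blast
qed

text \<open>The unconstrained case of the optimality system, in which the normal vector is
  orthogonal to itself and vanishes.\<close>

lemma minimizer_subgradient:
  fixes R :: "'a::euclidean_space \<Rightarrow> real"
  assumes R: "convex_on UNIV R" and \<alpha>: "0 < \<alpha>"
    and min: "\<And>v. model \<alpha> R x m w \<le> model \<alpha> R x m v"
  shows "- (m + (1 / \<alpha>) *\<^sub>R w) \<in> subdifferential R (x + w)"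
proof -
  obtain g \<nu> where g: "g \<in> subdifferential R (x + w)" "\<nu> \<in> orthogonal_comp UNIV"
    "m + (1 / \<alpha>) *\<^sub>R w + g + \<nu> = 0"
    by (rule subspace_minimizer_kkt[OF R subspace_UNIV UNIV_I \<alpha> min])
  have "\<nu> \<bullet> \<nu> = 0" using g(2) by (simp add: orthogonal_comp_def orthogonal_def)
  then have "g = - (m + (1 / \<alpha>) *\<^sub>R w)" using g(3) by (simp add: add_eq_0_iff)
  then show ?thesis using g(1) by simp
qed

lemma subdifferential_monotone:
  assumes "g \<in> subdifferential R y" "h \<in> subdifferential R z"
  shows "0 \<le> (g - h) \<bullet> (y - z)"
proof -
  have "R y + g \<bullet> (z - y) \<le> R z" "R z + h \<bullet> (y - z) \<le> R y"
    using assms by (auto simp: subdifferential_def)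
  then show ?thesis by (simp add: inner_diff_left inner_diff_right)
qed

text \<open>Monotonicity of the subdifferential, together with the strong convexity from the
  quadratic term, makes the minimizer depend Lipschitz continuously on the linear term. This is what
  makes the dual function differentiable.\<close>

lemma minimizer_lipschitz:
  fixes R :: "'a::euclidean_space \<Rightarrow> real"
  assumes R: "convex_on UNIV R" and \<alpha>: "0 < \<alpha>"
    and w: "\<And>v. model \<alpha> R x m w \<le> model \<alpha> R x m v"
    and w': "\<And>v. model \<alpha> R x m' w' \<le> model \<alpha> R x m' v"
  shows "norm (w' - w) \<le> \<alpha> * norm (m' - m)"
proof -
  have "0 \<le> (- (m' + (1 / \<alpha>) *\<^sub>R w') - - (m + (1 / \<alpha>) *\<^sub>R w)) \<bullet> ((x + w') - (x + w))"
    by (intro subdifferential_monotone[of _ R] minimizer_subgradient assms)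
  also have "\<dots> = - ((m' - m) \<bullet> (w' - w)) - (1/\<alpha>) * (norm (w' - w))\<^sup>2"
    by (simp add: power2_norm_eq_inner algebra_simps inner_diff_left inner_diff_right)
  finally have "(norm (w' - w))\<^sup>2 \<le> \<alpha> * (- ((m' - m) \<bullet> (w' - w)))"
    using \<alpha> by (simp add: field_simps)
  also have "\<dots> \<le> \<alpha> * (norm (m' - m) * norm (w' - w))"
using \<alpha> Cauchy_Schwarz_ineq2[of "m' - m" "w' - w"] by (intro mult_left_mono) (linarith, simp)
  finally have "norm (w' - w) * norm (w' - w) \<le> (\<alpha> * norm (m' - m)) * norm (w' - w)"
    by (simp add: power2_eq_square)
  then show ?thesis using \<alpha> by (cases "w' = w") auto
qed

section \<open>Proximal step and gradient of the dual function\<close>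

lemma gradient_eqI: assumes "GDERIV f x :> D" shows "gradient f x = D"
  unfolding gradient_def
proof (rule the_equality)
  show "GDERIV f x :> D" by (rule assms)
  fix D' assume "GDERIV f x :> D'"
  then have "(\<lambda>h. h \<bullet> D') = (\<lambda>h. h \<bullet> D)"
    using has_derivative_unique[OF _ assms[unfolded gderiv_def]] unfolding gderiv_def by simp
  then have "(D' - D) \<bullet> D' = (D' - D) \<bullet> D" by (rule fun_cong)
  then have "(D' - D) \<bullet> (D' - D) = 0" by (simp add: inner_diff_right)
  then show "D' = D" by simp
qed

lemma GDERIV_of_quadratic_bound:
  fixes f :: "'a::real_inner \<Rightarrow> real"
  assumes "\<And>y. \<bar>f y - f x - (y - x) \<bullet> D\<bar> \<le> C * (norm (y - x))\<^sup>2"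
  shows "GDERIV f x :> D"
  unfolding gderiv_def has_derivative_within
proof (intro conjI)
  show "bounded_linear (\<lambda>h. h \<bullet> D)" by (rule bounded_linear_inner_left)
  show "((\<lambda>y. (1 / norm (y - x)) *\<^sub>R (f y - (f x + (y - x) \<bullet> D))) \<longlongrightarrow> 0) (at x)"
  proof (rule Lim_null_comparison)
    show "\<forall>\<^sub>F y in at x. norm ((1 / norm (y - x)) *\<^sub>R (f y - (f x + (y - x) \<bullet> D))) \<le> C * norm (y - x)"
    proof (rule eventually_at_topological[THEN iffD2], intro exI[of _ UNIV], safe)
      fix y assume "y \<noteq> x"
      then show "norm ((1 / norm (y - x)) *\<^sub>R (f y - (f x + (y - x) \<bullet> D))) \<le> C * norm (y - x)"
        using assms[of y] by (simp add: field_simps power2_eq_square)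
    qed auto
    show "((\<lambda>y. C * norm (y - x)) \<longlongrightarrow> 0) (at x)"
      by (auto intro!: tendsto_eq_intros)
  qed
qed

text \<open>Completing the square turns the objective of \<open>prox\<close> into \<alpha> times the
  model plus a constant. Since \<open>prox\<close> is a choice, existence of a minimizer has to be
  supplied first.\<close>

lemma prox_step_minimizes:
  fixes R :: "'a::euclidean_space \<Rightarrow> real"
  assumes L: "LR-lipschitz_on UNIV R" and \<alpha>: "0 < \<alpha>"
  shows "model \<alpha> R x m (prox (\<lambda>z. \<alpha> * R z) (x - \<alpha> *\<^sub>R m) - x) \<le> model \<alpha> R x m v"
proof -
  have eq: "\<alpha> * R z + (norm (z - (x - \<alpha> *\<^sub>R m)))\<^sup>2 / 2 =
      \<alpha> * model \<alpha> R x m (z - x) + \<alpha>\<^sup>2 * (norm m)\<^sup>2 / 2" for z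
  proof -
    have "z - (x - \<alpha> *\<^sub>R m) = (z - x) + \<alpha> *\<^sub>R m" by simp
    then have "(norm (z - (x - \<alpha> *\<^sub>R m)))\<^sup>2 = (norm (z - x))\<^sup>2 + 2 * \<alpha> * ((z - x) \<bullet> m) + \<alpha>\<^sup>2 * (norm m)\<^sup>2"
      by (simp only: norm_add_scaleR_sq)
    then show ?thesis using \<alpha> by (simp add: model_def inner_commute field_simps)
  qed
  obtain w where w: "\<And>v. model \<alpha> R x m w \<le> model \<alpha> R x m v"
    using model_minimizer_exists[OF L subspace_UNIV \<alpha>] by auto
  let ?h = "\<lambda>z. \<alpha> * R z + (norm (z - (x - \<alpha> *\<^sub>R m)))\<^sup>2 / 2"
  have "is_arg_min ?h (\<lambda>_. True) (x + w)"
    unfolding is_arg_min_linorder eq using w \<alpha> by simp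
  then have "is_arg_min ?h (\<lambda>_. True) (prox (\<lambda>z. \<alpha> * R z) (x - \<alpha> *\<^sub>R m))"
    unfolding prox_def arg_min_def by (rule someI)
  then have "?h (prox (\<lambda>z. \<alpha> * R z) (x - \<alpha> *\<^sub>R m)) \<le> ?h (x + v)"
    unfolding is_arg_min_linorder by blast
  then show ?thesis unfolding eq using \<alpha> by simp
qed

text \<open>Danskin's argument: the dual value is minus the optimal model value with linear term
  \<open>m + adjoint B \<xi>\<close>, and the minimizer moves Lipschitz continuously with \<xi>, so
  the linearization error is quadratic. The inner stopping test thereby becomes a bound on
  \<open>B w\<close>.\<close>

lemma gradient_dual_model:
  fixes R :: "'a::euclidean_space \<Rightarrow> real" and B :: "'a \<Rightarrow> 'b::euclidean_space"
  assumes R: "convex_on UNIV R" and L: "LR-lipschitz_on UNIV R" and \<alpha>: "0 < \<alpha>" and B: "linear B"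
    and w: "\<And>v. model \<alpha> R x (m + adjoint B \<xi>) w \<le> model \<alpha> R x (m + adjoint B \<xi>) v"
  shows "gradient (dual_model \<alpha> R B x m) \<xi> = - B w"
proof (rule gradient_eqI, rule GDERIV_of_quadratic_bound)
  let ?M = "\<lambda>\<zeta>. model \<alpha> R x (m + adjoint B \<zeta>)"
  have G: "dual_model \<alpha> R B x m \<zeta> = - ?M \<zeta> u" if "\<And>v. ?M \<zeta> u \<le> ?M \<zeta> v" for \<zeta> u
  proof -
    have e: "- adjoint B \<zeta> \<bullet> v - model \<alpha> R x m v = - ?M \<zeta> v" for v
      by (simp add: model_def inner_add_left)
    show ?thesis unfolding dual_model_def fenchel_conjugate_def e
      by (rule cSup_eq_maximum) (use that in auto)
  qed
  have lin: "?M \<zeta>' v = ?M \<zeta> v + (\<zeta>' - \<zeta>) \<bullet> B v" for \<zeta> \<zeta>' v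
  proof -
    have "adjoint B c \<bullet> v = c \<bullet> B v" for c using adjoint_works[OF B, of v c] by (simp add: inner_commute)
    then show ?thesis by (simp add: model_def inner_add_left inner_diff_left)
  qed
  have bB: "bounded_linear B" using B by (simp add: linear_conv_bounded_linear)
  have bA: "bounded_linear (adjoint B)" using adjoint_linear[OF B] by (simp add: linear_conv_bounded_linear)
  fix \<zeta>
  obtain u where u: "\<And>v. ?M \<zeta> u \<le> ?M \<zeta> v"
    using model_minimizer_exists[OF L subspace_UNIV \<alpha>] by auto
  \<comment> \<open>Each minimizer is a competitor in the problem of the other; the two tests
    enclose the dual increment between linear terms in \<open>B w\<close> and
    \<open>B u\<close>.\<close>
  have lo: "?M \<zeta> u \<le> ?M \<xi> w + (\<zeta> - \<xi>) \<bullet> B w" using u[of w] lin[of \<zeta> w \<xi>] by simp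
  have up: "?M \<xi> w + (\<zeta> - \<xi>) \<bullet> B u \<le> ?M \<zeta> u" using w[of u] lin[of \<zeta> u \<xi>] by simp
  have "norm (u - w) \<le> \<alpha> * norm ((m + adjoint B \<zeta>) - (m + adjoint B \<xi>))"
    by (rule minimizer_lipschitz[OF R \<alpha> w u])
  also have "(m + adjoint B \<zeta>) - (m + adjoint B \<xi>) = adjoint B (\<zeta> - \<xi>)"
    by (simp add: linear_diff[OF adjoint_linear[OF B]])
  also have "norm (adjoint B (\<zeta> - \<xi>)) \<le> onorm (adjoint B) * norm (\<zeta> - \<xi>)" by (rule onorm[OF bA])
  finally have uw: "norm (u - w) \<le> \<alpha> * (onorm (adjoint B) * norm (\<zeta> - \<xi>))" using \<alpha> by simp
  have "\<bar>dual_model \<alpha> R B x m \<zeta> - dual_model \<alpha> R B x m \<xi> - (\<zeta> - \<xi>) \<bullet> - B w\<bar> =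
      ?M \<xi> w + (\<zeta> - \<xi>) \<bullet> B w - ?M \<zeta> u"
    using lo by (simp add: G[OF w] G[OF u])
  also have "\<dots> \<le> - ((\<zeta> - \<xi>) \<bullet> B (u - w))" using up by (simp add: linear_diff[OF B] inner_diff_right)
  also have "\<dots> \<le> norm (\<zeta> - \<xi>) * norm (B (u - w))"
    using Cauchy_Schwarz_ineq2[of "\<zeta> - \<xi>" "B (u - w)"] by linarith
  also have "\<dots> \<le> norm (\<zeta> - \<xi>) * (onorm B * (\<alpha> * (onorm (adjoint B) * norm (\<zeta> - \<xi>))))"
  proof (intro mult_left_mono)
    have "norm (B (u - w)) \<le> onorm B * norm (u - w)" by (rule onorm[OF bB])
    also have "\<dots> \<le> onorm B * (\<alpha> * (onorm (adjoint B) * norm (\<zeta> - \<xi>)))"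
      by (intro mult_left_mono uw onorm_pos_le[OF bB])
    finally show "norm (B (u - w)) \<le> \<dots>" .
  qed simp
  finally show "\<bar>dual_model \<alpha> R B x m \<zeta> - dual_model \<alpha> R B x m \<xi> - (\<zeta> - \<xi>) \<bullet> - B w\<bar>
      \<le> (onorm B * \<alpha> * onorm (adjoint B)) * (norm (\<zeta> - \<xi>))\<^sup>2"
    by (simp add: power2_eq_square mult_ac)
qed

section \<open>Exact and inexact tangent steps\<close>

lemma exact_step_minimizes:
  fixes R :: "'a::euclidean_space \<Rightarrow> real"
  assumes L: "LR-lipschitz_on UNIV R" and \<alpha>: "0 < \<alpha>" and S: "subspace (tangent_space M x)"
  shows "exact_step M \<alpha> R x m \<in> tangent_space M x"
    and "\<And>v. v \<in> tangent_space M x \<Longrightarrow> model \<alpha> R x m (exact_step M \<alpha> R x m) \<le> model \<alpha> R x m v"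
proof -
  obtain w where "w \<in> tangent_space M x"
    "\<And>v. v \<in> tangent_space M x \<Longrightarrow> model \<alpha> R x m w \<le> model \<alpha> R x m v"
    using model_minimizer_exists[OF L S \<alpha>] by blast
  then have "is_arg_min (model \<alpha> R x m) (\<lambda>\<eta>. \<eta> \<in> tangent_space M x) w"
    by (auto simp: is_arg_min_linorder)
  then have "is_arg_min (model \<alpha> R x m) (\<lambda>\<eta>. \<eta> \<in> tangent_space M x) (exact_step M \<alpha> R x m)"
    unfolding exact_step_def arg_min_def by (rule someI)
  then show "exact_step M \<alpha> R x m \<in> tangent_space M x"
    and "\<And>v. v \<in> tangent_space M x \<Longrightarrow> model \<alpha> R x m (exact_step M \<alpha> R x m) \<le> model \<alpha> R x m v"
    by (auto simp: is_arg_min_linorder)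
qed

text \<open>Test the optimality system with \<open>w\<close> itself, which removes the normal term.
  The bound keeps the exact step inside the region where gradients are Lipschitz.\<close>

lemma norm_subspace_minimizer_le:
  fixes R :: "'a::euclidean_space \<Rightarrow> real"
  assumes R: "convex_on UNIV R" and L: "LR-lipschitz_on UNIV R" and \<alpha>: "0 < \<alpha>"
    and S: "subspace S" and w: "w \<in> S"
    and min: "\<And>v. v \<in> S \<Longrightarrow> model \<alpha> R x m w \<le> model \<alpha> R x m v"
  shows "norm w \<le> \<alpha> * (norm m + LR)"
proof -
  obtain g \<nu> where g: "g \<in> subdifferential R (x + w)" "\<nu> \<in> orthogonal_comp S"
    "m + (1 / \<alpha>) *\<^sub>R w + g + \<nu> = 0"
    by (rule subspace_minimizer_kkt[OF R S w \<alpha> min])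
  have "\<nu> \<bullet> w = 0" using g(2) w by (simp add: orthogonal_comp_def orthogonal_def inner_commute[of \<nu>])
  moreover have "(m + (1 / \<alpha>) *\<^sub>R w + g + \<nu>) \<bullet> w = 0" by (simp add: g(3))
  ultimately have "(norm w)\<^sup>2 = - \<alpha> * ((m + g) \<bullet> w)"
    using \<alpha> by (simp add: inner_add_left power2_norm_eq_inner field_simps)
  also have "\<dots> \<le> \<alpha> * (norm (m + g) * norm w)"
    using Cauchy_Schwarz_ineq2[of "m + g" w] \<alpha> mult_left_mono[of "- ((m + g) \<bullet> w)" "norm (m + g) * norm w" \<alpha>]
    by simp
  also have "\<dots> \<le> \<alpha> * ((norm m + LR) * norm w)"
    using \<alpha> norm_triangle_ineq[of m g] norm_subgradient_le[OF L g(1)]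
    by (intro mult_left_mono mult_right_mono) auto
  finally have "norm w * norm w \<le> (\<alpha> * (norm m + LR)) * norm w" by (simp add: power2_eq_square mult_ac)
  then show ?thesis using \<alpha> lipschitz_on_nonneg[OF L] by (cases "w = 0") auto
qed

lemma sum3_sq_le: "(a + b + c)\<^sup>2 \<le> 3 * a\<^sup>2 + 3 * b\<^sup>2 + 3 * (c::real)\<^sup>2"
proof -
  have "0 \<le> (a - b)\<^sup>2 + (a - c)\<^sup>2 + (b - c)\<^sup>2" by simp
  then show ?thesis by (simp add: power2_eq_square algebra_simps)
qed

text \<open>The optimality system of the exact step supplies an element of the set whose distance to
  0 enters \<open>Theta\<close>. What remains of it is the change of the gradient along the step,
  the momentum error and \<open>\<eta>\<close> over \<alpha>, whence the three squares.\<close>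

lemma Theta_exact_step_le:
  fixes R F :: "'a::euclidean_space \<Rightarrow> real" and x m :: 'a
  assumes R: "convex_on UNIV R" and L: "LR-lipschitz_on UNIV R" and \<alpha>: "0 < \<alpha>"
    and S: "subspace (tangent_space M x)"
  defines "\<eta> \<equiv> exact_step M \<alpha> R x m"
  assumes lip: "norm (gradient F (x + \<eta>) - gradient F x) \<le> Lf * norm \<eta>"
  shows "(Theta M F R x \<eta>)\<^sup>2 \<le> (3 * Lf\<^sup>2 + 3 / \<alpha>\<^sup>2 + 1) * (norm \<eta>)\<^sup>2 + 3 * (norm (m - rgrad M F x))\<^sup>2"
proof -
  note e = exact_step_minimizes[OF L \<alpha> S, where m = m, folded \<eta>_def]
  obtain g \<nu> where g: "g \<in> subdifferential R (x + \<eta>)" "\<nu> \<in> orthogonal_comp (tangent_space M x)"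
    "m + (1 / \<alpha>) *\<^sub>R \<eta> + g + \<nu> = 0"
    by (rule subspace_minimizer_kkt[OF R S e(1) \<alpha> e(2)])
  \<comment> \<open>Normal vectors are free in \<open>Theta\<close>; subtracting the normal part of
    the Euclidean gradient exchanges that gradient for \<open>rgrad\<close>.\<close>
  let ?\<nu> = "\<nu> - (gradient F x - rgrad M F x)"
  let ?A = "{gradient F (x + \<eta>) + g + \<nu> | g \<nu>. g \<in> subdifferential R (x + \<eta>) \<and> \<nu> \<in> normal_space M x}"
  let ?v = "gradient F (x + \<eta>) + g + ?\<nu>"
  have "?\<nu> \<in> normal_space M x"
    unfolding normal_space_def rgrad_def tangent_proj_def
    by (rule subspace_diff[OF subspace_orthogonal_comp g(2) closest_point_subspace_comp_in[OF S]])
  then have "?v \<in> ?A" using g(1) by blast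
  have n1: "norm (rgrad M F x - m) = norm (m - rgrad M F x)" by (rule norm_minus_commute)
  have n2: "norm (- ((1 / \<alpha>) *\<^sub>R \<eta>)) = norm \<eta> / \<alpha>" using \<alpha> by simp
  have "infdist 0 ?A \<le> norm ?v" using infdist_le[OF \<open>?v \<in> ?A\<close>, of 0] by simp
  also have "?v = (gradient F (x + \<eta>) - gradient F x) + (rgrad M F x - m) + - ((1 / \<alpha>) *\<^sub>R \<eta>)"
  proof -
    have "g + \<nu> = (m + (1 / \<alpha>) *\<^sub>R \<eta> + g + \<nu>) - m - (1 / \<alpha>) *\<^sub>R \<eta>" by simp
    then have gn: "g + \<nu> = - m - (1 / \<alpha>) *\<^sub>R \<eta>" unfolding g(3) by simp
    have "?v = (gradient F (x + \<eta>) - gradient F x + rgrad M F x) + (g + \<nu>)"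
      by (simp add: algebra_simps)
    then show ?thesis unfolding gn by simp
  qed
  also have "norm \<dots> \<le> Lf * norm \<eta> + norm (m - rgrad M F x) + norm \<eta> / \<alpha>"
    using lip n1 n2 norm_triangle_ineq[of "(gradient F (x + \<eta>) - gradient F x) + (rgrad M F x - m)" "- ((1 / \<alpha>) *\<^sub>R \<eta>)"]
      norm_triangle_ineq[of "gradient F (x + \<eta>) - gradient F x" "rgrad M F x - m"]
    by linarith
  finally have "(infdist 0 ?A)\<^sup>2 \<le> (Lf * norm \<eta> + norm (m - rgrad M F x) + norm \<eta> / \<alpha>)\<^sup>2"
    by (intro power_mono infdist_nonneg)
  also have "\<dots> \<le> 3 * (Lf * norm \<eta>)\<^sup>2 + 3 * (norm (m - rgrad M F x))\<^sup>2 + 3 * (norm \<eta> / \<alpha>)\<^sup>2"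
    by (rule sum3_sq_le)
  finally have le: "(infdist 0 ?A)\<^sup>2 \<le> 3 * (Lf * norm \<eta>)\<^sup>2 + 3 * (norm (m - rgrad M F x))\<^sup>2 + 3 * (norm \<eta> / \<alpha>)\<^sup>2" .
  have "(Theta M F R x \<eta>)\<^sup>2 = (infdist 0 ?A)\<^sup>2 + (norm \<eta>)\<^sup>2"
    unfolding Theta_def by (rule real_sqrt_pow2) simp
  then show ?thesis using le by (simp only: power_mult_distrib power_divide) (simp add: distrib_right)
qed

text \<open>The stopping test bounds \<open>B w\<close>, hence through \<open>cB\<close> the normal
  part of \<open>w\<close>. Each estimate repeats the argument for an exact step at \<open>w\<close>
  with this normal part as a perturbation; the multiplier term is orthogonal to \<open>S\<close> and
  disappears when tested with tangent vectors.\<close>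

lemma inexact_step:
  fixes R :: "'a::euclidean_space \<Rightarrow> real" and B :: "'a \<Rightarrow> 'b::euclidean_space" and x m :: 'a
  assumes R: "convex_on UNIV R" and L: "LR-lipschitz_on UNIV R" and \<alpha>: "0 < \<alpha>" and B: "linear B"
    and S: "subspace S" and ker: "\<And>v. v \<in> S \<Longrightarrow> B v = 0"
    and cB: "\<And>v. v \<in> orthogonal_comp S \<Longrightarrow> norm v \<le> cB * norm (B v)" "0 \<le> cB"
    and tol: "norm (gradient (dual_model \<alpha> R B x m) \<xi>) \<le> \<delta>"
  defines "w \<equiv> prox (\<lambda>z. \<alpha> * R z) (x - \<alpha> *\<^sub>R (m + adjoint B \<xi>)) - x"
  defines "\<eta> \<equiv> closest_point S w"
  shows "norm \<eta> \<le> \<alpha> * (norm m + LR)"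
    and "R (x + \<eta>) - R x \<le> - (m \<bullet> \<eta>) - (norm \<eta>)\<^sup>2 / \<alpha> + 2 * LR * cB * \<delta>"
    and "\<lbrakk>h \<in> S; \<And>v. v \<in> S \<Longrightarrow> model \<alpha> R x m h \<le> model \<alpha> R x m v\<rbrakk> \<Longrightarrow>
      (norm (\<eta> - h))\<^sup>2 \<le> \<alpha> * (2 * LR * cB * \<delta>)"
proof -
  have LR: "0 \<le> LR" by (rule lipschitz_on_nonneg[OF L])
  have w: "model \<alpha> R x (m + adjoint B \<xi>) w \<le> model \<alpha> R x (m + adjoint B \<xi>) v" for v
    unfolding w_def by (rule prox_step_minimizes[OF L \<alpha>])
  define b where "b = adjoint B \<xi>"
  define g where "g = - (m + b + (1 / \<alpha>) *\<^sub>R w)"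
  have g: "g \<in> subdifferential R (x + w)"
    unfolding g_def b_def by (rule minimizer_subgradient[OF R \<alpha> w])
  have b: "b \<bullet> y = 0" if "y \<in> S" for y
    using adjoint_works[OF B, of y \<xi>] ker[OF that] by (simp add: b_def inner_commute)
  have \<eta>: "\<eta> \<in> S" unfolding \<eta>_def by (rule closest_point_subspace_in[OF S])
  have wy: "w \<bullet> y = \<eta> \<bullet> y" if "y \<in> S" for y
    unfolding \<eta>_def by (rule closest_point_subspace_inner[OF S that, symmetric])
  define n where "n = w - \<eta>"
  have n: "norm n \<le> cB * \<delta>"
  proof -
    have "norm (B w) \<le> \<delta>" using tol gradient_dual_model[OF R L \<alpha> B w] by simp
    moreover have "B n = B w" using ker[OF \<eta>] by (simp add: n_def linear_diff[OF B])
    moreover have "norm n \<le> cB * norm (B n)"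
      unfolding n_def \<eta>_def by (intro cB closest_point_subspace_comp_in S)
    ultimately show ?thesis using mult_left_mono[OF _ cB(2), of "norm (B w)" \<delta>] by simp
  qed
  have wn: "w = \<eta> + n" by (simp add: n_def)
  have gy: "g \<bullet> y = - (m \<bullet> y) - (\<eta> \<bullet> y) / \<alpha>" if "y \<in> S" for y
    unfolding g_def inner_minus_left inner_add_left inner_scaleR_left b[OF that] wy[OF that] by simp
  have gLR: "norm g \<le> LR" by (rule norm_subgradient_le[OF L g])
  have nLR: "k \<bullet> n \<le> c * norm n" if "norm k \<le> c" for k c
    using norm_cauchy_schwarz[of k n] mult_right_mono[OF that, of "norm n"] by simp
  show "norm \<eta> \<le> \<alpha> * (norm m + LR)"
  proof -
    have "(norm \<eta>)\<^sup>2 = \<alpha> * (- (m + g) \<bullet> \<eta>)"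
      using gy[OF \<eta>] \<alpha> by (simp add: inner_add_left inner_diff_left power2_norm_eq_inner field_simps)
    also have "\<dots> \<le> \<alpha> * (norm (- (m + g)) * norm \<eta>)"
      using \<alpha> by (intro mult_left_mono norm_cauchy_schwarz) auto
    also have "\<dots> \<le> \<alpha> * ((norm m + LR) * norm \<eta>)"
      unfolding norm_minus_cancel
      using \<alpha> norm_triangle_ineq[of m g] gLR by (intro mult_left_mono mult_right_mono) auto
    finally have "norm \<eta> * norm \<eta> \<le> (\<alpha> * (norm m + LR)) * norm \<eta>" by (simp add: power2_eq_square mult_ac)
    then show ?thesis using \<alpha> LR by (cases "\<eta> = 0") auto
  qed
  show "R (x + \<eta>) - R x \<le> - (m \<bullet> \<eta>) - (norm \<eta>)\<^sup>2 / \<alpha> + 2 * LR * cB * \<delta>"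
  proof -
    \<comment> \<open>The subgradient lives at \<open>x + w\<close>, not at
      \<open>x + \<eta>\<close>. One multiple \<open>LR * norm n\<close> pays for the normal
      component of the subgradient inequality, a second one for moving from \<open>x + w\<close> to
      \<open>x + \<eta>\<close>.\<close>
    have "R (x + w) + g \<bullet> (x - (x + w)) \<le> R x" using g unfolding subdifferential_def by blast
    then have "R (x + w) - R x \<le> g \<bullet> \<eta> + g \<bullet> n" by (simp add: wn inner_add_right inner_diff_right)
    moreover have "R (x + \<eta>) - R (x + w) \<le> LR * norm n"
      using lipschitz_onD[OF L, of "x + \<eta>" "x + w"] by (simp add: dist_norm wn)
    moreover have "g \<bullet> n \<le> LR * norm n" by (rule nLR[OF gLR])
    moreover have "LR * norm n \<le> LR * (cB * \<delta>)" by (intro mult_left_mono n LR)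
    ultimately show ?thesis using gy[OF \<eta>] by (simp add: power2_norm_eq_inner)
  qed
  assume h: "h \<in> S" "\<And>v. v \<in> S \<Longrightarrow> model \<alpha> R x m h \<le> model \<alpha> R x m v"
  obtain g' \<nu> where g': "g' \<in> subdifferential R (x + h)" "\<nu> \<in> orthogonal_comp S"
    "m + (1 / \<alpha>) *\<^sub>R h + g' + \<nu> = 0"
    by (rule subspace_minimizer_kkt[OF R S h(1) \<alpha> h(2)])
  have d: "\<eta> - h \<in> S" by (simp add: S \<eta> h subspace_diff)
  have g'y: "g' \<bullet> y = - (m \<bullet> y) - (h \<bullet> y) / \<alpha>" if "y \<in> S" for y
  proof -
    have "\<nu> \<bullet> y = 0" using g'(2) that by (simp add: orthogonal_comp_def orthogonal_def inner_commute[of \<nu>])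
    moreover have "(m + (1 / \<alpha>) *\<^sub>R h + g' + \<nu>) \<bullet> y = 0" by (simp add: g'(3))
    ultimately show ?thesis by (simp add: inner_add_left)
  qed
  \<comment> \<open>Monotonicity between the inexact and the exact point: the tangential part is
    minus the squared distance over \<alpha>, and the normal part is at most \<open>2 * LR\<close>
    times \<open>norm n\<close>.\<close>
  have "0 \<le> (g - g') \<bullet> ((x + w) - (x + h))" by (rule subdifferential_monotone[OF g g'(1)])
  also have "\<dots> = (g - g') \<bullet> (\<eta> - h) + (g - g') \<bullet> n"
    by (simp add: wn inner_add_right inner_diff_right)
  also have "(g - g') \<bullet> (\<eta> - h) = - (norm (\<eta> - h))\<^sup>2 / \<alpha>"
    unfolding inner_diff_left gy[OF d] g'y[OF d]
    by (simp add: power2_norm_eq_inner inner_diff_left inner_diff_right diff_divide_distrib)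
  also have "(g - g') \<bullet> n \<le> (2 * LR) * norm n"
    using norm_triangle_ineq4[of g g'] gLR norm_subgradient_le[OF L g'(1)] by (intro nLR) auto
  also have "\<dots> \<le> (2 * LR) * (cB * \<delta>)" by (intro mult_left_mono n) (simp add: LR)
  finally show "(norm (\<eta> - h))\<^sup>2 \<le> \<alpha> * (2 * LR * cB * \<delta>)" using \<alpha> by (simp add: field_simps)
qed

section \<open>Uniform estimates on the manifold\<close>

lemma le_of_mult_self_le:
  fixes a b :: real
  assumes "a * a \<le> a * b" "0 \<le> b" shows "a \<le> b"
proof (rule ccontr)
  assume "\<not> a \<le> b"
  then have "a * b < a * a" using assms(2) by (intro mult_strict_left_mono) auto
  then show False using assms(1) by simp
qed

section \<open>Quantitative smoothness and compactness\<close>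

lemma smooth_on_imp_Ck_on: "smooth_on W f \<Longrightarrow> Ck_on k W f"
  by (simp add: smooth_on_def)

lemma smooth_on_differentiable: "smooth_on W f \<Longrightarrow> x \<in> W \<Longrightarrow> f differentiable (at x)"
  using smooth_on_imp_Ck_on[of W f "Suc 0"] by simp

lemma smooth_on_has_derivative:
  "smooth_on W f \<Longrightarrow> x \<in> W \<Longrightarrow> (f has_derivative frechet_derivative f (at x)) (at x)"
  using smooth_on_differentiable frechet_derivative_works by blast

lemma linear_eq_sum_Basis:
  fixes v :: "'a::euclidean_space"
  assumes "linear f" shows "f v = (\<Sum>b\<in>Basis. (v \<bullet> b) *\<^sub>R f b)"
proof -
  have "f v = f (\<Sum>b\<in>Basis. (v \<bullet> b) *\<^sub>R b)" by (simp add: euclidean_representation)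
  also have "\<dots> = (\<Sum>b\<in>Basis. (v \<bullet> b) *\<^sub>R f b)" using assms by (simp add: linear_sum linear_scale)
  finally show ?thesis .
qed

text \<open>\<open>Ck_on\<close> controls derivatives only in each fixed direction, so operator norm
  bounds are assembled from the basis directions.\<close>

lemma norm_linear_le_sum_Basis:
  fixes v :: "'a::euclidean_space"
  assumes "linear f" "\<And>b. b \<in> Basis \<Longrightarrow> norm (f b) \<le> K b"
  shows "norm (f v) \<le> (\<Sum>b\<in>Basis. K b) * norm v"
proof -
  have "norm (f v) \<le> (\<Sum>b\<in>Basis. norm ((v \<bullet> b) *\<^sub>R f b))"
    unfolding linear_eq_sum_Basis[OF assms(1), of v] by (rule norm_sum)
  also have "\<dots> \<le> (\<Sum>b\<in>Basis. norm v * K b)"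
    using assms(2) Basis_le_norm by (intro sum_mono) (auto intro!: mult_mono)
  finally show ?thesis by (simp add: sum_distrib_left mult.commute)
qed

lemma Ck1_lipschitz_on_cball:
  fixes f :: "'a::euclidean_space \<Rightarrow> 'b::real_normed_vector"
  assumes "Ck_on (Suc 0) W f" "cball z r \<subseteq> W"
  obtains L where "\<And>x y. x \<in> cball z r \<Longrightarrow> y \<in> cball z r \<Longrightarrow> norm (f x - f y) \<le> L * norm (x - y)"
proof -
  have "\<exists>K. \<forall>x\<in>cball z r. norm (frechet_derivative f (at x) b) \<le> K" for b
  proof -
    have "continuous_on (cball z r) (\<lambda>x. frechet_derivative f (at x) b)"
      using assms by (auto intro: continuous_on_subset)
    then have "bounded ((\<lambda>x. frechet_derivative f (at x) b) ` cball z r)"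
      by (intro compact_imp_bounded compact_continuous_image compact_cball)
    then show ?thesis unfolding bounded_iff by auto
  qed
  then obtain K where K: "\<And>b x. x \<in> cball z r \<Longrightarrow> norm (frechet_derivative f (at x) b) \<le> K b" by metis
  have d: "(f has_derivative frechet_derivative f (at x)) (at x)" if "x \<in> cball z r" for x
  proof -
    have "x \<in> W" using that assms(2) by blast
    then have "f differentiable (at x)" using assms(1) by simp
    then show ?thesis using frechet_derivative_works by blast
  qed
  show ?thesis
  proof (rule that)
    fix x y assume "x \<in> cball z r" "y \<in> cball z r"
    then show "norm (f x - f y) \<le> (\<Sum>b\<in>Basis. K b) * norm (x - y)"
    proof (intro differentiable_bound[where S = "cball z r" and f' = "\<lambda>x. frechet_derivative f (at x)"])
      fix u assume u: "u \<in> cball z r"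
      show "(f has_derivative frechet_derivative f (at u)) (at u within cball z r)"
        using d[OF u] by (rule has_derivative_at_withinI)
      show "onorm (frechet_derivative f (at u)) \<le> (\<Sum>b\<in>Basis. K b)"
        by (rule onorm_le) (rule norm_linear_le_sum_Basis[OF has_derivative_linear[OF d[OF u]] K[OF u]])
    qed auto
  qed
qed

text \<open>Each directional derivative along a basis vector is itself continuously differentiable,
  hence Lipschitz on a closed ball; summing over the basis makes the bound uniform in the
  direction.\<close>

lemma smooth_on_derivative_lipschitz:
  fixes f :: "'a::euclidean_space \<Rightarrow> 'b::real_normed_vector"
  assumes "open W" "smooth_on W f" "z \<in> W"
  obtains r L where "0 < r" "cball z r \<subseteq> W" "0 \<le> L"
    "\<And>x y v. x \<in> cball z r \<Longrightarrow> y \<in> cball z r \<Longrightarrow>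
      norm (frechet_derivative f (at x) v - frechet_derivative f (at y) v) \<le> L * norm (x - y) * norm v"
proof -
  obtain r where r: "0 < r" "cball z r \<subseteq> W" using assms(1,3) open_contains_cball by blast
  have "Ck_on (Suc (Suc 0)) W f" by (rule smooth_on_imp_Ck_on[OF assms(2)])
  then have "Ck_on (Suc 0) W (\<lambda>x. frechet_derivative f (at x) b)" for b
    using iffD1[OF Ck_on.simps(2)] by blast
  then have "\<exists>L. \<forall>x\<in>cball z r. \<forall>y\<in>cball z r.
      norm (frechet_derivative f (at x) b - frechet_derivative f (at y) b) \<le> L * norm (x - y)" for b
    by (rule Ck1_lipschitz_on_cball[OF _ r(2)]) blast
  then obtain L where L: "\<And>b x y. x \<in> cball z r \<Longrightarrow> y \<in> cball z r \<Longrightarrow>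
      norm (frechet_derivative f (at x) b - frechet_derivative f (at y) b) \<le> L b * norm (x - y)"
    by metis
  show ?thesis
  proof (rule that[OF r, of "\<Sum>b\<in>Basis. \<bar>L b\<bar>"])
    fix x y v assume xy: "x \<in> cball z r" "y \<in> cball z r"
    have lin: "linear (\<lambda>v. frechet_derivative f (at x) v - frechet_derivative f (at y) v)"
      using xy r smooth_on_has_derivative[OF assms(2)] by (intro linear_compose_sub has_derivative_linear) blast+
    have "norm (frechet_derivative f (at x) v - frechet_derivative f (at y) v) \<le>
        (\<Sum>b\<in>Basis. \<bar>L b\<bar> * norm (x - y)) * norm v"
    proof (rule norm_linear_le_sum_Basis[OF lin])
      fix b
      show "norm (frechet_derivative f (at x) b - frechet_derivative f (at y) b) \<le> \<bar>L b\<bar> * norm (x - y)"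
        by (rule order_trans[OF L[OF xy]]) (simp add: mult_right_mono)
    qed
    then show "norm (frechet_derivative f (at x) v - frechet_derivative f (at y) v) \<le>
        (\<Sum>b\<in>Basis. \<bar>L b\<bar>) * norm (x - y) * norm v"
      by (simp add: sum_distrib_right)
  qed (simp add: sum_nonneg)
qed

text \<open>A Lebesgue number argument. Balls of half the local radius cover \<open>K\<close>, so a
  point near \<open>y\<close> still lies in the full ball containing \<open>y\<close>; monotonicity
  in the constant lets a finite sum dominate all local constants.\<close>

lemma compact_local_uniform:
  fixes K :: "'a::metric_space set"
  assumes K: "compact K"
    and loc: "\<And>z. z \<in> K \<Longrightarrow> \<exists>r>0. \<exists>L. \<forall>y\<in>ball z r. \<forall>x\<in>ball z r. P L y x"
    and mono: "\<And>L L' y x. P L y x \<Longrightarrow> L \<le> L' \<Longrightarrow> P (L'::real) y x"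
  obtains r L where "0 < r" "0 \<le> L" "\<And>y x. y \<in> K \<Longrightarrow> x \<in> ball y r \<Longrightarrow> P L y x"
proof -
  obtain r L where rL: "\<And>z. z \<in> K \<Longrightarrow> 0 < r z \<and> (\<forall>y\<in>ball z (r z). \<forall>x\<in>ball z (r z). P (L z) y x)"
    using loc by metis
  obtain C where C: "C \<subseteq> K" "finite C" "K \<subseteq> (\<Union>z\<in>C. ball z (r z / 2))"
    using compactE_image[OF K, of K "\<lambda>z. ball z (r z / 2)"] rL by force
  define \<rho> where "\<rho> = Min (insert 1 ((\<lambda>z. r z / 2) ` C))"
  define \<Lambda> where "\<Lambda> = (\<Sum>z\<in>C. \<bar>L z\<bar>)"
  show ?thesis
  proof (rule that[of \<rho> \<Lambda>])
    show "0 < \<rho>" using C rL by (auto simp: \<rho>_def)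
    show "0 \<le> \<Lambda>" by (simp add: \<Lambda>_def sum_nonneg)
    fix y x assume y: "y \<in> K" and x: "x \<in> ball y \<rho>"
    obtain z where z: "z \<in> C" "y \<in> ball z (r z / 2)" using C(3) y by blast
    have "\<rho> \<le> r z / 2" unfolding \<rho>_def using C(2) z(1) by (intro Min_le) auto
    moreover have "0 < r z" using rL z(1) C(1) by blast
    moreover have "dist z x \<le> dist z y + dist y x" by (rule dist_triangle)
    ultimately have "y \<in> ball z (r z)" "x \<in> ball z (r z)" using x z(2) by auto
    then have "P (L z) y x" using rL z(1) C(1) by blast
    moreover have "L z \<le> \<Lambda>"
      using member_le_sum[OF z(1), of "\<lambda>z. \<bar>L z\<bar>"] C(2) by (simp add: \<Lambda>_def)
    ultimately show "P \<Lambda> y x" by (rule mono)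
  qed
qed

text \<open>Brouwer's theorem puts a point of the zero set within \<open>o(t)\<close> of \<open>x + t v\<close>, and the
  metric projection of this line onto \<open>M\<close> is then a curve in \<open>M\<close> with velocity \<open>v\<close>.\<close>

lemma tangent_space_eq_kernel:
  fixes \<psi> :: "'a::euclidean_space \<Rightarrow> 'b::euclidean_space"
  assumes M: "closed M" and W: "open W" and \<psi>: "smooth_on W \<psi>" and MW: "M \<inter> W = {x \<in> W. \<psi> x = 0}"
    and x: "x \<in> M" "x \<in> W" and surj: "surj (frechet_derivative \<psi> (at x))"
  shows "tangent_space M x = {v. frechet_derivative \<psi> (at x) v = 0}"
proof -
  define D where "D = frechet_derivative \<psi> (at x)"
  have D: "(\<psi> has_derivative D) (at x)" unfolding D_def by (rule smooth_on_has_derivative[OF \<psi> x(2)])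
  have lin: "linear D" by (rule has_derivative_linear[OF D])
  have \<psi>0: "\<psi> x = 0" using MW x by blast
  show ?thesis unfolding D_def[symmetric]
  proof (intro set_eqI iffI; clarify?)
    fix v assume "v \<in> tangent_space M x"
    then obtain c :: "real \<Rightarrow> 'a" where c: "c 0 = x" "\<forall>\<^sub>F t in at 0. c t \<in> M"
      "(c has_vector_derivative v) (at 0)" unfolding tangent_space_def by blast
    have "isCont c 0" using c(3) has_vector_derivative_continuous by blast
    then have "\<forall>\<^sub>F t in at 0. c t \<in> W"
      using W x(2) c(1) by (metis isCont_def topological_tendstoD)
    with c(2) have "\<forall>\<^sub>F t in at 0. (\<psi> \<circ> c) t = 0"
      by eventually_elim (use MW in auto)
    then have ev: "\<forall>\<^sub>F t in at 0. 0 = (\<psi> \<circ> c) t" by eventually_elim simp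
    have "((\<psi> \<circ> c) has_derivative D \<circ> (\<lambda>t. t *\<^sub>R v)) (at 0)"
      using c(3) D unfolding has_vector_derivative_def c(1)[symmetric] by (rule diff_chain_at)
    moreover have "((\<lambda>t. 0) has_derivative (\<lambda>t. 0)) (at (0::real))" by (rule has_derivative_const)
    then have "((\<psi> \<circ> c) has_derivative (\<lambda>t. 0)) (at 0)"
      by (rule has_derivative_transform_eventually[OF _ ev]) (auto simp: c(1) \<psi>0)
    ultimately have "D \<circ> (\<lambda>t. t *\<^sub>R v) = (\<lambda>t. 0)" by (rule has_derivative_unique)
    then have "(D \<circ> (\<lambda>t. t *\<^sub>R v)) 1 = (\<lambda>t. 0) (1::real)" by (rule fun_cong)
    then show "D v = 0" by simp
  next
    fix v assume v: "D v = 0"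
    obtain g where g: "linear g" "D \<circ> g = id"
      using linear_surjective_right_inverse[OF lin] surj unfolding D_def by blast
    have gb: "bounded_linear g" using g(1) by (simp add: linear_conv_bounded_linear)
    obtain G where G: "G > 0" "\<And>y. norm (g y) \<le> norm y * G"
      using bounded_linear.pos_bounded[OF gb] by blast
    obtain s0 where s0: "s0 > 0" "ball x s0 \<subseteq> W" using W x(2) open_contains_ball by blast
    have near: "\<exists>d>0. \<forall>t. \<bar>t\<bar> < d \<longrightarrow> (\<exists>y\<in>M. norm (y - (x + t *\<^sub>R v)) \<le> e * \<bar>t\<bar>)" if e: "e > 0" for e
    proof -
      \<comment> \<open>Chosen so that the linearization error on the ball of radius
        \<open>\<rho>\<close> below, at most \<open>e'\<close> times |t| (norm v + e), equals
        exactly that radius.\<close>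
      define e' where "e' = e / (G * (norm v + e))"
      have ne: "norm v + e > 0" using e by (simp add: add_nonneg_pos)
      have e': "e' > 0" using e G(1) ne by (simp add: e'_def)
      obtain d1 where d1: "d1 > 0" "\<And>y. norm (y - x) < d1 \<Longrightarrow> norm (\<psi> y - \<psi> x - D (y - x)) \<le> e' * norm (y - x)"
        using D e' unfolding has_derivative_at_alt by blast
      define d where "d = min d1 s0 / (norm v + e)"
      have d: "d > 0" using d1(1) s0(1) ne by (simp add: d_def)
      have "\<exists>y\<in>M. norm (y - (x + t *\<^sub>R v)) \<le> e * \<bar>t\<bar>" if t: "\<bar>t\<bar> < d" for t
      proof (cases "t = 0")
        case True then show ?thesis using x(1) by (intro bexI[of _ x]) auto
      next
        case False
        define \<rho> where "\<rho> = e * \<bar>t\<bar> / G"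
        define p where "p y = x + t *\<^sub>R v + g y" for y
        have \<rho>: "0 \<le> \<rho>" using e G(1) by (simp add: \<rho>_def)
        have gy: "norm (g y) \<le> e * \<bar>t\<bar>" if "y \<in> cball 0 \<rho>" for y
        proof -
          have "norm (g y) \<le> \<rho> * G" using G that by (intro order_trans[OF G(2)] mult_right_mono) auto
          then show ?thesis using G(1) by (simp add: \<rho>_def)
        qed
        have py: "norm (p y - x) \<le> \<bar>t\<bar> * (norm v + e)" if "y \<in> cball 0 \<rho>" for y
          using norm_triangle_ineq[of "t *\<^sub>R v" "g y"] gy[OF that] by (simp add: p_def algebra_simps)
        have small: "\<bar>t\<bar> * (norm v + e) < min d1 s0"
          using t ne by (simp add: d_def pos_less_divide_eq)
        have pW: "p y \<in> W" if "y \<in> cball 0 \<rho>" for y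
          using py[OF that] small s0(2) by (auto simp: dist_norm norm_minus_commute)
        have err: "norm (y - \<psi> (p y)) \<le> \<rho>" if y: "y \<in> cball 0 \<rho>" for y
        proof -
          \<comment> \<open>Since \<open>g\<close> is a right inverse of \<open>D\<close> and
            \<open>D v = 0\<close>, the linearization of \<open>\<psi>\<close> along
            \<open>p\<close> is the identity. The map given to Brouwer is therefore minus the
            linearization error, and its fixed points are zeros of \<open>\<psi>\<close>.\<close>
          have "D (p y - x) = y"
            using g(2) v by (simp add: p_def linear_add[OF lin] linear_scale[OF lin] fun_eq_iff)
          then have "norm (y - \<psi> (p y)) = norm (\<psi> (p y) - \<psi> x - D (p y - x))"
            by (simp add: \<psi>0 norm_minus_commute)
          also have "\<dots> \<le> e' * norm (p y - x)" using py[OF y] small by (intro d1(2)) auto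
          also have "\<dots> \<le> e' * (\<bar>t\<bar> * (norm v + e))" using e' by (intro mult_left_mono py[OF y]) auto
          also have "\<dots> = \<rho>" using ne G(1) by (simp add: e'_def \<rho>_def)
          finally show ?thesis .
        qed
        have contg: "continuous_on (cball 0 \<rho>) p"
          unfolding p_def by (intro continuous_intros linear_continuous_on gb)
        have "continuous_on W \<psi>"
          using smooth_on_differentiable[OF \<psi>] W
          by (intro differentiable_imp_continuous_on) (auto simp: differentiable_on_eq_differentiable_at)
        then have "continuous_on (cball 0 \<rho>) (\<lambda>y. \<psi> (p y))"
          by (rule continuous_on_compose2[OF _ contg]) (use pW in auto)
        then have cont: "continuous_on (cball 0 \<rho>) (\<lambda>y. y - \<psi> (p y))"
          by (rule continuous_on_diff[OF continuous_on_id])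
        have "(\<lambda>y. y - \<psi> (p y)) \<in> cball 0 \<rho> \<rightarrow> cball 0 \<rho>" using err by auto
        then obtain y where y: "y \<in> cball 0 \<rho>" "y - \<psi> (p y) = y"
          by (rule brouwer[OF compact_cball convex_cball _ cont, rotated]) (use \<rho> in auto)
        then have "p y \<in> M" using MW pW by auto
        moreover have "norm (p y - (x + t *\<^sub>R v)) \<le> e * \<bar>t\<bar>" using gy[OF y(1)] by (simp add: p_def)
        ultimately show ?thesis by blast
      qed
      then show ?thesis using d by blast
    qed
    define c where "c t = closest_point M (x + t *\<^sub>R v)" for t :: real
    have Mne: "M \<noteq> {}" using x(1) by blast
    have c0: "c 0 = x" by (simp add: c_def closest_point_self x(1))
    have "(c has_vector_derivative v) (at 0)"
      unfolding has_vector_derivative_def has_derivative_at_alt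
    proof (intro conjI allI impI)
      show "bounded_linear (\<lambda>t::real. t *\<^sub>R v)" by (rule bounded_linear_scaleR_left)
      fix e :: real assume "e > 0"
      then obtain d where d: "d > 0" "\<And>t. \<bar>t\<bar> < d \<Longrightarrow> \<exists>y\<in>M. norm (y - (x + t *\<^sub>R v)) \<le> e * \<bar>t\<bar>"
        using near by meson
      have "norm (c t - c 0 - (t - 0) *\<^sub>R v) \<le> e * norm (t - 0)" if t: "norm (t - 0) < d" for t
      proof -
        obtain y where y: "y \<in> M" "norm (y - (x + t *\<^sub>R v)) \<le> e * \<bar>t\<bar>" using d(2) t by auto
        have "norm (c t - c 0 - (t - 0) *\<^sub>R v) = dist (x + t *\<^sub>R v) (c t)"
          by (simp add: c0 dist_norm norm_minus_commute algebra_simps)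
        also have "\<dots> \<le> dist (x + t *\<^sub>R v) y" unfolding c_def by (rule closest_point_le[OF M y(1)])
        finally show ?thesis using y(2) by (simp add: dist_norm norm_minus_commute)
      qed
      then show "\<exists>d>0. \<forall>t. norm (t - 0) < d \<longrightarrow> norm (c t - c 0 - (t - 0) *\<^sub>R v) \<le> e * norm (t - 0)"
        using d(1) by blast
    qed
    moreover have "\<forall>\<^sub>F t in at 0. c t \<in> M" by (simp add: c_def closest_point_in_set M Mne)
    ultimately show "v \<in> tangent_space M x" using c0 unfolding tangent_space_def by blast
  qed
qed

section \<open>Uniform constants of a compact embedded submanifold\<close>

locale embedded_submanifold =
  fixes M :: "(real^'d) set" and I :: "nat set" and V W :: "nat \<Rightarrow> (real^'d) set"
    and \<psi> :: "nat \<Rightarrow> real^'d \<Rightarrow> real^'p"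
  assumes M: "compact M" and cover: "defining_cover M I V W \<psi>"
begin

abbreviation D where "D i x \<equiv> frechet_derivative (\<psi> i) (at x)"

lemma chart:
  assumes "i \<in> I"
  shows "open (W i)" "smooth_on (W i) (\<psi> i)" "M \<inter> W i = {x \<in> W i. \<psi> i x = 0}" "closure (V i) \<subseteq> W i"
    "\<And>x. x \<in> M \<Longrightarrow> x \<in> W i \<Longrightarrow> surj (D i x)"
proof -
  have "closure (V i) \<subseteq> W i" "local_defining_function M (W i) (\<psi> i)"
    using cover assms unfolding defining_cover_def by blast+
  then show "open (W i)" "smooth_on (W i) (\<psi> i)" "M \<inter> W i = {x \<in> W i. \<psi> i x = 0}" "closure (V i) \<subseteq> W i"
    "\<And>x. x \<in> M \<Longrightarrow> x \<in> W i \<Longrightarrow> surj (D i x)"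
    unfolding local_defining_function_def by blast+
qed

lemma linear_D: "i \<in> I \<Longrightarrow> x \<in> W i \<Longrightarrow> linear (D i x)"
  using smooth_on_has_derivative[OF chart(2)] has_derivative_linear by blast

lemma tangent_space_kernel:
  assumes "i \<in> I" "x \<in> M" "x \<in> W i" shows "tangent_space M x = {v. D i x v = 0}"
  using tangent_space_eq_kernel[OF compact_imp_closed[OF M] chart(1-3)] chart(5) assms by blast

lemma chart_at: assumes "x \<in> M" obtains i where "i \<in> I" "x \<in> V i" "x \<in> W i"
proof -
  obtain i where i: "i \<in> I" "x \<in> V i" using cover assms unfolding defining_cover_def by blast
  then show ?thesis using that chart(4) closure_subset by blast
qed

lemma subspace_tangent_space: assumes "x \<in> M" shows "subspace (tangent_space M x)"
proof -
  obtain i where i: "i \<in> I" "x \<in> W i" using chart_at[OF assms] by blast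
  then show ?thesis
    using tangent_space_kernel[OF i(1) assms i(2)] linear_subspace_kernel[OF linear_D[OF i]] by simp
qed

lemma normal_space_range:
  assumes "i \<in> I" "x \<in> M" "x \<in> W i" shows "normal_space M x = range (adjoint (D i x))"
proof -
  have lin: "linear (D i x)" by (rule linear_D) (use assms in auto)
  have "tangent_space M x = orthogonal_comp (range (adjoint (D i x)))"
    using ker_orthogonal_comp_adjoint[OF lin] tangent_space_kernel[OF assms] by auto
  moreover have "subspace (range (adjoint (D i x)))"
    by (rule linear_subspace_image[OF adjoint_linear[OF lin] subspace_UNIV])
  ultimately show ?thesis by (simp add: normal_space_def orthogonal_comp_self)
qed

text \<open>Surjectivity of the differential makes its adjoint injective; continuity on the compact
  product of the closed patch with the unit sphere turns this into a positive lower bound. The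
  closure of \<open>V i\<close> inside \<open>W i\<close> is what makes the patch compact.\<close>

lemma adjoint_D_lower_bound_chart:
  assumes i: "i \<in> I"
  obtains c where "0 < c" "\<And>x \<xi>. x \<in> M \<Longrightarrow> x \<in> V i \<Longrightarrow> c * norm \<xi> \<le> norm (adjoint (D i x) \<xi>)"
proof -
  let ?K = "(M \<inter> closure (V i)) \<times> sphere (0::real^'p) 1"
  have xW: "x \<in> W i" if "x \<in> closure (V i)" for x using chart(4)[OF i] that by blast
  \<comment> \<open>The basis expansion exhibits joint continuity in x and \<xi>, given only
    continuity of each \<open>D i x b\<close> in x.\<close>
  have adj: "adjoint (D i x) \<xi> = (\<Sum>b\<in>Basis. (\<xi> \<bullet> D i x b) *\<^sub>R b)" if "x \<in> W i" for x \<xi>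
  proof -
    have "adjoint (D i x) \<xi> \<bullet> b = \<xi> \<bullet> D i x b" for b
      using adjoint_works[OF linear_D[OF i that], of b \<xi>] by (simp add: inner_commute)
    then show ?thesis using euclidean_representation[of "adjoint (D i x) \<xi>"] by simp
  qed
  have pos: "adjoint (D i x) \<xi> \<noteq> 0" if x: "x \<in> M" "x \<in> W i" and \<xi>: "\<xi> \<noteq> 0" for x \<xi>
  proof
    assume a: "adjoint (D i x) \<xi> = 0"
    obtain v where v: "D i x v = \<xi>" using chart(5)[OF i x] by (metis surjD)
    have "\<xi> \<bullet> \<xi> = 0" using adjoint_works[OF linear_D[OF i x(2)], of v \<xi>] a v by simp
    then show False using \<xi> by simp
  qed
  have contD: "continuous_on (W i) (\<lambda>x. D i x b)" for b
    using smooth_on_imp_Ck_on[OF chart(2)[OF i], of "Suc 0"] by simp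
  have "continuous_on ?K (\<lambda>(x, \<xi>). norm (\<Sum>b\<in>Basis. (\<xi> \<bullet> D i x b) *\<^sub>R b))"
    unfolding split_def using xW
    by (intro continuous_intros continuous_on_compose2[OF contD]) auto
  moreover have "compact ?K" by (intro compact_Times compact_sphere compact_Int_closed M closed_closure)
  ultimately obtain c where c: "0 < c" "\<And>p. p \<in> ?K \<Longrightarrow> c \<le> (\<lambda>(x, \<xi>). norm (\<Sum>b\<in>Basis. (\<xi> \<bullet> D i x b) *\<^sub>R b)) p"
  proof (cases "?K = {}")
    case True then show ?thesis using that[of 1] by auto
  next
    case False
    assume "continuous_on ?K (\<lambda>(x, \<xi>). norm (\<Sum>b\<in>Basis. (\<xi> \<bullet> D i x b) *\<^sub>R b))" "compact ?K"
    from continuous_attains_inf[OF this(2) False this(1)] obtain p where p: "p \<in> ?K"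
      "\<forall>q\<in>?K. (\<lambda>(x, \<xi>). norm (\<Sum>b\<in>Basis. (\<xi> \<bullet> D i x b) *\<^sub>R b)) p \<le> (\<lambda>(x, \<xi>). norm (\<Sum>b\<in>Basis. (\<xi> \<bullet> D i x b) *\<^sub>R b)) q"
      by blast
    obtain x \<xi> where px: "p = (x, \<xi>)" by (cases p)
    then have "x \<in> M" "x \<in> W i" "\<xi> \<noteq> 0" using p(1) xW by auto
    from pos[OF this] adj[OF this(2)]
    have "0 < (\<lambda>(x, \<xi>). norm (\<Sum>b\<in>Basis. (\<xi> \<bullet> D i x b) *\<^sub>R b)) p" by (simp add: px)
    then show ?thesis using that p(2) by blast
  qed
  show ?thesis
  proof (rule that[OF c(1)])
    fix x and \<xi> :: "real^'p" assume x: "x \<in> M" "x \<in> V i"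
    then have x': "x \<in> closure (V i)" "x \<in> W i" using closure_subset[of "V i"] xW by blast+
    show "c * norm \<xi> \<le> norm (adjoint (D i x) \<xi>)"
    proof (cases "\<xi> = 0")
      case False
      define \<zeta> where "\<zeta> = (1 / norm \<xi>) *\<^sub>R \<xi>"
      have "(x, \<zeta>) \<in> ?K" using x x' False by (simp add: \<zeta>_def)
      from c(2)[OF this] have "c \<le> norm (adjoint (D i x) \<zeta>)" by (simp add: adj[OF x'(2)])
      also have "\<dots> = norm (adjoint (D i x) \<xi>) / norm \<xi>"
        unfolding \<zeta>_def linear_scale[OF adjoint_linear[OF linear_D[OF i x'(2)]]] by simp
      finally show ?thesis using False by (simp add: pos_le_divide_eq)
    qed simp
  qed
qed

lemma adjoint_D_lower_bound:
  obtains c where "0 < c" "\<And>i x \<xi>. i \<in> I \<Longrightarrow> x \<in> M \<Longrightarrow> x \<in> V i \<Longrightarrow> c * norm \<xi> \<le> norm (adjoint (D i x) \<xi>)"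
proof -
  have "\<forall>i\<in>I. \<exists>c>0. \<forall>x \<xi>. x \<in> M \<longrightarrow> x \<in> V i \<longrightarrow> c * norm \<xi> \<le> norm (adjoint (D i x) \<xi>)"
    by (meson adjoint_D_lower_bound_chart)
  then obtain c where c: "\<And>i. i \<in> I \<Longrightarrow> 0 < c i"
    "\<And>i x \<xi>. i \<in> I \<Longrightarrow> x \<in> M \<Longrightarrow> x \<in> V i \<Longrightarrow> c i * norm \<xi> \<le> norm (adjoint (D i x) \<xi>)"
    by metis
  have fin: "finite I" using cover by (simp add: defining_cover_def)
  define c0 where "c0 = Min (insert 1 (c ` I))"
  show ?thesis
  proof (rule that[of c0])
    show "0 < c0" using fin c(1) by (auto simp: c0_def)
    fix i x and \<xi> :: "real^'p" assume i: "i \<in> I" "x \<in> M" "x \<in> V i"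
    have "c0 \<le> c i" using fin i(1) by (auto simp: c0_def intro!: Min_le)
    then have "c0 * norm \<xi> \<le> c i * norm \<xi>" by (intro mult_right_mono) auto
    then show "c0 * norm \<xi> \<le> norm (adjoint (D i x) \<xi>)" using c(2)[OF i, of \<xi>] by linarith
  qed
qed

text \<open>A normal vector has the form \<open>adjoint (D i x) \<xi>\<close>, so its squared norm
  is at most \<open>norm \<xi> * norm (D i x v)\<close>, and the lower bound for the adjoint removes
  \<xi>. This constant converts dual residuals into the size of normal parts.\<close>

lemma normal_norm_le:
  obtains c where "0 \<le> c" "\<And>i x v. i \<in> I \<Longrightarrow> x \<in> M \<Longrightarrow> x \<in> V i \<Longrightarrow> v \<in> normal_space M x \<Longrightarrow> norm v \<le> c * norm (D i x v)"
proof -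
  obtain c where c: "0 < c" "\<And>i x \<xi>. i \<in> I \<Longrightarrow> x \<in> M \<Longrightarrow> x \<in> V i \<Longrightarrow> c * norm \<xi> \<le> norm (adjoint (D i x) \<xi>)"
    by (rule adjoint_D_lower_bound) blast
  show ?thesis
  proof (rule that[of "1 / c"])
    fix i x v assume i: "i \<in> I" "x \<in> M" "x \<in> V i" and v: "v \<in> normal_space M x"
    have xW: "x \<in> W i" using i chart(4) closure_subset by blast
    obtain \<xi> where \<xi>: "v = adjoint (D i x) \<xi>" using v normal_space_range[OF i(1,2) xW] by blast
    have "norm v * norm v = \<xi> \<bullet> D i x v"
      using adjoint_works[OF linear_D[OF i(1) xW], of v \<xi>]
      by (simp add: \<xi>[symmetric] dot_square_norm power2_eq_square inner_commute)
    also have "\<dots> \<le> norm \<xi> * norm (D i x v)" by (rule norm_cauchy_schwarz)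
    also have "\<dots> \<le> (norm v / c) * norm (D i x v)"
      using c(2)[OF i, of \<xi>] c(1) by (intro mult_right_mono) (auto simp: \<xi> pos_le_divide_eq mult.commute)
    finally have "norm v * norm v \<le> norm v * (1 / c * norm (D i x v))" by simp
    then show "norm v \<le> 1 / c * norm (D i x v)"
      by (rule le_of_mult_self_le) (use c(1) in simp)
  qed (use c in simp)
qed

lemma D_locally_lipschitz:
  assumes i: "i \<in> I"
  obtains r L where "0 < r" "0 \<le> L" "\<And>y x v. y \<in> M \<Longrightarrow> y \<in> V i \<Longrightarrow> dist y x < r \<Longrightarrow>
    x \<in> W i \<and> norm (D i y v - D i x v) \<le> L * norm (x - y) * norm v"
proof -
  let ?P = "\<lambda>L y x. x \<in> W i \<and> (\<forall>v. norm (D i y v - D i x v) \<le> L * norm (x - y) * norm v)"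
  have K: "compact (M \<inter> closure (V i))" by (intro compact_Int_closed M closed_closure)
  obtain r L where rL: "0 < r" "0 \<le> L" "\<And>y x. y \<in> M \<inter> closure (V i) \<Longrightarrow> x \<in> ball y r \<Longrightarrow> ?P L y x"
  proof (rule compact_local_uniform[OF K, of ?P])
    fix z assume "z \<in> M \<inter> closure (V i)"
    then have "z \<in> W i" using chart(4)[OF i] by blast
    then obtain r L where r: "0 < r" "cball z r \<subseteq> W i" "0 \<le> L" and
      L: "\<And>x y v. x \<in> cball z r \<Longrightarrow> y \<in> cball z r \<Longrightarrow> norm (D i x v - D i y v) \<le> L * norm (x - y) * norm v"
      using smooth_on_derivative_lipschitz[OF chart(1,2)[OF i]] by metis
    have "\<forall>y\<in>ball z r. \<forall>x\<in>ball z r. ?P L y x"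
      using r L ball_subset_cball[of z r] by (auto simp: norm_minus_commute)
    then show "\<exists>r>0. \<exists>L. \<forall>y\<in>ball z r. \<forall>x\<in>ball z r. ?P L y x" using r(1) by blast
  next
    fix L L' y x assume P: "?P L y x" and "L \<le> L'"
    then have "L * norm (x - y) * norm v \<le> L' * norm (x - y) * norm v" for v :: "real^'d"
      by (intro mult_right_mono) auto
    then show "?P L' y x" using P order_trans by blast
  qed auto
  show ?thesis
  proof (rule that[OF rL(1,2)])
    fix y x v assume "y \<in> M" "y \<in> V i" "dist y x < r"
    then show "x \<in> W i \<and> norm (D i y v - D i x v) \<le> L * norm (x - y) * norm v"
      using rL(3)[of y x] closure_subset[of "V i"] by auto
  qed
qed

text \<open>For distant points the factor \<open>1 / r\<close> already suffices. For close ones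
  write \<open>v = adjoint (D i y) \<xi>\<close>; the projection p is annihilated by
  \<open>D i x\<close>, so its squared norm is the inner product of \<xi> with the difference of the
  differentials at y and x applied to p.\<close>

lemma tangent_proj_normal_chart:
  assumes i: "i \<in> I"
  obtains L where "0 \<le> L" "\<And>x y v. x \<in> M \<Longrightarrow> y \<in> M \<Longrightarrow> y \<in> V i \<Longrightarrow> v \<in> normal_space M y \<Longrightarrow>
    norm (tangent_proj M x v) \<le> L * norm (x - y) * norm v"
proof -
  obtain r L where r: "0 < r" "0 \<le> L" and L: "\<And>y x v. y \<in> M \<Longrightarrow> y \<in> V i \<Longrightarrow> dist y x < r \<Longrightarrow>
      x \<in> W i \<and> norm (D i y v - D i x v) \<le> L * norm (x - y) * norm v"
    by (rule D_locally_lipschitz[OF i]) blast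
  obtain c where c: "0 < c" "\<And>i x \<xi>. i \<in> I \<Longrightarrow> x \<in> M \<Longrightarrow> x \<in> V i \<Longrightarrow> c * norm \<xi> \<le> norm (adjoint (D i x) \<xi>)"
    by (rule adjoint_D_lower_bound) blast
  show ?thesis
  proof (rule that[of "1 / r + L / c"])
    show "0 \<le> 1 / r + L / c" using r c(1) by simp
    fix x y v assume x: "x \<in> M" and y: "y \<in> M" "y \<in> V i" and v: "v \<in> normal_space M y"
    note S = subspace_tangent_space[OF x]
    let ?p = "tangent_proj M x v"
    have pv: "norm ?p \<le> norm v" unfolding tangent_proj_def by (rule norm_closest_point_subspace_le[OF S])
    have pS: "?p \<in> tangent_space M x" unfolding tangent_proj_def by (rule closest_point_subspace_in[OF S])
    show "norm ?p \<le> (1 / r + L / c) * norm (x - y) * norm v"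
    proof (cases "dist y x < r")
      case False
      then have "1 \<le> (1 / r) * norm (x - y)" using r(1) by (simp add: dist_norm norm_minus_commute)
      also have "\<dots> \<le> (1 / r + L / c) * norm (x - y)" using r(2) c(1) by (intro mult_right_mono) auto
      finally have "1 * norm v \<le> (1 / r + L / c) * norm (x - y) * norm v" by (rule mult_right_mono) auto
      then show ?thesis using pv by simp
    next
      case True
      have xW: "x \<in> W i" using L[OF y True] by blast
      have yW: "y \<in> W i" using y chart(4)[OF i] closure_subset[of "V i"] by blast
      obtain \<xi> where \<xi>: "v = adjoint (D i y) \<xi>" using v normal_space_range[OF i y(1) yW] by blast
      have \<xi>v: "norm \<xi> \<le> norm v / c"
        using c(2)[OF i y, of \<xi>] c(1) by (simp add: \<xi> pos_le_divide_eq mult.commute)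
      have Dx: "D i x ?p = 0" using pS tangent_space_kernel[OF i x xW] by blast
      have "norm ?p * norm ?p = v \<bullet> ?p"
        using closest_point_subspace_inner[OF S pS, of v]
        by (simp add: tangent_proj_def[symmetric] dot_square_norm power2_eq_square)
      also have "\<dots> = \<xi> \<bullet> (D i y ?p - D i x ?p)"
        using adjoint_works[OF linear_D[OF i yW], of ?p \<xi>]
        unfolding Dx by (simp add: \<xi>[symmetric] inner_commute)
      also have "\<dots> \<le> norm \<xi> * norm (D i y ?p - D i x ?p)" by (rule norm_cauchy_schwarz)
      also have "\<dots> \<le> (norm v / c) * (L * norm (x - y) * norm ?p)"
        using L[OF y True] \<xi>v c(1) by (intro mult_mono) auto
      finally have "norm ?p * norm ?p \<le> norm ?p * (L / c * norm (x - y) * norm v)" by (simp add: mult_ac)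
      then have "norm ?p \<le> L / c * norm (x - y) * norm v"
        by (rule le_of_mult_self_le) (use r(2) c(1) in simp)
      also have "\<dots> \<le> (1 / r + L / c) * norm (x - y) * norm v"
        using r by (intro mult_right_mono) auto
      finally show ?thesis .
    qed
  qed
qed

lemma tangent_proj_normal:
  obtains L where "0 \<le> L" "\<And>x y v. x \<in> M \<Longrightarrow> y \<in> M \<Longrightarrow> v \<in> normal_space M y \<Longrightarrow>
    norm (tangent_proj M x v) \<le> L * norm (x - y) * norm v"
proof -
  have "\<forall>i\<in>I. \<exists>L\<ge>0. \<forall>x y v. x \<in> M \<longrightarrow> y \<in> M \<longrightarrow> y \<in> V i \<longrightarrow> v \<in> normal_space M y \<longrightarrow>
      norm (tangent_proj M x v) \<le> L * norm (x - y) * norm v"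
    by (meson tangent_proj_normal_chart)
  then obtain L where L: "\<And>i. i \<in> I \<Longrightarrow> 0 \<le> L i"
    "\<And>i x y v. i \<in> I \<Longrightarrow> x \<in> M \<Longrightarrow> y \<in> M \<Longrightarrow> y \<in> V i \<Longrightarrow> v \<in> normal_space M y \<Longrightarrow>
      norm (tangent_proj M x v) \<le> L i * norm (x - y) * norm v"
    by metis
  have fin: "finite I" using cover by (simp add: defining_cover_def)
  show ?thesis
  proof (rule that[of "\<Sum>i\<in>I. L i"])
    show "0 \<le> (\<Sum>i\<in>I. L i)" using L(1) by (rule sum_nonneg)
    fix x y v assume a: "x \<in> M" "y \<in> M" "v \<in> normal_space M y"
    obtain i where i: "i \<in> I" "y \<in> V i" using chart_at[OF a(2)] by blast
    have "norm (tangent_proj M x v) \<le> L i * norm (x - y) * norm v" by (rule L(2)[OF i(1) a(1,2) i(2) a(3)])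
    also have "\<dots> \<le> (\<Sum>i\<in>I. L i) * norm (x - y) * norm v"
      using fin i(1) L(1) by (intro mult_right_mono member_le_sum) auto
    finally show "norm (tangent_proj M x v) \<le> (\<Sum>i\<in>I. L i) * norm (x - y) * norm v" .
  qed
qed

text \<open>A second-order Taylor bound for a smooth local extension of the retraction around (z,
  0). On the zero section the extension returns x, its derivative in a tangent fibre direction is
  that direction, and the derivative is Lipschitz nearby.\<close>

lemma retraction_bounds_local:
  assumes retr: "manifold_retraction M retr" and z: "z \<in> M"
  obtains r L where "0 < r" "0 \<le> L" "\<And>x \<eta>. x \<in> M \<Longrightarrow> \<eta> \<in> tangent_space M x \<Longrightarrow> dist (z, 0) (x, \<eta>) < r \<Longrightarrow>
    norm (retr x \<eta> - x - \<eta>) \<le> L * (norm \<eta>)\<^sup>2"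
proof -
  have "(z, 0) \<in> tangent_bundle M"
    using z subspace_0[OF subspace_tangent_space[OF z]] by (simp add: tangent_bundle_def)
  then obtain Q g where Q: "open Q" "(z, 0) \<in> Q" "smooth_on Q g"
    "\<And>p. p \<in> Q \<inter> tangent_bundle M \<Longrightarrow> g p = (case p of (x, \<eta>) \<Rightarrow> retr x \<eta>)"
    using retr unfolding manifold_retraction_def locally_smooth_on_def by blast
  have geq: "g (x, \<eta>) = retr x \<eta>" if "(x, \<eta>) \<in> Q" "x \<in> M" "\<eta> \<in> tangent_space M x" for x \<eta>
    using Q(4)[of "(x, \<eta>)"] that by (simp add: tangent_bundle_def)
  obtain r L where r: "0 < r" "cball (z, 0) r \<subseteq> Q" "0 \<le> L" and
    L: "\<And>p q v. p \<in> cball (z, 0) r \<Longrightarrow> q \<in> cball (z, 0) r \<Longrightarrow>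
      norm (frechet_derivative g (at p) v - frechet_derivative g (at q) v) \<le> L * norm (p - q) * norm v"
    by (rule smooth_on_derivative_lipschitz[OF Q(1,3,2)]) blast
  show ?thesis
  proof (rule that[OF r(1,3)])
    fix x \<eta> assume x: "x \<in> M" and \<eta>: "\<eta> \<in> tangent_space M x" and d: "dist (z, 0) (x, \<eta>) < r"
    note S = subspace_tangent_space[OF x]
    have in_ball: "(x, t *\<^sub>R \<eta>) \<in> cball (z, 0) r" if "t \<in> {0..1}" for t
    proof -
      have "(norm (t *\<^sub>R \<eta>))\<^sup>2 \<le> (norm \<eta>)\<^sup>2" using that by (intro power_mono) (auto simp: mult_left_le_one_le)
      then have "dist (z, 0) (x, t *\<^sub>R \<eta>) \<le> dist (z, 0) (x, \<eta>)"
        unfolding dist_Pair_Pair by (intro real_sqrt_le_mono add_left_mono) simp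
      then show ?thesis using d by simp
    qed
    have dg: "(g has_derivative frechet_derivative g (at p)) (at p)" if "p \<in> cball (z, 0) r" for p
      using smooth_on_has_derivative[OF Q(3)] r(2) that by blast
    have x0: "(x, 0) \<in> Q" using in_ball[of 0] r(2) by auto
    have tend: "((\<lambda>t. (x, t *\<^sub>R \<eta>)) \<longlongrightarrow> (x, 0)) (at (0::real))"
      by (auto intro!: tendsto_eq_intros)
    have "\<forall>\<^sub>F t in at (0::real). (x, t *\<^sub>R \<eta>) \<in> Q"
      using topological_tendstoD[OF tend Q(1) x0] .
    then have ev: "\<forall>\<^sub>F t in at (0::real). retr x (t *\<^sub>R \<eta>) = g (x, t *\<^sub>R \<eta>)"
      by eventually_elim (simp add: geq x \<eta> S subspace_scale)
    have "(retr x has_derivative id) (at 0 within tangent_space M x)"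
      using retr x unfolding manifold_retraction_def by blast
    moreover have "range (\<lambda>t. t *\<^sub>R \<eta>) \<subseteq> tangent_space M x" using S \<eta> by (auto simp: subspace_scale)
    ultimately have "(retr x has_derivative id) (at (0 *\<^sub>R \<eta>) within range (\<lambda>t. t *\<^sub>R \<eta>))"
      using has_derivative_subset by simp
    moreover have "((\<lambda>t. t *\<^sub>R \<eta>) has_derivative (\<lambda>t. t *\<^sub>R \<eta>)) (at (0::real))"
      by (auto intro!: derivative_eq_intros)
    ultimately have "((\<lambda>t. retr x (t *\<^sub>R \<eta>)) has_derivative (\<lambda>t. id (t *\<^sub>R \<eta>))) (at (0::real))"
      by (rule has_derivative_in_compose[rotated])
    then have 1: "((\<lambda>t. g (x, t *\<^sub>R \<eta>)) has_derivative (\<lambda>t. t *\<^sub>R \<eta>)) (at (0::real))"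
      unfolding id_def
      by (rule has_derivative_transform_eventually[OF _ ev]) (simp add: geq x0 x S subspace_0, simp)
    have "((\<lambda>t. (x, t *\<^sub>R \<eta>)) has_derivative (\<lambda>t. (0, t *\<^sub>R \<eta>))) (at (0::real))"
      by (auto intro!: derivative_eq_intros)
    moreover have "(g has_derivative frechet_derivative g (at (x, 0))) (at (x, 0 *\<^sub>R \<eta>))"
      using dg in_ball[of 0] by simp
    ultimately have 2: "((\<lambda>t. g (x, t *\<^sub>R \<eta>)) has_derivative (\<lambda>t. frechet_derivative g (at (x, 0)) (0, t *\<^sub>R \<eta>))) (at (0::real))"
      by (rule has_derivative_compose)
    \<comment> \<open>The derivative of the retraction is given only within the tangent space; along
      the line through \<eta> it has to agree with that of the extension, which is all that is
      used.\<close>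
    have D0: "frechet_derivative g (at (x, 0)) (0, \<eta>) = \<eta>"
      using fun_cong[OF has_derivative_unique[OF 1 2], of 1] by simp
    let ?S = "(\<lambda>t. (x, t *\<^sub>R \<eta>)) ` {0..1::real}"
    have "norm (g (x, \<eta>) - g (x, 0) - frechet_derivative g (at (x, 0)) ((x, \<eta>) - (x, 0))) \<le>
        norm ((x, \<eta>) - (x, 0)) * (L * norm \<eta>)"
    proof (rule differentiable_bound_linearization[where S = ?S])
      fix t :: real assume "t \<in> {0..1}"
      then show "(x, 0) + t *\<^sub>R ((x, \<eta>) - (x, 0)) \<in> ?S" by auto
    next
      fix p assume p: "p \<in> ?S"
      then have pb: "p \<in> cball (z, 0) r" using in_ball by auto
      show "(g has_derivative frechet_derivative g (at p)) (at p within ?S)"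
        using dg[OF pb] by (rule has_derivative_at_withinI)
      show "onorm (frechet_derivative g (at p) - frechet_derivative g (at (x, 0))) \<le> L * norm \<eta>"
      proof (rule onorm_le)
        fix v
        have "norm (frechet_derivative g (at p) v - frechet_derivative g (at (x, 0)) v) \<le> L * norm (p - (x, 0)) * norm v"
          using in_ball[of 0] by (intro L pb) simp
        also have "\<dots> \<le> L * norm \<eta> * norm v"
          using p r(3) by (intro mult_right_mono mult_left_mono) (auto simp: norm_Pair mult_left_le_one_le)
        finally show "norm ((frechet_derivative g (at p) - frechet_derivative g (at (x, 0))) v) \<le> L * norm \<eta> * norm v"
          by simp
      qed
    next
      show "(x, 0) \<in> ?S" by (auto intro!: image_eqI[of _ _ 0])
    qed
    moreover have "g (x, \<eta>) = retr x \<eta>" using in_ball[of 1] r(2) x \<eta> by (intro geq) auto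
    moreover have "g (x, 0) = x"
      using geq[OF x0 x subspace_0[OF S]] retr x by (simp add: manifold_retraction_def)
    ultimately show "norm (retr x \<eta> - x - \<eta>) \<le> L * (norm \<eta>)\<^sup>2"
      by (simp add: D0 power2_eq_square norm_Pair mult_ac)
  qed
qed

text \<open>Compactness is available for the zero section but not for the tangent bundle, hence the
  restriction to short tangent vectors.\<close>

lemma retraction_bounds:
  assumes retr: "manifold_retraction M retr"
  obtains \<rho> L where "0 < \<rho>" "0 \<le> L" "\<And>x \<eta>. x \<in> M \<Longrightarrow> \<eta> \<in> tangent_space M x \<Longrightarrow> norm \<eta> < \<rho> \<Longrightarrow>
    norm (retr x \<eta> - x - \<eta>) \<le> L * (norm \<eta>)\<^sup>2"
proof -
  let ?P = "\<lambda>L (q :: (real^'d) \<times> (real^'d)) (p :: (real^'d) \<times> (real^'d)).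
    fst p \<in> M \<longrightarrow> snd p \<in> tangent_space M (fst p) \<longrightarrow> norm (retr (fst p) (snd p) - fst p - snd p) \<le> L * (norm (snd p))\<^sup>2"
  have K: "compact (M \<times> {0::real^'d})" by (intro compact_Times M) simp
  obtain r L where rL: "0 < r" "0 \<le> L" "\<And>q p. q \<in> M \<times> {0::real^'d} \<Longrightarrow> p \<in> ball q r \<Longrightarrow> ?P L q p"
  proof (rule compact_local_uniform[OF K, of ?P])
    fix q :: "(real^'d) \<times> (real^'d)" assume q: "q \<in> M \<times> {0}"
    then have "fst q \<in> M" by auto
    then obtain r L where r: "0 < r" and L: "\<And>x \<eta>. x \<in> M \<Longrightarrow> \<eta> \<in> tangent_space M x \<Longrightarrow>
        dist (fst q, 0) (x, \<eta>) < r \<Longrightarrow> norm (retr x \<eta> - x - \<eta>) \<le> L * (norm \<eta>)\<^sup>2"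
      by (rule retraction_bounds_local[OF retr]) blast
    have "q = (fst q, 0)" using q by auto
    then have "?P L y p" if "p \<in> ball q r" for y p
      using L[of "fst p" "snd p"] that by simp
    then show "\<exists>r>0. \<exists>L. \<forall>y\<in>ball q r. \<forall>x\<in>ball q r. ?P L y x" using r by blast
  next
    fix L L' y p assume P: "?P L y p" and "L \<le> L'"
    then have "L * (norm (snd p))\<^sup>2 \<le> L' * (norm (snd p))\<^sup>2" by (intro mult_right_mono) auto
    then show "?P L' y p" using P by linarith
  qed blast
  show ?thesis
  proof (rule that[OF rL(1,2)])
    fix x \<eta> assume "x \<in> M" "\<eta> \<in> tangent_space M x" "norm \<eta> < r"
    then show "norm (retr x \<eta> - x - \<eta>) \<le> L * (norm \<eta>)\<^sup>2"
      using rL(3)[of "(x, 0)" "(x, \<eta>)"] by (simp add: dist_Pair_Pair)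
  qed
qed

end

lemma open_neighbourhood_uniform:
  fixes M :: "'a::metric_space set"
  assumes "compact M" "open U" "M \<subseteq> U"
  obtains r where "0 < r" "\<And>x. x \<in> M \<Longrightarrow> ball x r \<subseteq> U"
proof -
  obtain r L where r: "0 < r" "0 \<le> (L::real)" "\<And>y x. y \<in> M \<Longrightarrow> x \<in> ball y r \<Longrightarrow> x \<in> U"
  proof (rule compact_local_uniform[OF assms(1), of "\<lambda>_ _ x. x \<in> U"])
    fix z assume "z \<in> M"
    then obtain r where "0 < r" "ball z r \<subseteq> U" using assms(2,3) open_contains_ball by blast
    then show "\<exists>r>0. \<exists>L::real. \<forall>y\<in>ball z r. \<forall>x\<in>ball z r. x \<in> U" by blast
  qed blast+
  show ?thesis by (rule that[OF r(1)]) (use r(3) in blast)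
qed

text \<open>Short steps cannot leave a connected chain of balls, so the oscillation of a function along
  them is bounded even if \<open>M\<close> is disconnected.\<close>

lemma short_step_oscillation:
  fixes h :: "'a::metric_space \<Rightarrow> real"
  assumes fin: "finite C"
    and osc: "\<And>a b. a \<in> M \<Longrightarrow> b \<in> M \<Longrightarrow> dist a b < r \<Longrightarrow> \<bar>h a - h b\<bar> \<le> \<delta>" and \<delta>: "0 \<le> \<delta>"
    and "\<And>k. k \<le> K \<Longrightarrow> x k \<in> M" "\<And>k. k \<le> K \<Longrightarrow> x k \<in> (\<Union>c\<in>C. ball c (r / 2))"
    and "\<And>k. k < K \<Longrightarrow> dist (x (Suc k)) (x k) < r"
  shows "\<bar>h (x K) - h (x 0)\<bar> \<le> 2 * real (card C) * \<delta>"
  using fin assms(4-)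
proof (induction C arbitrary: x K rule: finite_psubset_induct)
  case (psubset C)
  obtain c where c: "c \<in> C" "x 0 \<in> ball c (r / 2)" using psubset.prems(2)[of 0] by auto
  \<comment> \<open>The last visit to the ball containing the start. Getting there costs one
    \<delta>, leaving it another, and the rest of the path never meets this ball again, so the
    induction continues with one centre fewer.\<close>
  define j where "j = Max {j. j \<le> K \<and> x j \<in> ball c (r / 2)}"
  have fin: "finite {j. j \<le> K \<and> x j \<in> ball c (r / 2)}" by simp
  have "j \<in> {j. j \<le> K \<and> x j \<in> ball c (r / 2)}" unfolding j_def by (rule Max_in[OF fin]) (use c in auto)
  then have j: "j \<le> K" "x j \<in> ball c (r / 2)" by auto
  have jmax: "x i \<notin> ball c (r / 2)" if "j < i" "i \<le> K" for i
  proof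
    assume "x i \<in> ball c (r / 2)"
    then have "i \<le> j" unfolding j_def using that by (intro Max_ge[OF fin]) auto
    then show False using that by simp
  qed
  have "dist (x j) (x 0) < r" using dist_triangle_half_l[of "x j" c r "x 0"] j(2) c(2) by (simp add: dist_commute)
  then have 1: "\<bar>h (x j) - h (x 0)\<bar> \<le> \<delta>" using j(1) by (intro osc psubset.prems(1)) auto
  have cC: "card C = Suc (card (C - {c}))" by (rule card.remove[OF psubset.hyps c(1)])
  show ?case
  proof (cases "j = K")
    case True
    then have "\<bar>h (x K) - h (x 0)\<bar> \<le> \<delta>" using 1 by simp
    also have "\<dots> \<le> 2 * real (card C) * \<delta>" using \<delta> cC by (simp add: algebra_simps)
    finally show ?thesis .
  next
    case False
    then have jK: "j < K" using j(1) by simp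
    have 2: "\<bar>h (x (Suc j)) - h (x j)\<bar> \<le> \<delta>"
      by (rule osc[OF psubset.prems(1) psubset.prems(1) psubset.prems(3)]) (use jK in auto)
    have "\<bar>h (x (Suc j + (K - Suc j))) - h (x (Suc j + 0))\<bar> \<le> 2 * real (card (C - {c})) * \<delta>"
    proof (rule psubset.IH[where x = "\<lambda>k. x (Suc j + k)"])
      show "C - {c} \<subset> C" using c(1) by blast
      fix k
      show "x (Suc j + k) \<in> M" if "k \<le> K - Suc j" using jK that by (intro psubset.prems(1)) auto
      show "x (Suc j + k) \<in> (\<Union>c\<in>C - {c}. ball c (r / 2))" if "k \<le> K - Suc j"
      proof -
        have le: "Suc j + k \<le> K" using jK that by simp
        have "x (Suc j + k) \<notin> ball c (r / 2)" by (rule jmax[OF _ le]) simp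
        then show ?thesis using psubset.prems(2)[OF le] by blast
      qed
      show "dist (x (Suc j + Suc k)) (x (Suc j + k)) < r" if "k < K - Suc j"
        using psubset.prems(3)[of "Suc j + k"] jK that by simp
    qed
    then have 3: "\<bar>h (x K) - h (x (Suc j))\<bar> \<le> 2 * real (card (C - {c})) * \<delta>" using jK by simp
    have "2 * real (card C) * \<delta> = 2 * \<delta> + 2 * real (card (C - {c})) * \<delta>" by (simp add: cC algebra_simps)
    then show ?thesis using 1 2 3 by linarith
  qed
qed

section \<open>Uniform batches\<close>

text \<open>Batches grow by one index at the head of the list. Recording the possible next draws
  lets one induction treat both sampling modes.\<close>

primrec avail :: "sampling \<Rightarrow> nat \<Rightarrow> nat list \<Rightarrow> nat set" where
  "avail With_Replacement n js = {1..n}"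
| "avail Without_Replacement n js = {1..n} - set js"

lemma batches_0: "batches smp n 0 = {[]}"
  by (cases smp) auto

lemma batches_Suc:
  "batches smp n (Suc b) = (\<lambda>(js, j). j # js) ` (SIGMA js:batches smp n b. avail smp n js)"
proof -
  have "js \<in> batches smp n (Suc b) \<longleftrightarrow>
      js \<in> (\<lambda>(js, j). j # js) ` (SIGMA js:batches smp n b. avail smp n js)" for js
    by (cases smp; cases js) (auto simp: image_iff)
  then show ?thesis by blast
qed

lemma finite_avail [simp]: "finite (avail smp n js)"
  by (cases smp) auto

lemma finite_batches [simp]: "finite (batches smp n b)"
  by (induction b) (auto simp: batches_0 batches_Suc)

lemma sum_batches_Suc:
  "(\<Sum>js\<in>batches smp n (Suc b). f js) =
   (\<Sum>js\<in>batches smp n b. \<Sum>j\<in>avail smp n js. f (j # js))"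
proof -
  have "inj_on (\<lambda>(js, j). j # js) (SIGMA js:batches smp n b. avail smp n js)"
    by (auto simp: inj_on_def)
  then show ?thesis
    by (simp add: batches_Suc sum.reindex sum.Sigma split_def o_def)
qed

text \<open>The number of possible next draws depends on the length of the batch only, which is why
  uniform batches can be counted draw by draw.\<close>

definition avail_card :: "sampling \<Rightarrow> nat \<Rightarrow> nat \<Rightarrow> nat" where
  "avail_card smp n b = (case smp of With_Replacement \<Rightarrow> n | Without_Replacement \<Rightarrow> n - b)"

lemma card_avail: "js \<in> batches smp n b \<Longrightarrow> card (avail smp n js) = avail_card smp n b"
  by (cases smp) (auto simp: avail_card_def card_Diff_subset distinct_card)

lemma avail_subset: "avail smp n js \<subseteq> {1..n}"
  by (cases smp) auto

lemma card_batches_Suc: "card (batches smp n (Suc b)) = card (batches smp n b) * avail_card smp n b"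
proof -
  have "card (batches smp n (Suc b)) = (\<Sum>js\<in>batches smp n b. card (avail smp n js))"
    unfolding card_eq_sum sum_batches_Suc ..
  also have "\<dots> = (\<Sum>js\<in>batches smp n b. avail_card smp n b)" by (intro sum.cong card_avail) auto
  finally show ?thesis by simp
qed

lemma avail_card_pos: "b < n \<Longrightarrow> 0 < avail_card smp n b"
  by (cases smp) (auto simp: avail_card_def)

lemma card_batches_pos: "b \<le> n \<Longrightarrow> 0 < card (batches smp n b)"
  by (induction b) (auto simp: batches_0 card_batches_Suc avail_card_pos)

text \<open>In both sampling modes, the next index appended to a batch is uniformly distributed.\<close>

lemma card_room:
  assumes "j \<in> {1..n}" "b < n"
  shows "n * card {js \<in> batches smp n b. j \<in> avail smp n js} = card (batches smp n (Suc b))"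
proof (cases smp)
  case With_Replacement
  then have "{js \<in> batches smp n b. j \<in> avail smp n js} = batches smp n b" using assms by auto
  then show ?thesis unfolding card_batches_Suc With_Replacement avail_card_def by simp
next
  case Without_Replacement
  have "{js \<in> batches smp n b. j \<in> avail smp n js} =
      {js. length js = b \<and> distinct js \<and> set js \<subseteq> {1..n} - {j}}"
    using assms Without_Replacement by auto
  then have 1: "card {js \<in> batches smp n b. j \<in> avail smp n js} = \<Prod>{n - 1 - b + 1..n - 1}"
    using assms by (simp add: card_lists_distinct_length_eq)
  have "batches smp n (Suc b) = {js. length js = Suc b \<and> distinct js \<and> set js \<subseteq> {1..n}}"
    using Without_Replacement by auto
  then have 2: "card (batches smp n (Suc b)) = \<Prod>{n - Suc b + 1..n}"
    using assms by (simp add: card_lists_distinct_length_eq)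
  \<comment> \<open>The product n (n - 1) ... (n - b): lists that avoid j are drawn from n - 1
    indices, and the factor n completes the falling factorial of length b + 1.\<close>
  have "{n - Suc b + 1..n} = insert n {n - 1 - b + 1..n - 1}" using assms by auto
  moreover have "n \<notin> {n - 1 - b + 1..n - 1}" using assms by auto
  ultimately show ?thesis unfolding 1 2 by simp
qed

lemma sum_avail_swap:
  fixes \<phi> :: "nat \<Rightarrow> real"
  assumes "b < n"
  shows "(\<Sum>js\<in>batches smp n b. \<Sum>j\<in>avail smp n js. \<phi> j) =
    real (card (batches smp n (Suc b))) * (\<Sum>j=1..n. \<phi> j) / real n"
proof -
  have "(\<Sum>js\<in>batches smp n b. \<Sum>j\<in>avail smp n js. \<phi> j) =
      (\<Sum>js\<in>batches smp n b. \<Sum>j=1..n. if j \<in> avail smp n js then \<phi> j else 0)"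
  proof (rule sum.cong[OF refl])
    fix js
    have "{1..n} \<inter> avail smp n js = avail smp n js" using avail_subset by blast
    then show "(\<Sum>j\<in>avail smp n js. \<phi> j) = (\<Sum>j=1..n. if j \<in> avail smp n js then \<phi> j else 0)"
      by (simp add: sum.If_cases)
  qed
  also have "\<dots> = (\<Sum>j=1..n. \<Sum>js\<in>batches smp n b. if j \<in> avail smp n js then \<phi> j else 0)"
    by (rule sum.swap)
  also have "\<dots> = (\<Sum>j=1..n. real (card {js \<in> batches smp n b. j \<in> avail smp n js}) * \<phi> j)"
    by (simp add: sum.If_cases Int_def)
  also have "\<dots> = (\<Sum>j=1..n. real (card (batches smp n (Suc b))) / real n * \<phi> j)"
  proof (intro sum.cong refl)
    fix j assume "j \<in> {1..n}"
    from card_room[OF this assms, of smp]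
    have "real n * real (card {js \<in> batches smp n b. j \<in> avail smp n js}) = real (card (batches smp n (Suc b)))"
      by (metis of_nat_mult)
    then show "real (card {js \<in> batches smp n b. j \<in> avail smp n js}) * \<phi> j =
        real (card (batches smp n (Suc b))) / real n * \<phi> j"
      using assms by (simp add: field_simps)
  qed
  finally show ?thesis by (simp add: sum_distrib_left sum_divide_distrib)
qed

lemma sum_batches_sum_list:
  fixes \<phi> :: "nat \<Rightarrow> real"
  assumes "b \<le> n"
  shows "(\<Sum>js\<in>batches smp n b. \<Sum>j\<leftarrow>js. \<phi> j) =
    real (card (batches smp n b)) * (real b * ((\<Sum>j=1..n. \<phi> j) / real n))"
  using assms
proof (induction b)
  case 0 then show ?case by (simp add: batches_0)
next
  case (Suc b)
  have "(\<Sum>js\<in>batches smp n (Suc b). \<Sum>j\<leftarrow>js. \<phi> j) =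
      (\<Sum>js\<in>batches smp n b. \<Sum>j\<in>avail smp n js. \<phi> j) +
      (\<Sum>js\<in>batches smp n b. real (avail_card smp n b) * (\<Sum>j\<leftarrow>js. \<phi> j))"
    by (simp add: sum_batches_Suc sum.distrib card_avail)
  also have "\<dots> = real (card (batches smp n (Suc b))) * (\<Sum>j=1..n. \<phi> j) / real n +
      real (avail_card smp n b) * (real (card (batches smp n b)) * (real b * ((\<Sum>j=1..n. \<phi> j) / real n)))"
    using Suc by (simp add: sum_avail_swap sum_distrib_left[symmetric])
  finally show ?case by (simp add: card_batches_Suc algebra_simps add_divide_distrib)
qed

text \<open>Sampling without replacement can only help: the index added to a batch is negatively
  correlated with the centred sum over that batch.\<close>

lemma sum_batches_centred_sq:
  fixes \<zeta> :: "nat \<Rightarrow> 'a::euclidean_space"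
  assumes "b \<le> n" and \<zeta>: "(\<Sum>j=1..n. \<zeta> j) = 0"
  shows "(\<Sum>js\<in>batches smp n b. (norm (\<Sum>j\<leftarrow>js. \<zeta> j))\<^sup>2) \<le>
    real (card (batches smp n b)) * (real b * ((\<Sum>j=1..n. (norm (\<zeta> j))\<^sup>2) / real n))"
  using assms(1)
proof (induction b)
  case 0 then show ?case by (simp add: batches_0)
next
  case (Suc b)
  let ?s = "\<lambda>js. \<Sum>j\<leftarrow>js. \<zeta> j"
  have cross: "(\<Sum>j\<in>avail smp n js. \<zeta> j \<bullet> ?s js) \<le> 0" if "js \<in> batches smp n b" for js
  proof (cases smp)
    case With_Replacement
    then show ?thesis by (simp add: inner_sum_left[symmetric] \<zeta>[simplified])
  next
    case Without_Replacement
    then have js: "distinct js" "set js \<subseteq> {1..n}" using that by auto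
    then have "(\<Sum>j\<in>avail smp n js. \<zeta> j) = - ?s js"
      using Without_Replacement \<zeta> by (simp add: sum_diff sum_list_distinct_conv_sum_set)
    then show ?thesis by (simp add: inner_sum_left[symmetric])
  qed
  have "(\<Sum>js\<in>batches smp n (Suc b). (norm (?s js))\<^sup>2) =
      (\<Sum>js\<in>batches smp n b. \<Sum>j\<in>avail smp n js. (norm (\<zeta> j + ?s js))\<^sup>2)"
    by (simp add: sum_batches_Suc)
  also have "\<dots> \<le> (\<Sum>js\<in>batches smp n b. (\<Sum>j\<in>avail smp n js. (norm (\<zeta> j))\<^sup>2) +
      real (avail_card smp n b) * (norm (?s js))\<^sup>2)"
  proof (rule sum_mono)
    fix js assume js: "js \<in> batches smp n b"
    have "(\<Sum>j\<in>avail smp n js. (norm (\<zeta> j + ?s js))\<^sup>2) =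
        (\<Sum>j\<in>avail smp n js. (norm (\<zeta> j))\<^sup>2 + 2 * (\<zeta> j \<bullet> ?s js) + (norm (?s js))\<^sup>2)"
      by (simp add: power2_norm_eq_inner inner_add_left inner_add_right inner_commute algebra_simps)
    also have "\<dots> = (\<Sum>j\<in>avail smp n js. (norm (\<zeta> j))\<^sup>2) + 2 * (\<Sum>j\<in>avail smp n js. \<zeta> j \<bullet> ?s js) +
        real (avail_card smp n b) * (norm (?s js))\<^sup>2"
      using js by (simp add: sum.distrib card_avail sum_distrib_left)
    finally show "(\<Sum>j\<in>avail smp n js. (norm (\<zeta> j + ?s js))\<^sup>2) \<le>
        (\<Sum>j\<in>avail smp n js. (norm (\<zeta> j))\<^sup>2) + real (avail_card smp n b) * (norm (?s js))\<^sup>2"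
      using cross[OF js] by simp
  qed
  also have "\<dots> = real (card (batches smp n (Suc b))) * (\<Sum>j=1..n. (norm (\<zeta> j))\<^sup>2) / real n +
      real (avail_card smp n b) * (\<Sum>js\<in>batches smp n b. (norm (?s js))\<^sup>2)"
    using Suc by (simp add: sum.distrib sum_avail_swap sum_distrib_left)
  also have "\<dots> \<le> real (card (batches smp n (Suc b))) * (\<Sum>j=1..n. (norm (\<zeta> j))\<^sup>2) / real n +
      real (avail_card smp n b) *
        (real (card (batches smp n b)) * (real b * ((\<Sum>j=1..n. (norm (\<zeta> j))\<^sup>2) / real n)))"
    using Suc by (intro add_left_mono mult_left_mono) auto
  finally show ?case by (simp add: card_batches_Suc algebra_simps add_divide_distrib)
qed

text \<open>With a candidates left, j among them, the next draw avoids j in a - 1 cases; since a is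
  at most n, this is at most the fraction 1 - 1/n of the cases in either sampling mode.\<close>

lemma card_batches_avoiding:
  assumes "b \<le> n" "j \<in> {1..n}"
  shows "real (card {js \<in> batches smp n b. j \<notin> set js}) \<le> (1 - 1 / real n) ^ b * real (card (batches smp n b))"
  using assms(1)
proof (induction b)
  case 0 then show ?case by (simp add: batches_0 card_gt_0_iff) (simp add: Collect_conv_if)
next
  case (Suc b)
  let ?N = "\<lambda>b. real (card {js \<in> batches smp n b. j \<notin> set js})"
  have N: "?N b = (\<Sum>js\<in>batches smp n b. if j \<notin> set js then 1 else 0)" for b
    by (simp add: sum.If_cases Int_def)
  have "?N (Suc b) = (\<Sum>js\<in>batches smp n b. \<Sum>i\<in>avail smp n js. if j \<notin> set (i # js) then 1 else 0)"
    unfolding N sum_batches_Suc ..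
  also have "\<dots> = (\<Sum>js\<in>batches smp n b. if j \<notin> set js then real (avail_card smp n b) - 1 else 0)"
  proof (intro sum.cong refl)
    fix js assume js: "js \<in> batches smp n b"
    show "(\<Sum>i\<in>avail smp n js. if j \<notin> set (i # js) then 1 else 0) =
        (if j \<notin> set js then real (avail_card smp n b) - 1 else 0)"
    proof (cases "j \<in> set js")
      case False
      have j: "j \<in> avail smp n js" using False assms(2) by (cases smp) auto
      have "(\<Sum>i\<in>avail smp n js. if j \<notin> set (i # js) then 1 else 0) =
          (\<Sum>i\<in>avail smp n js. if i \<in> avail smp n js - {j} then 1 else (0::real))"
        using False by (intro sum.cong) auto
      also have "\<dots> = real (card (avail smp n js - {j}))"
        by (simp add: sum.If_cases Int_def) (rule arg_cong[where f = card], auto)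
      also have "\<dots> = real (avail_card smp n b) - 1"
        using j js by (simp add: card_Diff_singleton card_avail[symmetric] of_nat_diff card_gt_0_iff Suc_leI)
          (metis One_nat_def Suc_leI card_gt_0_iff empty_iff finite_avail of_nat_1 of_nat_diff)
      finally show ?thesis using False by simp
    qed simp
  qed
  also have "\<dots> = (real (avail_card smp n b) - 1) * ?N b"
    unfolding N by (simp add: sum_distrib_left if_distrib cong: if_cong)
  also have "\<dots> \<le> ((1 - 1 / real n) * real (avail_card smp n b)) * ?N b"
  proof (rule mult_right_mono)
    have "real (avail_card smp n b) \<le> real n" by (cases smp) (auto simp: avail_card_def)
    then have "real (avail_card smp n b) / real n \<le> 1" using Suc by (simp add: divide_le_eq_1)
    then show "real (avail_card smp n b) - 1 \<le> (1 - 1 / real n) * real (avail_card smp n b)"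
      by (simp add: left_diff_distrib)
  qed simp
  also have "\<dots> \<le> ((1 - 1 / real n) * real (avail_card smp n b)) *
      ((1 - 1 / real n) ^ b * real (card (batches smp n b)))"
    using Suc by (intro mult_left_mono) auto
  finally show ?case by (simp add: card_batches_Suc mult_ac)
qed

text \<open>With t = b/n, Bernoulli's inequality and (1 - 1/n)(1 + 1/n) at most 1 give the bound
  1/(1 + t), which is at most 1 - t/2 on the unit interval. Thus every table entry is refreshed with
  probability at least b/(2n).\<close>

lemma avoiding_ratio_le:
  assumes "1 \<le> b" "b \<le> n"
  shows "(1 - 1 / real n) ^ b \<le> 1 - real b / (2 * real n)"
proof -
  let ?t = "real b / real n"
  have t: "0 \<le> ?t" "?t \<le> 1" using assms by auto
  have "(1 - 1 / real n) ^ b * (1 + ?t) \<le> (1 - 1 / real n) ^ b * (1 + 1 / real n) ^ b"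
  proof (intro mult_left_mono)
    have "1 + real b * (1 / real n) \<le> (1 + 1 / real n) ^ b"
      by (rule Bernoulli_inequality) (use assms in \<open>auto intro: order_trans[of _ 0]\<close>)
    then show "1 + ?t \<le> (1 + 1 / real n) ^ b" by simp
  qed (use assms in auto)
  also have "\<dots> = (1 - (1 / real n)\<^sup>2) ^ b"
    by (simp add: power_mult_distrib[symmetric] algebra_simps power2_eq_square)
  also have "\<dots> \<le> 1" using assms by (intro power_le_one) (auto simp: power_le_one)
  finally have "(1 - 1 / real n) ^ b * (1 + ?t) \<le> 1" .
  moreover have "0 < 1 + ?t" using t by linarith
  ultimately have "(1 - 1 / real n) ^ b \<le> 1 / (1 + ?t)" by (simp only: pos_le_divide_eq)
  also have "\<dots> \<le> 1 - ?t / 2"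
  proof -
    have "1 \<le> (1 - s / 2) * (1 + s)" if "0 \<le> s" "s \<le> 1" for s :: real
      using mult_left_mono[OF that(2) that(1)] by (simp add: algebra_simps)
    from this[OF t] show ?thesis using t by (subst pos_divide_le_eq) linarith+
  qed
  finally show ?thesis by simp
qed

text \<open>Finite uniform averages stand in for expectations, so no integrability question arises;
  over an empty or infinite set the value is 0.\<close>

definition avg :: "'a set \<Rightarrow> ('a \<Rightarrow> real) \<Rightarrow> real" where
  "avg A g = (\<Sum>x\<in>A. g x) / real (card A)"

lemma avg_mono: "(\<And>x. x \<in> A \<Longrightarrow> g x \<le> h x) \<Longrightarrow> avg A g \<le> avg A h"
  unfolding avg_def by (intro divide_right_mono sum_mono) auto

lemma avg_nonneg: "(\<And>x. x \<in> A \<Longrightarrow> 0 \<le> g x) \<Longrightarrow> 0 \<le> avg A g"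
  unfolding avg_def by (intro divide_nonneg_nonneg sum_nonneg) auto

lemma avg_cong: "(\<And>x. x \<in> A \<Longrightarrow> g x = h x) \<Longrightarrow> avg A g = avg A h"
  unfolding avg_def by (auto intro!: sum.cong)

lemma avg_add: "avg A (\<lambda>x. g x + h x) = avg A g + avg A h"
  by (simp add: avg_def sum.distrib add_divide_distrib)

lemma avg_cmult: "avg A (\<lambda>x. c * g x) = c * avg A g"
  by (simp add: avg_def sum_distrib_left)

lemma avg_sum: "avg A (\<lambda>x. \<Sum>i\<in>S. g i x) = (\<Sum>i\<in>S. avg A (g i))"
  unfolding avg_def by (simp add: sum.swap[of _ S] sum_divide_distrib)

lemma avg_const: "finite A \<Longrightarrow> A \<noteq> {} \<Longrightarrow> avg A (\<lambda>_. c) = c"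
  by (simp add: avg_def)

definition batch_space :: "sampling \<Rightarrow> nat \<Rightarrow> nat \<Rightarrow> nat \<Rightarrow> (nat \<Rightarrow> nat list) set" where
  "batch_space smp n b K = PiE_dflt {1..K} [] (\<lambda>_. batches smp n b)"

lemma batches_nonempty: "b \<le> n \<Longrightarrow> batches smp n b \<noteq> {}"
  using card_batches_pos[of b n smp] by auto

lemma finite_batch_space [simp]: "finite (batch_space smp n b K)"
  unfolding batch_space_def by (intro finite_PiE_dflt) auto

lemma batch_space_nonempty: "b \<le> n \<Longrightarrow> batch_space smp n b K \<noteq> {}"
  unfolding batch_space_def by (simp add: batches_nonempty)

lemma batch_law_eq: "b \<le> n \<Longrightarrow> batch_law smp n b K = pmf_of_set (batch_space smp n b K)"
  unfolding batch_law_def batch_space_def by (intro Pi_pmf_of_set) (auto simp: batches_nonempty)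

lemma expectation_batch_law:
  assumes "b \<le> n"
  shows "measure_pmf.expectation (batch_law smp n b K) g = avg (batch_space smp n b K) g"
  unfolding batch_law_eq[OF assms] avg_def
  by (rule integral_pmf_of_set) (auto simp: batch_space_nonempty assms)

lemma batch_space_valid: "\<omega> \<in> batch_space smp n b K \<Longrightarrow> i \<in> {1..K} \<Longrightarrow> \<omega> i \<in> batches smp n b"
  by (auto simp: batch_space_def PiE_dflt_def)

lemma batch_space_upd:
  "\<omega> \<in> batch_space smp n b K \<Longrightarrow> k \<in> {1..K} \<Longrightarrow> js \<in> batches smp n b \<Longrightarrow>
    \<omega> (k := js) \<in> batch_space smp n b K"
  by (auto simp: batch_space_def PiE_dflt_def)

text \<open>The involution \<open>(\<omega>, js) \<mapsto> (\<omega> (k := js), \<omega> k)\<close> shows that redrawing one batch does not change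
  averages.\<close>

lemma avg_resample:
  assumes "b \<le> n" and k: "k \<in> {1..K}"
  shows "avg (batch_space smp n b K) g =
    avg (batch_space smp n b K) (\<lambda>\<omega>. avg (batches smp n b) (\<lambda>js. g (\<omega> (k := js))))"
proof -
  let ?\<Omega> = "batch_space smp n b K" and ?B = "batches smp n b"
  have "(\<Sum>p\<in>?\<Omega> \<times> ?B. g ((fst p)(k := snd p))) = (\<Sum>p\<in>?\<Omega> \<times> ?B. g (fst p))"
    by (rule sum.reindex_bij_witness[where i = "\<lambda>p. ((fst p)(k := snd p), fst p k)"
          and j = "\<lambda>p. ((fst p)(k := snd p), fst p k)"])
       (use k in \<open>auto intro!: batch_space_upd dest: batch_space_valid\<close>)
  also have "\<dots> = real (card ?B) * (\<Sum>\<omega>\<in>?\<Omega>. g \<omega>)"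
    by (simp add: sum.cartesian_product' sum_distrib_left)
  finally have "(\<Sum>\<omega>\<in>?\<Omega>. \<Sum>js\<in>?B. g (\<omega> (k := js))) = real (card ?B) * (\<Sum>\<omega>\<in>?\<Omega>. g \<omega>)"
    by (simp add: sum.cartesian_product')
  then show ?thesis
    using batches_nonempty[OF assms(1), of smp] by (simp add: avg_def sum_divide_distrib[symmetric])
qed

text \<open>The finite form of bounding a conditional expectation with all other batches
  fixed.\<close>

lemma avg_resample_le:
  assumes "b \<le> n" "k \<in> {1..K}"
    and "\<And>\<omega>. \<omega> \<in> batch_space smp n b K \<Longrightarrow> avg (batches smp n b) (\<lambda>js. g (\<omega> (k := js))) \<le> h \<omega>"
  shows "avg (batch_space smp n b K) g \<le> avg (batch_space smp n b K) h"
  unfolding avg_resample[OF assms(1,2), of _ g] by (rule avg_mono[OF assms(3)])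

text \<open>Allows all iterations below a horizon K to be averaged over one common space, although
  each expectation is defined with its own number of batches.\<close>

lemma avg_batch_law_restrict:
  assumes "b \<le> n" "k \<le> K"
    and g: "\<And>\<omega>. \<omega> \<in> batch_space smp n b K \<Longrightarrow> g (\<lambda>i. if i \<in> {1..k} then \<omega> i else []) = g \<omega>"
  shows "measure_pmf.expectation (batch_law smp n b k) g = avg (batch_space smp n b K) g"
proof -
  have "batch_law smp n b k = map_pmf (\<lambda>\<omega> i. if i \<in> {1..k} then \<omega> i else []) (batch_law smp n b K)"
    unfolding batch_law_def by (rule Pi_pmf_subset) (use assms in auto)
  then have "measure_pmf.expectation (batch_law smp n b k) g =
      measure_pmf.expectation (batch_law smp n b K) (\<lambda>\<omega>. g (\<lambda>i. if i \<in> {1..k} then \<omega> i else []))"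
    by simp
  also have "\<dots> = avg (batch_space smp n b K) g"
    unfolding expectation_batch_law[OF assms(1)] by (rule avg_cong[OF g])
  finally show ?thesis .
qed

lemma length_batches: "js \<in> batches smp n b \<Longrightarrow> length js = b"
  by (cases smp) auto

lemma inner_sum_list: "a \<bullet> (\<Sum>j\<leftarrow>js. \<zeta> j) = (\<Sum>j\<leftarrow>js. a \<bullet> \<zeta> j)"
  by (induction js) (auto simp: inner_add_right)

abbreviation mean_sq :: "nat \<Rightarrow> (nat \<Rightarrow> 'a::real_normed_vector) \<Rightarrow> real" where
  "mean_sq n v \<equiv> (\<Sum>j=1..n. (norm (v j))\<^sup>2) / real n"

abbreviation batch_deviation :: "nat \<Rightarrow> nat list \<Rightarrow> (nat \<Rightarrow> 'a::real_normed_vector) \<Rightarrow> 'a" where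
  "batch_deviation n js v \<equiv>
    (1 / real (length js)) *\<^sub>R (\<Sum>j\<leftarrow>js. v j) - (1 / real n) *\<^sub>R (\<Sum>j=1..n. v j)"

text \<open>Bias-variance decomposition: after centring, the term linear in the batch averages to
  zero, and the variance of a batch mean is at most 1/b times the raw second moment, with or without
  replacement.\<close>

lemma avg_batches_centred:
  fixes \<xi> :: "nat \<Rightarrow> 'a::euclidean_space"
  assumes b: "1 \<le> b" "b \<le> n"
  shows "avg (batches smp n b) (\<lambda>js. (norm (a + batch_deviation n js \<xi>))\<^sup>2)
    \<le> (norm a)\<^sup>2 + 1 / real b * mean_sq n \<xi>"
proof -
  let ?B = "batches smp n b"
  define \<mu> where "\<mu> = (1 / real n) *\<^sub>R (\<Sum>j=1..n. \<xi> j)"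
  define \<zeta> where "\<zeta> j = \<xi> j - \<mu>" for j
  have n: "real n > 0" using b by simp
  have \<zeta>0: "(\<Sum>j=1..n. \<zeta> j) = 0"
    using n by (simp add: \<zeta>_def sum_subtractf \<mu>_def sum_constant_scaleR)
  have "(\<Sum>j=1..n. (norm (\<zeta> j))\<^sup>2) \<le> (\<Sum>j=1..n. (norm (\<xi> j))\<^sup>2)"
  proof -
    have "(norm (\<xi> j))\<^sup>2 = (norm (\<zeta> j))\<^sup>2 + 2 * (\<mu> \<bullet> \<zeta> j) + (norm \<mu>)\<^sup>2" for j
    proof -
      have "\<xi> j = \<zeta> j + \<mu>" by (simp add: \<zeta>_def)
      then show ?thesis unfolding power2_norm_eq_inner by (simp add: inner_add_left inner_add_right inner_commute)
    qed
    then have "(\<Sum>j=1..n. (norm (\<xi> j))\<^sup>2) = (\<Sum>j=1..n. (norm (\<zeta> j))\<^sup>2) + 2 * (\<mu> \<bullet> (\<Sum>j=1..n. \<zeta> j)) + real n * (norm \<mu>)\<^sup>2"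
      by (simp add: sum.distrib inner_sum_right sum_distrib_left)
    then show ?thesis unfolding \<zeta>0 by simp
  qed
  then have \<zeta>\<xi>: "mean_sq n \<zeta> \<le> mean_sq n \<xi>" by (rule divide_right_mono) simp
  have expand: "(norm (a + batch_deviation n js \<xi>))\<^sup>2 =
      (norm a)\<^sup>2 + (2 / real b) * (\<Sum>j\<leftarrow>js. a \<bullet> \<zeta> j) + (1 / (real b)\<^sup>2) * (norm (\<Sum>j\<leftarrow>js. \<zeta> j))\<^sup>2"
    if js: "js \<in> ?B" for js
  proof -
    have "(\<Sum>j\<leftarrow>js. \<zeta> j) = (\<Sum>j\<leftarrow>js. \<xi> j) - real (length js) *\<^sub>R \<mu>"
      by (induction js) (auto simp: \<zeta>_def algebra_simps)
    then have dev: "batch_deviation n js \<xi> = (1 / real b) *\<^sub>R (\<Sum>j\<leftarrow>js. \<zeta> j)"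
      using b by (simp add: length_batches[OF js] \<mu>_def scaleR_diff_right)
    have "(norm (a + (1 / real b) *\<^sub>R z))\<^sup>2 = (norm a)\<^sup>2 + (2 / real b) * (a \<bullet> z) + (1 / (real b)\<^sup>2) * (norm z)\<^sup>2" for z
      unfolding power2_norm_eq_inner
      by (simp add: inner_add_left inner_add_right inner_commute power2_eq_square)
    then show ?thesis unfolding dev by (simp add: inner_sum_list)
  qed
  have cross: "avg ?B (\<lambda>js. \<Sum>j\<leftarrow>js. a \<bullet> \<zeta> j) = 0"
  proof -
    have "(\<Sum>j=1..n. a \<bullet> \<zeta> j) = 0" using \<zeta>0 by (simp add: inner_sum_right[symmetric])
    then show ?thesis unfolding avg_def sum_batches_sum_list[OF b(2)] by simp
  qed
  have "0 < card ?B" by (rule card_batches_pos[OF b(2)])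
  then have var: "avg ?B (\<lambda>js. (norm (\<Sum>j\<leftarrow>js. \<zeta> j))\<^sup>2) \<le> real b * mean_sq n \<zeta>"
    using sum_batches_centred_sq[OF b(2) \<zeta>0, of smp] unfolding avg_def
    by (simp only: pos_divide_le_eq of_nat_0_less_iff mult.commute[of _ "real (card _)"])
  have "avg ?B (\<lambda>js. (norm (a + batch_deviation n js \<xi>))\<^sup>2) =
      avg ?B (\<lambda>js. (norm a)\<^sup>2 + (2 / real b) * (\<Sum>j\<leftarrow>js. a \<bullet> \<zeta> j) + (1 / (real b)\<^sup>2) * (norm (\<Sum>j\<leftarrow>js. \<zeta> j))\<^sup>2)"
    by (rule avg_cong[OF expand])
  also have "\<dots> = (norm a)\<^sup>2 + (1 / (real b)\<^sup>2) * avg ?B (\<lambda>js. (norm (\<Sum>j\<leftarrow>js. \<zeta> j))\<^sup>2)"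
    by (simp only: avg_add avg_cmult cross) (simp add: avg_const batches_nonempty b)
  also have "\<dots> \<le> (norm a)\<^sup>2 + (1 / (real b)\<^sup>2) * (real b * mean_sq n \<xi>)"
    using \<zeta>\<xi> by (intro add_left_mono mult_left_mono order_trans[OF var]) auto
  finally show ?thesis using b by (simp add: power2_eq_square)
qed

text \<open>The hypothesis on \<open>a\<close> and \<open>\<xi>\<close> says that neither sees the
  current batch; it replaces measurability with respect to the past.\<close>

lemma avg_batch_variance:
  fixes \<xi> :: "(nat \<Rightarrow> nat list) \<Rightarrow> nat \<Rightarrow> 'a::euclidean_space"
  assumes b: "1 \<le> b" "b \<le> n" and k: "k \<in> {1..K}"
    and indep: "\<And>\<omega> js. \<omega> \<in> batch_space smp n b K \<Longrightarrow> js \<in> batches smp n b \<Longrightarrow>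
      a (\<omega> (k := js)) = a \<omega> \<and> \<xi> (\<omega> (k := js)) = \<xi> \<omega>"
  shows "avg (batch_space smp n b K) (\<lambda>\<omega>. (norm (a \<omega> + batch_deviation n (\<omega> k) (\<xi> \<omega>)))\<^sup>2)
    \<le> avg (batch_space smp n b K) (\<lambda>\<omega>. (norm (a \<omega>))\<^sup>2 + 1 / real b * mean_sq n (\<xi> \<omega>))"
proof (rule avg_resample_le[OF b(2) k])
  fix \<omega> assume \<omega>: "\<omega> \<in> batch_space smp n b K"
  let ?g = "\<lambda>\<omega>. (norm (a \<omega> + batch_deviation n (\<omega> k) (\<xi> \<omega>)))\<^sup>2"
  have "avg (batches smp n b) (\<lambda>js. ?g (\<omega> (k := js))) =
      avg (batches smp n b) (\<lambda>js. (norm (a \<omega> + batch_deviation n js (\<xi> \<omega>)))\<^sup>2)"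
    by (rule avg_cong) (simp add: indep[OF \<omega>])
  also have "\<dots> \<le> (norm (a \<omega>))\<^sup>2 + 1 / real b * mean_sq n (\<xi> \<omega>)" by (rule avg_batches_centred[OF b])
  finally show "avg (batches smp n b) (\<lambda>js. ?g (\<omega> (k := js))) \<le> (norm (a \<omega>))\<^sup>2 + 1 / real b * mean_sq n (\<xi> \<omega>)" .
qed

lemma avg_batch_sum_list:
  fixes \<phi> :: "(nat \<Rightarrow> nat list) \<Rightarrow> nat \<Rightarrow> real"
  assumes b: "b \<le> n" and k: "k \<in> {1..K}"
    and indep: "\<And>\<omega> js. \<omega> \<in> batch_space smp n b K \<Longrightarrow> js \<in> batches smp n b \<Longrightarrow> \<phi> (\<omega> (k := js)) = \<phi> \<omega>"
  shows "avg (batch_space smp n b K) (\<lambda>\<omega>. \<Sum>j\<leftarrow>\<omega> k. \<phi> \<omega> j)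
    \<le> avg (batch_space smp n b K) (\<lambda>\<omega>. real b * ((\<Sum>j=1..n. \<phi> \<omega> j) / real n))"
proof (rule avg_resample_le[OF b k])
  fix \<omega> assume \<omega>: "\<omega> \<in> batch_space smp n b K"
  have "avg (batches smp n b) (\<lambda>js. \<Sum>j\<leftarrow>(\<omega> (k := js)) k. \<phi> (\<omega> (k := js)) j) =
      avg (batches smp n b) (\<lambda>js. \<Sum>j\<leftarrow>js. \<phi> \<omega> j)"
    by (rule avg_cong) (simp add: indep[OF \<omega>])
  also have "\<dots> = real b * ((\<Sum>j=1..n. \<phi> \<omega> j) / real n)"
    using batches_nonempty[OF b, of smp] unfolding avg_def sum_batches_sum_list[OF b] by simp
  finally show "avg (batches smp n b) (\<lambda>js. \<Sum>j\<leftarrow>(\<omega> (k := js)) k. \<phi> (\<omega> (k := js)) j)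
      \<le> real b * ((\<Sum>j=1..n. \<phi> \<omega> j) / real n)" by simp
qed

text \<open>Repeated draws of an index do not add to its chance of refreshing an entry, so the
  avoidance bound is used instead of the expected multiplicity.\<close>

lemma avg_batch_avoid:
  fixes \<phi> :: "(nat \<Rightarrow> nat list) \<Rightarrow> nat \<Rightarrow> real"
  assumes b: "1 \<le> b" "b \<le> n" and k: "k \<in> {1..K}"
    and indep: "\<And>\<omega> js. \<omega> \<in> batch_space smp n b K \<Longrightarrow> js \<in> batches smp n b \<Longrightarrow> \<phi> (\<omega> (k := js)) = \<phi> \<omega>"
    and nonneg: "\<And>\<omega> j. 0 \<le> \<phi> \<omega> j"
  shows "avg (batch_space smp n b K) (\<lambda>\<omega>. \<Sum>j=1..n. if j \<in> set (\<omega> k) then 0 else \<phi> \<omega> j)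
    \<le> avg (batch_space smp n b K) (\<lambda>\<omega>. (1 - real b / (2 * real n)) * (\<Sum>j=1..n. \<phi> \<omega> j))"
proof (rule avg_resample_le[OF b(2) k])
  fix \<omega> assume \<omega>: "\<omega> \<in> batch_space smp n b K"
  let ?B = "batches smp n b"
  have pos: "0 < card ?B" by (rule card_batches_pos[OF b(2)])
  have "avg ?B (\<lambda>js. \<Sum>j=1..n. if j \<in> set ((\<omega> (k := js)) k) then 0 else \<phi> (\<omega> (k := js)) j) =
      avg ?B (\<lambda>js. \<Sum>j=1..n. if j \<in> set js then 0 else \<phi> \<omega> j)"
    by (rule avg_cong) (simp add: indep[OF \<omega>] cong: if_cong)
  also have "\<dots> = (\<Sum>j=1..n. avg ?B (\<lambda>js. if j \<in> set js then 0 else \<phi> \<omega> j))" by (rule avg_sum)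
  also have "\<dots> \<le> (\<Sum>j=1..n. (1 - real b / (2 * real n)) * \<phi> \<omega> j)"
  proof (rule sum_mono)
    fix j assume j: "j \<in> {1..n}"
    have "(\<Sum>js\<in>?B. if j \<in> set js then 0 else \<phi> \<omega> j) = \<phi> \<omega> j * real (card {js \<in> ?B. j \<notin> set js})"
      by (simp add: sum.If_cases Int_def Collect_neg_eq[symmetric])
    also have "\<dots> \<le> \<phi> \<omega> j * ((1 - real b / (2 * real n)) * real (card ?B))"
      using card_batches_avoiding[OF b(2) j, of smp] mult_right_mono[OF avoiding_ratio_le[OF b], of "real (card ?B)"]
      by (intro mult_left_mono nonneg) auto
    finally show "avg ?B (\<lambda>js. if j \<in> set js then 0 else \<phi> \<omega> j) \<le> (1 - real b / (2 * real n)) * \<phi> \<omega> j"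
      using pos unfolding avg_def by (subst pos_divide_le_eq) (simp_all add: mult_ac)
  qed
  finally show "avg ?B (\<lambda>js. \<Sum>j=1..n. if j \<in> set ((\<omega> (k := js)) k) then 0 else \<phi> (\<omega> (k := js)) j)
      \<le> (1 - real b / (2 * real n)) * (\<Sum>j=1..n. \<phi> \<omega> j)" by (simp add: sum_distrib_left)
qed

section \<open>Summation inequalities\<close>

lemma sum_shift_le:
  fixes D :: "nat \<Rightarrow> real"
  assumes "\<And>k. 0 \<le> D k"
  shows "(\<Sum>k<K. if k = 0 then 0 else D (k - 1)) \<le> (\<Sum>k<K. D k)"
proof (cases K)
  case (Suc m)
  have "(\<Sum>k<Suc m. if k = 0 then 0 else D (k - 1)) = (\<Sum>k<m. D k)"
    by (subst sum.lessThan_Suc_shift) simp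
  also have "\<dots> \<le> (\<Sum>k<Suc m. D k)" using assms by simp
  finally show ?thesis using Suc by simp
qed simp

lemma contraction_sum:
  fixes T c :: "nat \<Rightarrow> real"
  assumes \<theta>: "0 \<le> \<theta>" "\<theta> \<le> 1" and T0: "T 0 = 0" and T: "\<And>k. 0 \<le> T k" and c0: "0 \<le> c 0"
    and step: "\<And>k. Suc k < K \<Longrightarrow> T (Suc k) \<le> (1 - \<theta>) * T k + c (Suc k)"
  shows "\<theta> * (\<Sum>k<K. T k) \<le> (\<Sum>k<K. c k)"
proof (cases K)
  case (Suc m)
  \<comment> \<open>The invariant carries the last term in full; at the end it yields its own share
    \<open>\<theta> * T m\<close>.\<close>
  have "T m + \<theta> * (\<Sum>k<m. T k) \<le> (\<Sum>k\<le>m. c k)" if "m < K" for m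
    using that
  proof (induction m)
    case 0 then show ?case using T0 c0 by simp
  next
    case (Suc m)
    then show ?case using step[of m] by (simp add: algebra_simps)
  qed
  from this[of m] have "T m + \<theta> * (\<Sum>k<m. T k) \<le> (\<Sum>k<K. c k)" using Suc by (simp add: lessThan_Suc_atMost)
  moreover have "\<theta> * T m \<le> T m" using \<theta> T by (intro mult_left_le_one_le)
  ultimately show ?thesis using Suc by (simp add: algebra_simps)
qed simp

text \<open>Exchange the sums: a displacement i is counted only by later k of the same epoch, that
  is for i < k < i + q, hence fewer than q times.\<close>

lemma epoch_sum_le:
  fixes D :: "nat \<Rightarrow> real"
  assumes D: "\<And>k. 0 \<le> D k" and q: "1 \<le> q"
  shows "(\<Sum>k<K. \<Sum>i\<in>{k div q * q..<k}. D i) \<le> real q * (\<Sum>i<K. D i)"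
proof -
  have "(\<Sum>k<K. \<Sum>i\<in>{k div q * q..<k}. D i) = (\<Sum>k<K. \<Sum>i<K. if i \<in> {k div q * q..<k} then D i else 0)"
  proof (rule sum.cong[OF refl])
    fix k assume "k \<in> {..<K}"
    then have "{..<K} \<inter> {k div q * q..<k} = {k div q * q..<k}" by auto
    then show "(\<Sum>i\<in>{k div q * q..<k}. D i) = (\<Sum>i<K. if i \<in> {k div q * q..<k} then D i else 0)"
      using sum.inter_restrict[of "{..<K}" D "{k div q * q..<k}"] by simp
  qed
  also have "\<dots> = (\<Sum>i<K. \<Sum>k<K. if i \<in> {k div q * q..<k} then D i else 0)" by (rule sum.swap)
  also have "\<dots> \<le> (\<Sum>i<K. real q * D i)"
  proof (rule sum_mono)
    fix i
    have sub: "{k. k < K \<and> i \<in> {k div q * q..<k}} \<subseteq> {i..<i + q}"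
    proof
      fix k assume "k \<in> {k. k < K \<and> i \<in> {k div q * q..<k}}"
      then have "k div q * q \<le> i" "i < k" by auto
      moreover have "k = k div q * q + k mod q" by simp
      moreover have "k mod q < q" using q by simp
      ultimately have "k < i + q" by linarith
      then show "k \<in> {i..<i + q}" using \<open>i < k\<close> by simp
    qed
    have "(\<Sum>k<K. if i \<in> {k div q * q..<k} then D i else 0) = real (card {k. k < K \<and> i \<in> {k div q * q..<k}}) * D i"
      by (simp add: sum.If_cases Int_def)
    also have "\<dots> \<le> real q * D i"
      using card_mono[OF _ sub] by (intro mult_right_mono D) auto
    finally show "(\<Sum>k<K. if i \<in> {k div q * q..<k} then D i else 0) \<le> real q * D i" .
  qed
  finally show ?thesis by (simp add: sum_distrib_left)
qed

section \<open>Pathwise estimates\<close>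

lemma table_cong:
  assumes "\<And>i. i \<le> k \<Longrightarrow> x i = x' i" "\<And>i. 1 \<le> i \<Longrightarrow> i < k \<Longrightarrow> B i = B' i"
  shows "table x B k j = table x' B' k j"
  using assms by (induction k) auto

lemma vr_estimate_cong:
  assumes k: "k \<noteq> 0" and x: "\<And>i. i \<le> k \<Longrightarrow> x i = x' i" and u: "\<And>i. i < k \<Longrightarrow> u i = u' i"
    and B: "\<And>i. 1 \<le> i \<Longrightarrow> i \<le> k \<Longrightarrow> B i = B' i"
  shows "vr_estimate est M n f b q x u B k = vr_estimate est M n f b q x' u' B' k"
proof -
  have "table x B k = table x' B' k" by (intro ext table_cong) (auto simp: x B)
  moreover have "x (k div q * q) = x' (k div q * q)" by (rule x) simp
  moreover have "B k = B' k" using k by (intro B) auto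
  moreover have "u (k - 1) = u' (k - 1)" "x (k - 1) = x' (k - 1)" "x k = x' k" using k by (auto intro: u x)
  ultimately show ?thesis by (cases est) (simp_all add: Let_def)
qed

lemma table_in:
  assumes "\<And>i. i \<le> k \<Longrightarrow> x i \<in> M" shows "table x B k j \<in> M"
  using assms
proof (induction k)
  case (Suc k)
  have "table x B k j \<in> M" by (rule Suc.IH) (simp add: Suc.prems)
  then show ?case using Suc.prems[of k] by simp
qed simp

lemma GDERIV_gradient:
  fixes f :: "'a::euclidean_space \<Rightarrow> real"
  assumes "f differentiable (at x)" shows "GDERIV f x :> gradient f x"
proof -
  obtain f' where f': "(f has_derivative f') (at x)" using assms by (auto simp: differentiable_def)
  define D where "D = (\<Sum>b\<in>Basis. f' b *\<^sub>R b)"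
  have "f' h = h \<bullet> D" for h
    using linear_eq_sum_Basis[OF has_derivative_linear[OF f'], of h]
    by (simp add: D_def inner_sum_right mult.commute)
  then have "f' = (\<lambda>h. h \<bullet> D)" by (rule ext)
  then have "GDERIV f x :> D" using f' by (simp only: gderiv_def)
  then show ?thesis by (simp add: gradient_eqI)
qed

lemma norm_mean_le:
  fixes v :: "nat \<Rightarrow> 'a::real_normed_vector"
  assumes "\<And>j. j \<in> {1..n} \<Longrightarrow> norm (v j) \<le> c" "1 \<le> n"
  shows "norm ((1 / real n) *\<^sub>R (\<Sum>j=1..n. v j)) \<le> c"
proof -
  have "norm (\<Sum>j=1..n. v j) \<le> (\<Sum>j=1..n. c)" using assms(1) by (rule sum_norm_le)
  then have "norm (\<Sum>j=1..n. v j) \<le> real n * c" by simp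
  then show ?thesis using assms(2) by (simp add: field_simps)
qed

lemma GDERIV_finite_avg:
  fixes f :: "nat \<Rightarrow> 'a::euclidean_space \<Rightarrow> real"
  assumes "\<And>j. j \<in> {1..n} \<Longrightarrow> GDERIV (f j) x :> g j"
  shows "GDERIV (finite_avg n f) x :> (1 / real n) *\<^sub>R (\<Sum>j=1..n. g j)"
proof -
  have "((\<lambda>x. \<Sum>j=1..n. f j x) has_derivative (\<lambda>h. \<Sum>j=1..n. h \<bullet> g j)) (at x)"
    using assms unfolding gderiv_def by (intro has_derivative_sum) auto
  then have "((\<lambda>x. (1 / real n) * (\<Sum>j=1..n. f j x)) has_derivative (\<lambda>h. (1 / real n) * (\<Sum>j=1..n. h \<bullet> g j))) (at x)"
    by (rule has_derivative_mult_right)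
  then show ?thesis
    unfolding gderiv_def finite_avg_def by (simp add: inner_sum_right)
qed

text \<open>Everything used about \<open>M\<close>, \<open>retr\<close>, \<open>B\<close> and
  \<open>R\<close>, with constants that know nothing of \<open>n\<close>, the components or the run.
  The uniformity of the final bounds rests on this separation.\<close>

locale run_geometry =
  fixes M U :: "(real^'d) set" and retr :: "real^'d \<Rightarrow> real^'d \<Rightarrow> real^'d" and R :: "real^'d \<Rightarrow> real"
    and B :: "real^'d \<Rightarrow> real^'d \<Rightarrow> real^'p" and C :: "(real^'d) set"
    and Lf Mf LR cf cB LP \<rho> L2 r0 dM :: real
  assumes subspace_T: "x \<in> M \<Longrightarrow> subspace (tangent_space M x)"
    and linear_B: "x \<in> M \<Longrightarrow> linear (B x)"
    and B_tangent: "x \<in> M \<Longrightarrow> v \<in> tangent_space M x \<Longrightarrow> B x v = 0"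
    and cB: "0 \<le> cB" "x \<in> M \<Longrightarrow> v \<in> normal_space M x \<Longrightarrow> norm v \<le> cB * norm (B x v)"
    and LP: "0 \<le> LP" "x \<in> M \<Longrightarrow> y \<in> M \<Longrightarrow> v \<in> normal_space M y \<Longrightarrow>
      norm (tangent_proj M x v) \<le> LP * norm (x - y) * norm v"
    and retr_in: "x \<in> M \<Longrightarrow> v \<in> tangent_space M x \<Longrightarrow> retr x v \<in> M"
    and \<rho>: "0 < \<rho>" and L2: "0 \<le> L2"
    and retr_close: "x \<in> M \<Longrightarrow> v \<in> tangent_space M x \<Longrightarrow> norm v < \<rho> \<Longrightarrow>
      norm (retr x v - x - v) \<le> L2 * (norm v)\<^sup>2"
    and r0: "0 < r0" "x \<in> M \<Longrightarrow> ball x r0 \<subseteq> U"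
    and net: "finite C" "M \<subseteq> (\<Union>c\<in>C. ball c (r0 / 2))"
    and dM: "x \<in> M \<Longrightarrow> y \<in> M \<Longrightarrow> dist x y \<le> dM"
    and R_convex: "convex_on UNIV R" and R_lipschitz: "LR-lipschitz_on UNIV R"
    and Lf: "0 \<le> Lf" and Mf: "0 < Mf" and cf: "1 \<le> cf"
begin

text \<open>\<open>M1\<close> is the displacement per unit of tangent step; \<open>LG\<close> below
  is the Lipschitz constant of Riemannian gradients under transport by projection.\<close>

definition "M1 = 1 + L2 * \<rho>"
definition "Mu = cf * Mf"
definition "LG = Lf + LP * Mf"

text \<open>\<open>Ct\<close> is the price of a unit of inner tolerance. \<open>Cd\<close> collects
  the second-order losses of a step: the retraction error seen by \<open>F\<close> and by
  \<open>R\<close>, and the curvature of \<open>F\<close>. \<open>osc\<close> bounds the change of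
  the objective along a whole run.\<close>

definition "Ct = 2 * LR * cB"
definition "Cd = Mf * L2 + LR * L2 + Lf * M1\<^sup>2"
definition "osc = 2 * real (card C) * ((Mf + Lf * r0) * r0) + LR * dM"
text \<open>The summands serve SVRG and SARAH, SAGA, and SAG in this order; a sum replaces the case
  distinction. \<open>CA\<close> solves the momentum recursion with contraction rate (1 -
  \<open>\<chi>bar\<close>)/2, the displacement being converted into steps by
  \<open>M1\<close>.\<close>

definition "CE \<kappa>b = 4 * LG\<^sup>2 + 24 * Lf\<^sup>2 + 96 * Lf\<^sup>2 / \<kappa>b\<^sup>2"
definition "CA \<chi>bar \<kappa>b = ((1 + 2 / (1 - \<chi>bar)) * (LG * M1)\<^sup>2 + CE \<kappa>b * M1\<^sup>2) * (2 / (1 - \<chi>bar))"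

lemma LR: "0 \<le> LR" by (rule lipschitz_on_nonneg[OF R_lipschitz])

lemma M_subset_U: "x \<in> M \<Longrightarrow> x \<in> U" using r0 by (metis centre_in_ball subsetD)

lemma Mf_le_Mu: "Mf \<le> Mu" using Mf cf by (simp add: Mu_def)

lemma M1: "1 \<le> M1" using L2 \<rho> by (simp add: M1_def)

lemma Ct: "0 \<le> Ct" using LR cB by (simp add: Ct_def)

lemma CE: "0 \<le> CE \<kappa>b" by (simp add: CE_def)

lemma CA: "\<chi>bar < 1 \<Longrightarrow> 0 \<le> CA \<chi>bar \<kappa>b" using CE by (simp add: CA_def)

lemma LG: "0 \<le> LG" using Lf LP Mf by (simp add: LG_def)

lemma proj_norm: "x \<in> M \<Longrightarrow> norm (tangent_proj M x v) \<le> norm v"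
  unfolding tangent_proj_def by (rule norm_closest_point_subspace_le[OF subspace_T])

lemma proj_linear: "x \<in> M \<Longrightarrow> linear (tangent_proj M x)"
  unfolding tangent_proj_def by (rule linear_closest_point_subspace[OF subspace_T])

lemma proj_inner: "x \<in> M \<Longrightarrow> v \<in> tangent_space M x \<Longrightarrow> tangent_proj M x w \<bullet> v = w \<bullet> v"
  unfolding tangent_proj_def by (rule closest_point_subspace_inner[OF subspace_T])

lemma proj_normal: "x \<in> M \<Longrightarrow> v - tangent_proj M x v \<in> normal_space M x"
  unfolding tangent_proj_def normal_space_def by (rule closest_point_subspace_comp_in[OF subspace_T])

text \<open>The normal part of \<open>\<nabla>h(y)\<close> is lost at \<open>y\<close> but partly visible in \<open>T\<^sub>xM\<close>; this costs
  the Lipschitz constant of the tangent projection times the gradient bound.\<close>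

lemma rgrad_transport:
  assumes x: "x \<in> M" and y: "y \<in> M"
    and lip: "Lf-lipschitz_on U (gradient h)" and bd: "norm (gradient h y) \<le> Mf"
  shows "norm (rgrad M h x - tangent_proj M x (rgrad M h y)) \<le> LG * norm (x - y)"
proof -
  let ?P = "tangent_proj M x" and ?n = "gradient h y - tangent_proj M y (gradient h y)"
  have eq: "rgrad M h x - ?P (rgrad M h y) = ?P (gradient h x - gradient h y) + ?P ?n"
    by (simp add: rgrad_def linear_diff[OF proj_linear[OF x]])
  have "norm (?P (gradient h x - gradient h y)) \<le> norm (gradient h x - gradient h y)" by (rule proj_norm[OF x])
  also have "\<dots> \<le> Lf * norm (x - y)"
    using lipschitz_onD[OF lip M_subset_U[OF x] M_subset_U[OF y]] by (simp add: dist_norm)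
  finally have 1: "norm (?P (gradient h x - gradient h y)) \<le> Lf * norm (x - y)" .
  have "norm ?n \<le> norm (gradient h y)"
    unfolding tangent_proj_def by (rule norm_closest_point_subspace_le[OF subspace_T[OF y]])
  then have "norm (?P ?n) \<le> LP * norm (x - y) * Mf"
    using LP(2)[OF x y proj_normal[OF y], of "gradient h y"] bd LP(1)
    by (smt (verit) mult_left_mono mult_nonneg_nonneg norm_ge_zero)
  then show ?thesis unfolding eq LG_def using 1 norm_triangle_ineq[of "?P (gradient h x - gradient h y)" "?P ?n"]
    by (simp add: algebra_simps)
qed

text \<open>\<open>U\<close> need not be convex, so the segment is kept in a ball around a point of
  \<open>M\<close>. The mean value estimate gives \<open>Lf\<close> in place of the sharp half of
  it.\<close>

lemma quadratic_upper_bound: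
  assumes x: "x \<in> M" and y: "dist x y < r0" and der: "\<And>z. GDERIV h z :> gradient h z"
    and lip: "Lf-lipschitz_on U (gradient h)"
  shows "\<bar>h y - h x - gradient h x \<bullet> (y - x)\<bar> \<le> Lf * (norm (y - x))\<^sup>2"
proof -
  let ?S = "closed_segment x y"
  have S: "?S \<subseteq> ball x r0" using y r0(1) by (intro closed_segment_subset) auto
  have "norm (h y - h x - (\<lambda>z v. v \<bullet> gradient h z) x (y - x)) \<le> norm (y - x) * (Lf * norm (y - x))"
  proof (rule differentiable_bound_linearization[where S = ?S and f' = "\<lambda>z v. v \<bullet> gradient h z"])
    fix t :: real assume "t \<in> {0..1}"
    moreover have "x + t *\<^sub>R (y - x) = (1 - t) *\<^sub>R x + t *\<^sub>R y" by (simp add: algebra_simps)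
    ultimately show "x + t *\<^sub>R (y - x) \<in> ?S" unfolding closed_segment_def by auto
  next
    fix z assume z: "z \<in> ?S"
    show "(h has_derivative (\<lambda>v. v \<bullet> gradient h z)) (at z within ?S)"
      using der[of z] unfolding gderiv_def by (rule has_derivative_at_withinI)
    have "z \<in> U" using z S r0(2)[OF x] by blast
    then have "norm (gradient h z - gradient h x) \<le> Lf * norm (z - x)"
      using lipschitz_onD[OF lip _ M_subset_U[OF x]] by (simp add: dist_norm)
    also have "\<dots> \<le> Lf * norm (y - x)"
      using segment_bound1[OF z] Lf by (intro mult_left_mono) (simp_all add: norm_minus_commute)
    finally have gz: "norm (gradient h z - gradient h x) \<le> Lf * norm (y - x)" .
    show "onorm ((\<lambda>v. v \<bullet> gradient h z) - (\<lambda>v. v \<bullet> gradient h x)) \<le> Lf * norm (y - x)"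
    proof (rule onorm_le)
      fix v
      have "norm (v \<bullet> (gradient h z - gradient h x)) \<le> norm v * norm (gradient h z - gradient h x)"
        by (simp add: Cauchy_Schwarz_ineq2)
      also have "\<dots> \<le> norm v * (Lf * norm (y - x))" by (intro mult_left_mono gz) simp
      finally show "norm (((\<lambda>v. v \<bullet> gradient h z) - (\<lambda>v. v \<bullet> gradient h x)) v) \<le> Lf * norm (y - x) * norm v"
        by (simp add: inner_diff_right mult.commute)
    qed
  qed simp
  then show ?thesis by (simp add: inner_commute power2_eq_square mult_ac)
qed

end

text \<open>\<open>small1\<close> keeps every tangent step in the range of the retraction estimate.
  \<open>small2\<close> keeps every displacement below \<open>r0\<close>, so that segments between
  consecutive iterates stay in \<open>U\<close>.\<close>

locale algorithm_run = run_geometry M U retr R B C Lf Mf LR cf cB LP \<rho> L2 r0 dM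
  for M U :: "(real^'d) set" and retr :: "real^'d \<Rightarrow> real^'d \<Rightarrow> real^'d" and R :: "real^'d \<Rightarrow> real"
    and B :: "real^'d \<Rightarrow> real^'d \<Rightarrow> real^'p" and C :: "(real^'d) set"
    and Lf Mf LR cf cB LP \<rho> L2 r0 dM :: real +
  fixes \<alpha> \<gamma> \<Delta>bar \<chi>bar \<kappa> \<kappa>b Csum :: real and est :: estimator and smp :: sampling and n :: nat
    and f :: "nat \<Rightarrow> real^'d \<Rightarrow> real" and x0 :: "real^'d" and \<sigma> :: "nat \<Rightarrow> real"
    and Y :: "nat \<Rightarrow> (nat \<Rightarrow> nat list) \<Rightarrow> (real^'d, real^'p) iterate" and b q :: nat
  assumes \<alpha>: "0 < \<alpha>" and small1: "\<alpha> * (cf * Mf + LR) < \<rho>"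
    and small2: "(1 + L2 * \<rho>) * (\<alpha> * (cf * Mf + LR)) < r0"
    and \<gamma>: "0 < \<gamma>" "\<gamma> \<le> 1" and \<chi>bar: "0 \<le> \<chi>bar" "\<chi>bar < 1" and \<kappa>: "0 \<le> \<kappa>" and \<kappa>b: "0 < \<kappa>b" "\<kappa>b < 1"
    and n: "1 \<le> n" and adm: "admissible_components M U Lf Mf n f" and x0: "x0 \<in> M"
    and \<sigma>: "\<And>k. 0 \<le> \<sigma> k" "summable \<sigma>" "suminf \<sigma> \<le> Csum"
    and b_def: "b = batch_size est \<kappa>b n" and q_def: "q = epoch_length est n"
    and run: "iRPMVR_run est smp M B retr R n f b q \<alpha> \<gamma> \<Delta>bar \<chi>bar (cf * Mf) x0 Y"
    and tol_rule: "tolerance_rule smp n b \<Delta>bar \<kappa> \<sigma> Y"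
begin

abbreviation "F \<equiv> finite_avg n f"
abbreviation "x k \<omega> \<equiv> pt (Y k \<omega>)"
abbreviation "\<eta> k \<omega> \<equiv> tstep (Y k \<omega>)"
abbreviation "m k \<omega> \<equiv> mom (Y k \<omega>)"

text \<open>A run satisfies its step equations only along realizable batches, so pathwise facts need
  this guard.\<close>

definition valid :: "nat \<Rightarrow> (nat \<Rightarrow> nat list) \<Rightarrow> bool" where
  "valid k \<omega> \<longleftrightarrow> (\<forall>i\<in>{1..k}. \<omega> i \<in> batches smp n b)"

lemma valid_mono: assumes "valid k \<omega>" "i \<le> k" shows "valid i \<omega>"
  unfolding valid_def
proof
  fix j assume "j \<in> {1..i}"
  then have "j \<in> {1..k}" using assms(2) by simp
  then show "\<omega> j \<in> batches smp n b" using assms(1) unfolding valid_def by blast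
qed

lemma GDERIV_f: assumes "j \<in> {1..n}" shows "GDERIV (f j) z :> gradient (f j) z"
proof (rule GDERIV_gradient)
  have "Ck_on (Suc 0) UNIV (f j)" using adm assms by (simp add: admissible_components_def)
  then show "f j differentiable (at z)" by simp
qed

lemma f_lipschitz: "j \<in> {1..n} \<Longrightarrow> Lf-lipschitz_on U (gradient (f j))"
  and f_bound: "j \<in> {1..n} \<Longrightarrow> y \<in> M \<Longrightarrow> norm (gradient (f j) y) \<le> Mf"
  using adm by (auto simp: admissible_components_def)

lemma gradient_F: "gradient F z = (1 / real n) *\<^sub>R (\<Sum>j=1..n. gradient (f j) z)"
  by (rule gradient_eqI[OF GDERIV_finite_avg[OF GDERIV_f]])

lemma GDERIV_F: "GDERIV F z :> gradient F z"
  unfolding gradient_F by (rule GDERIV_finite_avg[OF GDERIV_f])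

lemma F_bound: "y \<in> M \<Longrightarrow> norm (gradient F y) \<le> Mf"
  unfolding gradient_F by (rule norm_mean_le[OF f_bound n])

lemma F_lipschitz: "Lf-lipschitz_on U (gradient F)"
proof (rule lipschitz_onI[OF _ Lf])
  fix y z assume yz: "y \<in> U" "z \<in> U"
  have "gradient F y - gradient F z = (1 / real n) *\<^sub>R (\<Sum>j=1..n. gradient (f j) y - gradient (f j) z)"
    by (simp add: gradient_F sum_subtractf scaleR_diff_right)
  also have "norm \<dots> \<le> Lf * dist y z"
    using lipschitz_onD[OF f_lipschitz yz] by (intro norm_mean_le n) (simp add: dist_norm)
  finally show "dist (gradient F y) (gradient F z) \<le> Lf * dist y z" by (simp add: dist_norm)
qed

lemma rgrad_F: assumes "y \<in> M" shows "rgrad M F y = (1 / real n) *\<^sub>R (\<Sum>j=1..n. rgrad M (f j) y)"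
  by (simp add: rgrad_def gradient_F linear_scale[OF proj_linear[OF assms]] linear_sum[OF proj_linear[OF assms]])

lemma rgrad_F_bound: assumes "y \<in> M" shows "norm (rgrad M F y) \<le> Mf"
  unfolding rgrad_def using proj_norm[OF assms] F_bound[OF assms] by (rule order_trans)

section \<open>Adaptedness of the run\<close>

lemmas run_rules = run[unfolded iRPMVR_run_def]

lemma adapted_params:
  assumes "\<And>i. 1 \<le> i \<Longrightarrow> i < k \<Longrightarrow> \<omega> i = \<omega>' i"
  shows "gam (Y k \<omega>) = gam (Y k \<omega>') \<and> chi (Y k \<omega>) = chi (Y k \<omega>')"
proof -
  have "\<forall>i\<in>{1..<k}. \<omega> i = \<omega>' i" using assms by simp
  then show ?thesis using run_rules[THEN conjunct1] by blast
qed

lemma adapted_mult: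
  assumes "\<And>i. 1 \<le> i \<Longrightarrow> i \<le> k \<Longrightarrow> \<omega> i = \<omega>' i" shows "mult (Y k \<omega>) = mult (Y k \<omega>')"
proof -
  have "\<forall>i\<in>{1..k}. \<omega> i = \<omega>' i" using assms by simp
  then show ?thesis using run_rules[THEN conjunct2, THEN conjunct1] by blast
qed

lemma init: "x 0 \<omega> = x0" "estim (Y 0 \<omega>) = rgrad M F x0" "trunc (Y 0 \<omega>) = rgrad M F x0"
  "mbar (Y 0 \<omega>) = rgrad M F x0"
  using run_rules[THEN conjunct2, THEN conjunct2, THEN conjunct1] by blast+

lemma step:
  assumes "valid k \<omega>"
  shows "\<gamma> \<le> gam (Y k \<omega>)" "gam (Y k \<omega>) \<le> 1" "0 \<le> chi (Y k \<omega>)" "chi (Y k \<omega>) \<le> \<chi>bar"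
    "0 \<le> tol (Y k \<omega>)"
    "k \<noteq> 0 \<Longrightarrow> estim (Y k \<omega>) = vr_estimate est M n f b q (\<lambda>i. x i \<omega>) (\<lambda>i. estim (Y i \<omega>)) \<omega> k"
    "k \<noteq> 0 \<Longrightarrow> trunc (Y k \<omega>) = closest_point (cball 0 Mu) (estim (Y k \<omega>))"
    "m k \<omega> = chi (Y k \<omega>) *\<^sub>R mbar (Y k \<omega>) + (1 - chi (Y k \<omega>)) *\<^sub>R trunc (Y k \<omega>)"
    "norm (gradient (dual_model \<alpha> R (B (x k \<omega>)) (x k \<omega>) (m k \<omega>)) (mult (Y k \<omega>))) \<le> tol (Y k \<omega>)"
    "\<eta> k \<omega> = closest_point (tangent_space M (x k \<omega>)) (prox (\<lambda>z. \<alpha> * R z)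
       (x k \<omega> - \<alpha> *\<^sub>R (m k \<omega> + adjoint (B (x k \<omega>)) (mult (Y k \<omega>)))) - x k \<omega>)"
    "x (Suc k) \<omega> = retr (x k \<omega>) (gam (Y k \<omega>) *\<^sub>R \<eta> k \<omega>)"
    "mbar (Y (Suc k) \<omega>) = tangent_proj M (x (Suc k) \<omega>) (m k \<omega>)"
  using run_rules[THEN conjunct2, THEN conjunct2, THEN conjunct2, rule_format, of k \<omega>, unfolded Let_def]
    assms
  unfolding valid_def Mu_def tangent_proj_def by auto

text \<open>The only free choices are the parameters and the multiplier, whose dependence on the
  history is imposed; induction makes everything else a function of that history.\<close>

lemma adapted:
  assumes "valid k \<omega>" "valid k \<omega>'" "\<And>i. 1 \<le> i \<Longrightarrow> i \<le> k \<Longrightarrow> \<omega> i = \<omega>' i"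
  shows "x k \<omega> = x k \<omega>' \<and> mbar (Y k \<omega>) = mbar (Y k \<omega>') \<and> estim (Y k \<omega>) = estim (Y k \<omega>') \<and>
    m k \<omega> = m k \<omega>' \<and> \<eta> k \<omega> = \<eta> k \<omega>'"
  using assms
proof (induction k rule: less_induct)
  case (less k)
  have par: "gam (Y i \<omega>) = gam (Y i \<omega>')" "chi (Y i \<omega>) = chi (Y i \<omega>')" "mult (Y i \<omega>) = mult (Y i \<omega>')"
    if "i \<le> k" for i
    using that less.prems(3) adapted_params[of i \<omega> \<omega>'] by (auto intro: adapted_mult)
  have IH: "x i \<omega> = x i \<omega>' \<and> mbar (Y i \<omega>) = mbar (Y i \<omega>') \<and> estim (Y i \<omega>) = estim (Y i \<omega>') \<and>
      m i \<omega> = m i \<omega>' \<and> \<eta> i \<omega> = \<eta> i \<omega>'" if "i < k" for i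
    using that less.prems by (intro less.IH) (auto intro: valid_mono)
  have xm: "x k \<omega> = x k \<omega>' \<and> mbar (Y k \<omega>) = mbar (Y k \<omega>')"
  proof (cases k)
    case 0 then show ?thesis by (simp add: init)
  next
    case (Suc i)
    have "valid i \<omega>" "valid i \<omega>'" using less.prems Suc by (auto intro: valid_mono)
    note s = step(11,12)[OF this(1)] step(11,12)[OF this(2)]
    have "x (Suc i) \<omega> = x (Suc i) \<omega>'" unfolding s(1) s(3) using IH[of i] par[of i] Suc by simp
    then show ?thesis unfolding Suc s(2) s(4) using IH[of i] Suc by simp
  qed
  have x: "x i \<omega> = x i \<omega>'" if "i \<le> k" for i using that IH xm by (cases "i = k") auto
  have u: "estim (Y k \<omega>) = estim (Y k \<omega>') \<and> trunc (Y k \<omega>) = trunc (Y k \<omega>')"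
  proof (cases "k = 0")
    case True then show ?thesis by (simp add: init)
  next
    case False
    have "estim (Y k \<omega>) = estim (Y k \<omega>')"
      unfolding step(6)[OF less.prems(1) False] step(6)[OF less.prems(2) False]
      by (rule vr_estimate_cong[OF False]) (use x IH less.prems(3) in auto)
    then show ?thesis unfolding step(7)[OF less.prems(1) False] step(7)[OF less.prems(2) False] by simp
  qed
  have mm: "m k \<omega> = m k \<omega>'"
    unfolding step(8)[OF less.prems(1)] step(8)[OF less.prems(2)] using xm u par by simp
  moreover have "\<eta> k \<omega> = \<eta> k \<omega>'"
    unfolding step(10)[OF less.prems(1)] step(10)[OF less.prems(2)] using xm mm par by simp
  ultimately show ?case using xm u by simp
qed

text \<open>The iterate is completed in the preceding iteration and so does not see its own batch.
  This strict inequality is what permits redrawing batch k with \<open>x k\<close> held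
  fixed.\<close>

lemma adapted_pt:
  assumes "valid k \<omega>" "valid k \<omega>'" "\<And>i. 1 \<le> i \<Longrightarrow> i < k \<Longrightarrow> \<omega> i = \<omega>' i"
  shows "x k \<omega> = x k \<omega>'"
proof (cases k)
  case 0 then show ?thesis by (simp add: init)
next
  case (Suc i)
  have v: "valid i \<omega>" "valid i \<omega>'" using assms Suc by (auto intro: valid_mono)
  have "gam (Y i \<omega>) = gam (Y i \<omega>')" using assms(3) Suc adapted_params[of i \<omega> \<omega>'] by simp
  moreover have "x i \<omega> = x i \<omega>' \<and> \<eta> i \<omega> = \<eta> i \<omega>'" using adapted[OF v] assms(3) Suc by simp
  ultimately show ?thesis unfolding Suc step(11)[OF v(1)] step(11)[OF v(2)] by simp
qed

text \<open>The exact tangent step, at which criticality is measured.\<close>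

definition "ch k \<omega> = exact_step M \<alpha> R (x k \<omega>) (m k \<omega>)"

section \<open>Bounds preserved by the iteration\<close>

lemma trunc_bound: assumes "valid k \<omega>" shows "norm (trunc (Y k \<omega>)) \<le> Mu"
proof (cases "k = 0")
  case True
  then show ?thesis using rgrad_F_bound[OF x0] Mf_le_Mu by (simp add: init)
next
  case False
  have "closest_point (cball 0 Mu) (estim (Y k \<omega>)) \<in> cball 0 Mu"
    using Mf Mf_le_Mu by (intro closest_point_in_set) auto
  then show ?thesis by (simp add: step(7)[OF assms False])
qed

lemma mom_bound_of_mbar:
  assumes "valid k \<omega>" "norm (mbar (Y k \<omega>)) \<le> Mu" shows "norm (m k \<omega>) \<le> Mu"
proof -
  note s = step[OF assms(1)]
  have "norm (m k \<omega>) \<le> chi (Y k \<omega>) * norm (mbar (Y k \<omega>)) + (1 - chi (Y k \<omega>)) * norm (trunc (Y k \<omega>))"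
    unfolding s(8) using s(3,4) \<chi>bar(2) by (intro order_trans[OF norm_triangle_ineq]) simp
  also have "\<dots> \<le> chi (Y k \<omega>) * Mu + (1 - chi (Y k \<omega>)) * Mu"
    using s(3,4) \<chi>bar(2) assms(2) trunc_bound[OF assms(1)] by (intro add_mono mult_left_mono) auto
  finally show ?thesis by (simp add: algebra_simps)
qed

text \<open>Membership in \<open>M\<close> and the momentum bound are hypotheses here because they
  are established in \<open>state\<close> by an induction that itself uses the step.\<close>

lemma tangent_step:
  assumes v: "valid k \<omega>" and x: "x k \<omega> \<in> M" and mb: "norm (m k \<omega>) \<le> Mu"
  shows "\<eta> k \<omega> \<in> tangent_space M (x k \<omega>)" "norm (\<eta> k \<omega>) \<le> \<alpha> * (Mu + LR)"
    "R (x k \<omega> + \<eta> k \<omega>) - R (x k \<omega>) \<le> - (m k \<omega> \<bullet> \<eta> k \<omega>) - (norm (\<eta> k \<omega>))\<^sup>2 / \<alpha> + Ct * tol (Y k \<omega>)"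
    "(norm (\<eta> k \<omega> - ch k \<omega>))\<^sup>2 \<le> \<alpha> * (Ct * tol (Y k \<omega>))"
proof -
  have T: "x k \<omega> \<in> M \<Longrightarrow> v \<in> orthogonal_comp (tangent_space M (x k \<omega>)) \<Longrightarrow> norm v \<le> cB * norm (B (x k \<omega>) v)" for v
    using cB(2) unfolding normal_space_def by blast
  note S = subspace_T[OF x]
  note i = inexact_step[OF R_convex R_lipschitz \<alpha> linear_B[OF x] S B_tangent[OF x] T[OF x] cB(1) step(9)[OF v],
      folded step(10)[OF v] Ct_def]
  note e = exact_step_minimizes[OF R_lipschitz \<alpha> S]
  show "\<eta> k \<omega> \<in> tangent_space M (x k \<omega>)" unfolding step(10)[OF v] by (rule closest_point_subspace_in[OF S])
  have "norm (\<eta> k \<omega>) \<le> \<alpha> * (norm (m k \<omega>) + LR)" by (rule i(1))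
  also have "\<dots> \<le> \<alpha> * (Mu + LR)" using \<alpha> mb by (intro mult_left_mono) auto
  finally show "norm (\<eta> k \<omega>) \<le> \<alpha> * (Mu + LR)" .
  show "R (x k \<omega> + \<eta> k \<omega>) - R (x k \<omega>) \<le> - (m k \<omega> \<bullet> \<eta> k \<omega>) - (norm (\<eta> k \<omega>))\<^sup>2 / \<alpha> + Ct * tol (Y k \<omega>)"
    by (rule i(2))
  show "(norm (\<eta> k \<omega> - ch k \<omega>))\<^sup>2 \<le> \<alpha> * (Ct * tol (Y k \<omega>))"
    unfolding ch_def by (rule i(3)[OF _ _ e])
qed

lemma retraction_step:
  assumes v: "valid k \<omega>" and x: "x k \<omega> \<in> M" and mb: "norm (m k \<omega>) \<le> Mu"
  shows "x (Suc k) \<omega> \<in> M" "norm (x (Suc k) \<omega> - x k \<omega> - gam (Y k \<omega>) *\<^sub>R \<eta> k \<omega>) \<le> L2 * (norm (\<eta> k \<omega>))\<^sup>2"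
    "norm (x (Suc k) \<omega> - x k \<omega>) \<le> M1 * norm (\<eta> k \<omega>)" "norm (x (Suc k) \<omega> - x k \<omega>) < r0"
proof -
  let ?g = "gam (Y k \<omega>)" and ?e = "\<eta> k \<omega>"
  note s = step[OF v] and t = tangent_step[OF v x mb]
  have g: "0 \<le> ?g" "?g \<le> 1" using s(1,2) \<gamma> by auto
  have ge: "?g *\<^sub>R ?e \<in> tangent_space M (x k \<omega>)" using t(1) subspace_T[OF x] by (simp add: subspace_scale)
  have ng: "norm (?g *\<^sub>R ?e) \<le> norm ?e" using g by (simp add: mult_left_le_one_le)
  have e\<rho>: "norm ?e < \<rho>" using t(2) small1 by (simp add: Mu_def)
  show "x (Suc k) \<omega> \<in> M" unfolding s(11) by (rule retr_in[OF x ge])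
  have "norm (x (Suc k) \<omega> - x k \<omega> - ?g *\<^sub>R ?e) \<le> L2 * (norm (?g *\<^sub>R ?e))\<^sup>2"
    unfolding s(11) using ng e\<rho> by (intro retr_close[OF x ge]) simp
  also have "\<dots> \<le> L2 * (norm ?e)\<^sup>2" using L2 ng by (intro mult_left_mono power_mono) auto
  finally show 2: "norm (x (Suc k) \<omega> - x k \<omega> - ?g *\<^sub>R ?e) \<le> L2 * (norm ?e)\<^sup>2" .
  \<comment> \<open>One factor of the square is spent on the bound \<open>\<rho>\<close>, leaving
    the linear estimate with constant \<open>M1\<close>.\<close>
  have "L2 * (norm ?e)\<^sup>2 \<le> L2 * \<rho> * norm ?e"
    using L2 e\<rho> by (simp add: power2_eq_square mult.assoc mult_left_mono mult_right_mono)
  then show 3: "norm (x (Suc k) \<omega> - x k \<omega>) \<le> M1 * norm ?e"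
    using norm_triangle_ineq[of "x (Suc k) \<omega> - x k \<omega> - ?g *\<^sub>R ?e" "?g *\<^sub>R ?e"] 2 ng
    by (simp add: M1_def algebra_simps)
  also have "\<dots> \<le> M1 * (\<alpha> * (Mu + LR))" using M1 by (intro mult_left_mono t(2)) simp
  also have "\<dots> < r0" using small2 by (simp add: M1_def Mu_def)
  finally show "norm (x (Suc k) \<omega> - x k \<omega>) < r0" .
qed

text \<open>Truncation, convex combination and projection all preserve the ball of radius
  \<open>Mu\<close>. The momentum is therefore bounded on every path, and with it the step
  length.\<close>

lemma state: "valid k \<omega> \<Longrightarrow> x k \<omega> \<in> M \<and> norm (mbar (Y k \<omega>)) \<le> Mu"
proof (induction k)
  case 0
  then show ?case using x0 rgrad_F_bound[OF x0] Mf_le_Mu by (simp add: init)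
next
  case (Suc k)
  have v: "valid k \<omega>" using Suc.prems by (rule valid_mono) simp
  note IH = Suc.IH[OF v]
  have mb: "norm (m k \<omega>) \<le> Mu" using mom_bound_of_mbar[OF v] IH by blast
  have "x (Suc k) \<omega> \<in> M" using retraction_step(1)[OF v _ mb] IH by blast
  moreover have "norm (mbar (Y (Suc k) \<omega>)) \<le> Mu"
    unfolding step(12)[OF v] using proj_norm[OF \<open>x (Suc k) \<omega> \<in> M\<close>] mb by (rule order_trans)
  ultimately show ?case by blast
qed

lemma x_in: "valid k \<omega> \<Longrightarrow> x k \<omega> \<in> M" using state by blast

lemma mom_bound: "valid k \<omega> \<Longrightarrow> norm (m k \<omega>) \<le> Mu" using state mom_bound_of_mbar by blast

lemmas tangent_step' = tangent_step[OF _ x_in mom_bound]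
lemmas retraction_step' = retraction_step[OF _ x_in mom_bound]

section \<open>Descent, momentum and criticality along one path\<close>

definition "e k \<omega> = m k \<omega> - rgrad M F (x k \<omega>)"
definition "err k \<omega> = estim (Y k \<omega>) - rgrad M F (x k \<omega>)"
definition "\<Phi> y = F y + R y"

lemma tol_le:
  assumes "valid k \<omega>"
  shows "tol (Y k \<omega>) \<le> (if k = 0 then 0 else \<kappa> * (norm (\<eta> (k - 1) \<omega>))\<^sup>2) + \<sigma> k"
proof -
  have "tol (Y k \<omega>) = min \<Delta>bar (max (\<kappa> * (norm (if k = 0 then 0 else \<eta> (k - 1) \<omega>))\<^sup>2) (\<sigma> k))"
    using tol_rule assms unfolding tolerance_rule_def valid_def by blast
  also have "\<dots> \<le> max (\<kappa> * (norm (if k = 0 then 0 else \<eta> (k - 1) \<omega>))\<^sup>2) (\<sigma> k)" by simp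
  also have "\<dots> \<le> (if k = 0 then 0 else \<kappa> * (norm (\<eta> (k - 1) \<omega>))\<^sup>2) + \<sigma> k"
    using \<sigma>(1)[of k] \<kappa> by auto
  finally show ?thesis .
qed

text \<open>The damping factor scales the whole model decrease by convexity of \<open>R\<close>.
  Half of the decrease \<open>(norm (\<eta> k \<omega>))\<^sup>2\<close> over \<alpha> is given up
  to absorb the momentum error, and the retraction enters only at second order.\<close>

lemma descent:
  assumes v: "valid k \<omega>"
  shows "\<Phi> (x (Suc k) \<omega>) - \<Phi> (x k \<omega>) \<le> - (\<gamma> / (2 * \<alpha>) - Cd) * (norm (\<eta> k \<omega>))\<^sup>2
    + \<alpha> / 2 * (norm (e k \<omega>))\<^sup>2 + Ct * tol (Y k \<omega>)"
proof -
  let ?g = "gam (Y k \<omega>)" and ?e = "\<eta> k \<omega>" and ?x = "x k \<omega>" and ?x' = "x (Suc k) \<omega>" and ?m = "m k \<omega>"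
  let ?gr = "gradient F ?x" and ?N = "(norm (\<eta> k \<omega>))\<^sup>2"
  note s = step[OF v] and t = tangent_step'[OF v v v] and r = retraction_step'[OF v v v] and x = x_in[OF v]
  have g: "0 < ?g" "?g \<le> 1" using s(1,2) \<gamma> by auto
  define d where "d = ?x' - ?x - ?g *\<^sub>R ?e"
  have d: "norm d \<le> L2 * ?N" unfolding d_def by (rule r(2))
  have "F ?x' - F ?x \<le> ?gr \<bullet> (?x' - ?x) + Lf * (norm (?x' - ?x))\<^sup>2"
    using quadratic_upper_bound[OF x _ GDERIV_F F_lipschitz, of ?x'] r(4)
    by (auto simp: dist_norm norm_minus_commute)
  also have "\<dots> \<le> ?gr \<bullet> (?x' - ?x) + Lf * (M1\<^sup>2 * ?N)"
    using power_mono[OF r(3), of 2] Lf by (intro add_left_mono mult_left_mono) (auto simp: power_mult_distrib)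
  also have "?gr \<bullet> (?x' - ?x) = ?g * (?gr \<bullet> ?e) + ?gr \<bullet> d"
    by (simp add: d_def inner_diff_right)
  also have "?gr \<bullet> d \<le> Mf * (L2 * ?N)"
    using norm_cauchy_schwarz[of ?gr d] mult_mono[OF F_bound[OF x] d] Mf by simp
  finally have F': "F ?x' - F ?x \<le> ?g * (?gr \<bullet> ?e) + Mf * (L2 * ?N) + Lf * (M1\<^sup>2 * ?N)" by simp
  have "R ?x' - R (?x + ?g *\<^sub>R ?e) \<le> LR * norm d"
    using lipschitz_onD[OF R_lipschitz, of ?x' "?x + ?g *\<^sub>R ?e"] by (simp add: dist_norm d_def diff_diff_eq)
  also have "\<dots> \<le> LR * (L2 * ?N)" by (intro mult_left_mono d LR)
  finally have R1: "R ?x' - R (?x + ?g *\<^sub>R ?e) \<le> LR * (L2 * ?N)" .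
  have "?x + ?g *\<^sub>R ?e = (1 - ?g) *\<^sub>R ?x + ?g *\<^sub>R (?x + ?e)" by (simp add: algebra_simps)
  then have R2: "R (?x + ?g *\<^sub>R ?e) \<le> (1 - ?g) * R ?x + ?g * R (?x + ?e)"
    using convex_onD[OF R_convex, of ?g ?x "?x + ?e"] g by simp
  have "rgrad M F ?x \<bullet> ?e = ?gr \<bullet> ?e" unfolding rgrad_def by (rule proj_inner[OF x t(1)])
  then have ge: "?gr \<bullet> ?e - ?m \<bullet> ?e = - (e k \<omega> \<bullet> ?e)" by (simp add: e_def inner_diff_left)
  \<comment> \<open>Young's inequality weighted by \<alpha>, so that exactly half of the decrease is
    spent and the momentum error keeps a factor that is small with \<alpha>.\<close>
  have young: "- (e k \<omega> \<bullet> ?e) \<le> \<alpha> / 2 * (norm (e k \<omega>))\<^sup>2 + ?N / (2 * \<alpha>)"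
  proof -
    have "0 \<le> (norm (?e + \<alpha> *\<^sub>R e k \<omega>))\<^sup>2" by simp
    also have "(norm (?e + \<alpha> *\<^sub>R e k \<omega>))\<^sup>2 = ?N + 2 * \<alpha> * (?e \<bullet> e k \<omega>) + \<alpha>\<^sup>2 * (norm (e k \<omega>))\<^sup>2"
      by (rule norm_add_scaleR_sq)
    finally show ?thesis using \<alpha> by (simp add: field_simps inner_commute power2_eq_square)
  qed
  have "?gr \<bullet> ?e + (R (?x + ?e) - R ?x) \<le> - ?N / (2 * \<alpha>) + \<alpha> / 2 * (norm (e k \<omega>))\<^sup>2 + Ct * tol (Y k \<omega>)"
    using t(3) ge young by (simp add: field_simps)
  then have "?g * (?gr \<bullet> ?e + (R (?x + ?e) - R ?x)) \<le>
      ?g * (- ?N / (2 * \<alpha>) + \<alpha> / 2 * (norm (e k \<omega>))\<^sup>2 + Ct * tol (Y k \<omega>))"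
    using g by (intro mult_left_mono) auto
  also have "\<dots> = - (?g * (?N / (2 * \<alpha>))) + ?g * (\<alpha> / 2 * (norm (e k \<omega>))\<^sup>2 + Ct * tol (Y k \<omega>))"
    by (simp add: algebra_simps)
  \<comment> \<open>The damping factor is replaced by its lower bound in the negative term and by 1
    in the nonnegative ones.\<close>
  also have "\<dots> \<le> - (\<gamma> * (?N / (2 * \<alpha>))) + 1 * (\<alpha> / 2 * (norm (e k \<omega>))\<^sup>2 + Ct * tol (Y k \<omega>))"
    using s(1,5) g \<alpha> Ct by (intro add_mono mult_right_mono le_imp_neg_le) auto
  finally show ?thesis
    using F' R1 R2 unfolding \<Phi>_def Cd_def by (simp add: algebra_simps)
qed

text \<open>The transported error grows only by the gradient change along the displacement. Since
  \<open>\<chi>bar\<close> equals 1 - 2 \<theta>, Young's inequality with weight \<theta> still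
  leaves a contraction by 1 - \<theta>.\<close>

lemma momentum:
  assumes v: "valid (Suc k) \<omega>"
  defines "\<theta> \<equiv> (1 - \<chi>bar) / 2"
  shows "(norm (e (Suc k) \<omega>))\<^sup>2 \<le> (1 - \<theta>) * (norm (e k \<omega>))\<^sup>2
    + (1 + 1 / \<theta>) * (LG * M1)\<^sup>2 * (norm (\<eta> k \<omega>))\<^sup>2 + (norm (err (Suc k) \<omega>))\<^sup>2"
proof -
  have v': "valid k \<omega>" using v by (rule valid_mono) simp
  let ?c = "chi (Y (Suc k) \<omega>)" and ?x = "x k \<omega>" and ?x' = "x (Suc k) \<omega>"
  note s = step[OF v] and x = x_in[OF v'] and x' = x_in[OF v]
  let ?g = "rgrad M F ?x'" and ?P = "tangent_proj M ?x'"
  define a where "a = norm (e k \<omega>)"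
  define t where "t = LG * M1 * norm (\<eta> k \<omega>)"
  define r where "r = norm (err (Suc k) \<omega>)"
  have c: "0 \<le> ?c" "?c \<le> \<chi>bar" "?c \<le> 1" using s(3,4) \<chi>bar(2) by auto
  have \<theta>: "0 < \<theta>" "\<theta> \<le> 1" using \<chi>bar by (auto simp: \<theta>_def)
  have eq: "mbar (Y (Suc k) \<omega>) - ?g = ?P (e k \<omega>) - (?g - ?P (rgrad M F ?x))"
    by (simp add: step(12)[OF v'] e_def linear_diff[OF proj_linear[OF x']])
  have "norm (mbar (Y (Suc k) \<omega>) - ?g) \<le> norm (?P (e k \<omega>)) + norm (?g - ?P (rgrad M F ?x))"
    unfolding eq by (rule norm_triangle_ineq4)
  also have "\<dots> \<le> a + LG * norm (?x' - ?x)"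
    unfolding a_def by (intro add_mono proj_norm[OF x'] rgrad_transport[OF x' x F_lipschitz F_bound[OF x]])
  also have "\<dots> \<le> a + t"
    using retraction_step'(3)[OF v' v' v'] LG by (simp add: t_def mult.assoc mult_left_mono)
  finally have mb: "norm (mbar (Y (Suc k) \<omega>) - ?g) \<le> a + t" .
  \<comment> \<open>The exact gradient lies in the truncation ball, so truncation fixes it; being
    nonexpansive, truncation cannot enlarge the estimator error.\<close>
  have gb: "?g \<in> cball 0 Mu" using rgrad_F_bound[OF x'] Mf_le_Mu by simp
  have "dist (closest_point (cball 0 Mu) (estim (Y (Suc k) \<omega>))) (closest_point (cball 0 Mu) ?g) \<le>
      dist (estim (Y (Suc k) \<omega>)) ?g"
    using Mf Mf_le_Mu by (intro closest_point_lipschitz) auto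
  then have tr: "norm (trunc (Y (Suc k) \<omega>) - ?g) \<le> r"
    by (simp add: s(7) closest_point_self[OF gb] dist_norm r_def err_def)
  have "e (Suc k) \<omega> = ?c *\<^sub>R (mbar (Y (Suc k) \<omega>) - ?g) + (1 - ?c) *\<^sub>R (trunc (Y (Suc k) \<omega>) - ?g)"
    unfolding e_def s(8) by (simp add: algebra_simps)
  then have "norm (e (Suc k) \<omega>) \<le> ?c * norm (mbar (Y (Suc k) \<omega>) - ?g) + (1 - ?c) * norm (trunc (Y (Suc k) \<omega>) - ?g)"
    using norm_triangle_ineq[of "?c *\<^sub>R (mbar (Y (Suc k) \<omega>) - ?g)" "(1 - ?c) *\<^sub>R (trunc (Y (Suc k) \<omega>) - ?g)"] c
    by simp
  also have "\<dots> \<le> ?c * (a + t) + (1 - ?c) * r" using c mb tr by (intro add_mono mult_left_mono) auto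
  finally have "(norm (e (Suc k) \<omega>))\<^sup>2 \<le> (?c * (a + t) + (1 - ?c) * r)\<^sup>2" by (rule power_mono) simp
  \<comment> \<open>Convexity of the square, which avoids a cross term between momentum error and
    estimator error.\<close>
  also have "\<dots> \<le> ?c * (a + t)\<^sup>2 + (1 - ?c) * r\<^sup>2"
  proof -
    have "?c * (a + t)\<^sup>2 + (1 - ?c) * r\<^sup>2 - (?c * (a + t) + (1 - ?c) * r)\<^sup>2 = ?c * (1 - ?c) * (a + t - r)\<^sup>2"
      by (simp add: power2_eq_square algebra_simps)
    moreover have "0 \<le> ?c * (1 - ?c) * (a + t - r)\<^sup>2" using c by simp
    ultimately show ?thesis by linarith
  qed
  also have "\<dots> \<le> \<chi>bar * (a + t)\<^sup>2 + 1 * r\<^sup>2" using c by (intro add_mono mult_right_mono) auto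
  also have "(a + t)\<^sup>2 \<le> (1 + \<theta>) * a\<^sup>2 + (1 + 1 / \<theta>) * t\<^sup>2"
  proof -
    have "0 \<le> (\<theta> * a - t)\<^sup>2 / \<theta>" using \<theta> by simp
    then show ?thesis using \<theta> by (simp add: power2_eq_square field_simps)
  qed
  then have "\<chi>bar * (a + t)\<^sup>2 + 1 * r\<^sup>2 \<le> \<chi>bar * ((1 + \<theta>) * a\<^sup>2 + (1 + 1 / \<theta>) * t\<^sup>2) + 1 * r\<^sup>2"
    using \<chi>bar by (intro add_mono mult_left_mono) auto
  also have "\<dots> = (\<chi>bar * (1 + \<theta>)) * a\<^sup>2 + \<chi>bar * ((1 + 1 / \<theta>) * t\<^sup>2) + r\<^sup>2"
    by (simp add: algebra_simps)
  also have "\<dots> \<le> (1 - \<theta>) * a\<^sup>2 + 1 * ((1 + 1 / \<theta>) * t\<^sup>2) + r\<^sup>2"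
  proof (intro add_mono mult_right_mono)
    have "\<chi>bar * \<theta> \<le> \<theta>" using \<chi>bar \<theta> by (simp add: mult_left_le_one_le)
    then have "\<chi>bar + \<chi>bar * \<theta> \<le> 1 - \<theta>" by (simp add: \<theta>_def field_simps)
    then show "\<chi>bar * (1 + \<theta>) \<le> 1 - \<theta>" by (simp add: algebra_simps)
  qed (use \<chi>bar \<theta> in auto)
  finally show ?thesis by (simp add: a_def t_def r_def power_mult_distrib algebra_simps)
qed

text \<open>The transported momentum and the truncated estimate both start at the exact gradient, so
  the error recursion starts from zero.\<close>

lemma e_0: "e 0 \<omega> = 0"
proof -
  have "valid 0 \<omega>" by (simp add: valid_def)
  then show ?thesis unfolding e_def step(8)[OF \<open>valid 0 \<omega>\<close>] by (simp add: init algebra_simps)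
qed

text \<open>The exact step is short enough to stay in \<open>U\<close>, where \<open>F\<close> has a
  Lipschitz gradient, and its distance to the computed step is paid for by the tolerance.\<close>

lemma Theta_le:
  assumes v: "valid k \<omega>" 
  shows "(Theta M F R (x k \<omega>) (ch k \<omega>))\<^sup>2 \<le> (3 * Lf\<^sup>2 + 3 / \<alpha>\<^sup>2 + 1) * (2 * (norm (\<eta> k \<omega>))\<^sup>2 + 2 * (\<alpha> * (Ct * tol (Y k \<omega>))))
    + 3 * (norm (e k \<omega>))\<^sup>2"
proof -
  note x = x_in[OF v] and t = tangent_step'[OF v v v]
  note S = subspace_T[OF x]
  note ex = exact_step_minimizes[OF R_lipschitz \<alpha> S, where m = "m k \<omega>", folded ch_def]
  have "norm (ch k \<omega>) \<le> \<alpha> * (norm (m k \<omega>) + LR)"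
    by (rule norm_subspace_minimizer_le[OF R_convex R_lipschitz \<alpha> S ex])
  also have "\<dots> \<le> \<alpha> * (Mu + LR)" using \<alpha> mom_bound[OF v] by (intro mult_left_mono) auto
  also have "\<dots> \<le> M1 * (\<alpha> * (Mu + LR))"
    using M1 \<alpha> Mf Mf_le_Mu LR by (simp add: mult_ge1_I)
  also have "\<dots> < r0" using small2 by (simp add: M1_def Mu_def)
  finally have "x k \<omega> + ch k \<omega> \<in> ball (x k \<omega>) r0" by (simp add: dist_norm)
  then have "x k \<omega> + ch k \<omega> \<in> U" using r0(2)[OF x] by blast
  from lipschitz_onD[OF F_lipschitz this M_subset_U[OF x]]
  have lip: "norm (gradient F (x k \<omega> + ch k \<omega>) - gradient F (x k \<omega>)) \<le> Lf * norm (ch k \<omega>)"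
    by (simp add: dist_norm)
  have "(Theta M F R (x k \<omega>) (ch k \<omega>))\<^sup>2 \<le> (3 * Lf\<^sup>2 + 3 / \<alpha>\<^sup>2 + 1) * (norm (ch k \<omega>))\<^sup>2 + 3 * (norm (e k \<omega>))\<^sup>2"
    unfolding e_def ch_def
    by (rule Theta_exact_step_le[OF R_convex R_lipschitz \<alpha> S lip[unfolded ch_def]])
  also have "(norm (ch k \<omega>))\<^sup>2 \<le> 2 * (norm (\<eta> k \<omega>))\<^sup>2 + 2 * (norm (\<eta> k \<omega> - ch k \<omega>))\<^sup>2"
  proof -
    have "norm (ch k \<omega>) \<le> norm (\<eta> k \<omega>) + norm (\<eta> k \<omega> - ch k \<omega>)"
      using norm_triangle_ineq4[of "\<eta> k \<omega>" "\<eta> k \<omega> - ch k \<omega>"] by simp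
    then have "(norm (ch k \<omega>))\<^sup>2 \<le> (norm (\<eta> k \<omega>) + norm (\<eta> k \<omega> - ch k \<omega>))\<^sup>2" by (rule power_mono) simp
    also have "\<dots> \<le> 2 * (norm (\<eta> k \<omega>))\<^sup>2 + 2 * (norm (\<eta> k \<omega> - ch k \<omega>))\<^sup>2"
      using sum_squares_bound[of "norm (\<eta> k \<omega>)" "norm (\<eta> k \<omega> - ch k \<omega>)"] by (simp add: power2_sum)
    finally show ?thesis .
  qed
  also have "\<dots> \<le> 2 * (norm (\<eta> k \<omega>))\<^sup>2 + 2 * (\<alpha> * (Ct * tol (Y k \<omega>)))" using t(4) by simp
  finally show ?thesis by (simp add: mult_left_mono)
qed

text \<open>Stands in for a lower bound of the objective. \<open>F\<close> is followed along the
  chain of short steps; \<open>R\<close> is globally Lipschitz, so the diameter bound of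
  \<open>M\<close> suffices for it.\<close>

lemma Phi_oscillation:
  assumes v: "valid K \<omega>"
  shows "\<bar>\<Phi> (x K \<omega>) - \<Phi> (x 0 \<omega>)\<bar> \<le> osc"
proof -
  have vk: "valid k \<omega>" if "k \<le> K" for k using v that by (rule valid_mono)
  have "\<bar>F (x K \<omega>) - F (x 0 \<omega>)\<bar> \<le> 2 * real (card C) * ((Mf + Lf * r0) * r0)"
  proof (rule short_step_oscillation[where M = M and r = r0, OF net(1)])
    fix y z assume y: "y \<in> M" and z: "z \<in> M" and d: "dist y z < r0"
    have "\<bar>F y - F z - gradient F z \<bullet> (y - z)\<bar> \<le> Lf * (norm (y - z))\<^sup>2"
      using d by (intro quadratic_upper_bound z GDERIV_F F_lipschitz) (simp add: dist_commute)
    moreover have "\<bar>gradient F z \<bullet> (y - z)\<bar> \<le> Mf * r0"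
      using Cauchy_Schwarz_ineq2[of "gradient F z" "y - z"] mult_mono[OF F_bound[OF z], of "norm (y - z)" r0] d Mf
      by (simp add: dist_norm)
    moreover have "Lf * (norm (y - z))\<^sup>2 \<le> Lf * r0\<^sup>2"
      using d Lf by (intro mult_left_mono power_mono) (auto simp: dist_norm)
    ultimately show "\<bar>F y - F z\<bar> \<le> (Mf + Lf * r0) * r0" by (simp add: power2_eq_square algebra_simps)
  next
    show "0 \<le> (Mf + Lf * r0) * r0" using Mf Lf r0(1) by simp
    fix k assume "k \<le> K"
    then show "x k \<omega> \<in> M" "x k \<omega> \<in> (\<Union>c\<in>C. ball c (r0 / 2))" using x_in[OF vk] net(2) by blast+
  next
    fix k assume "k < K"
    then have "valid k \<omega>" by (intro vk) simp
    then show "dist (x (Suc k) \<omega>) (x k \<omega>) < r0" using retraction_step'(4) by (simp add: dist_norm)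
  qed
  moreover have "\<bar>R (x K \<omega>) - R (x 0 \<omega>)\<bar> \<le> LR * dM"
  proof -
    have "\<bar>R (x K \<omega>) - R (x 0 \<omega>)\<bar> \<le> LR * dist (x K \<omega>) (x 0 \<omega>)"
      using lipschitz_onD[OF R_lipschitz, of "x K \<omega>" "x 0 \<omega>"] by (simp add: dist_norm)
    also have "\<dots> \<le> LR * dM" using vk by (intro mult_left_mono dM x_in LR) auto
    finally show ?thesis .
  qed
  ultimately show ?thesis unfolding \<Phi>_def osc_def by linarith
qed

end

section \<open>Estimates in expectation\<close>

lemma norm_add_sq_weighted:
  fixes u v :: "'a::real_inner"
  assumes "0 < s"
  shows "(norm (u + v))\<^sup>2 \<le> (1 + 1 / s) * (norm u)\<^sup>2 + (1 + s) * (norm v)\<^sup>2"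
proof -
  have "(norm (u + v))\<^sup>2 \<le> (norm u + norm v)\<^sup>2" by (intro power_mono norm_triangle_ineq) simp
  also have "\<dots> \<le> (1 + 1 / s) * (norm u)\<^sup>2 + (1 + s) * (norm v)\<^sup>2"
  proof -
    have "0 \<le> (norm u - s * norm v)\<^sup>2 / s" using assms by simp
    then show ?thesis using assms by (simp add: power2_eq_square field_simps)
  qed
  finally show ?thesis .
qed

lemma norm_path_sq_le:
  fixes y :: "nat \<Rightarrow> 'a::real_normed_vector"
  assumes "s \<le> k"
  shows "(norm (y k - y s))\<^sup>2 \<le> real (k - s) * (\<Sum>i\<in>{s..<k}. (norm (y (Suc i) - y i))\<^sup>2)"
proof -
  have "y k - y s = (\<Sum>i\<in>{s..<k}. y (Suc i) - y i)" by (rule sum_Suc_diff'[OF assms, symmetric])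
  then have "norm (y k - y s) \<le> (\<Sum>i\<in>{s..<k}. norm (y (Suc i) - y i))" by (simp add: norm_sum)
  then have "(norm (y k - y s))\<^sup>2 \<le> (\<Sum>i\<in>{s..<k}. norm (y (Suc i) - y i))\<^sup>2" by (rule power_mono) simp
  also have "\<dots> \<le> (\<Sum>i\<in>{s..<k}. (norm (y (Suc i) - y i))\<^sup>2) * real (card {s..<k})"
    by (rule sum_squared_le_sum_of_squares)
  finally show ?thesis by (simp add: mult.commute)
qed

lemma norm_sum_list_sq_le:
  "(norm (\<Sum>j\<leftarrow>js. d j))\<^sup>2 \<le> real (length js) * (\<Sum>j\<leftarrow>js. (norm (d j))\<^sup>2)"
proof (cases js rule: rev_cases)
  case Nil then show ?thesis by simp
next
  case snoc
  have "norm (\<Sum>j\<leftarrow>js. d j) \<le> (\<Sum>i<length js. norm (d (js ! i)))"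
    by (simp add: sum_list_sum_nth atLeast0LessThan norm_sum)
  then have "(norm (\<Sum>j\<leftarrow>js. d j))\<^sup>2 \<le> (\<Sum>i<length js. norm (d (js ! i)))\<^sup>2" by (rule power_mono) simp
  also have "\<dots> \<le> (\<Sum>i<length js. (norm (d (js ! i)))\<^sup>2) * real (card {..<length js})"
    by (rule sum_squared_le_sum_of_squares)
  finally show ?thesis by (simp add: sum_list_sum_nth atLeast0LessThan mult.commute)
qed

lemma nat_ceiling_le_twice:
  fixes z :: real assumes "1 \<le> z" shows "z \<le> real (nat \<lceil>z\<rceil>)" "real (nat \<lceil>z\<rceil>) \<le> 2 * z"
  using assms by linarith+

lemma nat_ceiling_ge_1: "1 \<le> z \<Longrightarrow> 1 \<le> nat \<lceil>z::real\<rceil>"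
  by linarith

lemma le_divide_of_mult_le: "0 < t \<Longrightarrow> t * y \<le> w \<Longrightarrow> y \<le> w / (t::real)"
  by (simp add: pos_le_divide_eq mult.commute)

context algorithm_run
begin

section \<open>Batch sizes and independence of the current batch\<close>

lemma n_powr: "0 \<le> a \<Longrightarrow> 1 \<le> real n powr a"
  using n by (simp add: ge_one_powr_ge_zero)

lemma ceiling_powr_le: assumes "0 \<le> a" "a \<le> 1" shows "nat \<lceil>real n powr a\<rceil> \<le> n"
proof -
  have "real n powr a \<le> real n powr 1" using n assms by (intro powr_mono) auto
  then show ?thesis using n by simp
qed

lemma b_pos: "1 \<le> b" and b_le: "b \<le> n"
proof -
  have "1 \<le> batch_size est \<kappa>b n \<and> batch_size est \<kappa>b n \<le> n"
  proof (cases est)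
    case SAG
    have "0 < \<kappa>b * real n" using \<kappa>b n by simp
    moreover have "\<kappa>b * real n \<le> 1 * real n" using \<kappa>b by (intro mult_right_mono) auto
    ultimately show ?thesis using SAG by simp linarith
  next
    case SVRG
    have "nat \<lceil>real n powr (2/3)\<rceil> \<le> n" by (rule ceiling_powr_le) auto
    then show ?thesis using SVRG nat_ceiling_ge_1[OF n_powr[of "2/3"]] by simp
  next
    case SAGA
    have "nat \<lceil>real n powr (2/3)\<rceil> \<le> n" by (rule ceiling_powr_le) auto
    then show ?thesis using SAGA nat_ceiling_ge_1[OF n_powr[of "2/3"]] by simp
  next
    case SARAH
    have "nat \<lceil>real n powr (1/2)\<rceil> \<le> n" by (rule ceiling_powr_le) auto
    then show ?thesis using SARAH nat_ceiling_ge_1[OF n_powr[of "1/2"]] by simp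
  qed
  then show "1 \<le> b" "b \<le> n" by (auto simp: b_def)
qed

lemma q_pos: "1 \<le> q"
  using nat_ceiling_ge_1[OF n_powr[of "1/2"]] nat_ceiling_ge_1[OF n_powr[of "1/3"]]
  by (cases est) (auto simp: q_def)

abbreviation "\<Omega> K \<equiv> batch_space smp n b K"

lemma valid_space: "\<omega> \<in> \<Omega> K \<Longrightarrow> k \<le> K \<Longrightarrow> valid k \<omega>"
  unfolding valid_def by (intro ballI batch_space_valid) auto

text \<open>Iterates up to k, estimates before k and the table at k involve batches before k only:
  the table at k was last changed by batch k - 1.\<close>

lemma resample_indep:
  assumes \<omega>: "\<omega> \<in> \<Omega> K" and js: "js \<in> batches smp n b" and k: "k \<in> {1..K}"
  shows "i \<le> k \<Longrightarrow> x i (\<omega> (k := js)) = x i \<omega>"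
    and "i < k \<Longrightarrow> estim (Y i (\<omega> (k := js))) = estim (Y i \<omega>)"
    and "table (\<lambda>i. x i (\<omega> (k := js))) (\<omega> (k := js)) k j = table (\<lambda>i. x i \<omega>) \<omega> k j"
proof -
  have v: "valid i \<omega>" "valid i (\<omega> (k := js))" if "i \<le> k" for i
    using that k by (auto intro!: valid_space[OF \<omega>] valid_space[OF batch_space_upd[OF \<omega> k js]])
  show x: "x i (\<omega> (k := js)) = x i \<omega>" if "i \<le> k" for i
    by (rule adapted_pt[OF v(2)[OF that] v(1)[OF that]]) (use that in auto)
  show "estim (Y i (\<omega> (k := js))) = estim (Y i \<omega>)" if "i < k"
    using adapted[OF v(2)[of i] v(1)[of i]] that by auto
  show "table (\<lambda>i. x i (\<omega> (k := js))) (\<omega> (k := js)) k j = table (\<lambda>i. x i \<omega>) \<omega> k j"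
    by (rule table_cong) (auto simp: x)
qed

text \<open>All averages share the horizon K, so that sums over iterations commute with averaging.
  \<open>T\<close> below measures the staleness of the gradient table in the space of points, not of
  gradients.\<close>

definition "D K k = avg (\<Omega> K) (\<lambda>\<omega>. (norm (x (Suc k) \<omega> - x k \<omega>))\<^sup>2)"
definition "N K k = avg (\<Omega> K) (\<lambda>\<omega>. (norm (\<eta> k \<omega>))\<^sup>2)"
definition "Er K k = avg (\<Omega> K) (\<lambda>\<omega>. (norm (err k \<omega>))\<^sup>2)"
definition "A K k = avg (\<Omega> K) (\<lambda>\<omega>. (norm (e k \<omega>))\<^sup>2)"
definition "z k \<omega> j = table (\<lambda>i. x i \<omega>) \<omega> k j"
definition "T K k = avg (\<Omega> K) (\<lambda>\<omega>. mean_sq n (\<lambda>j. x k \<omega> - z k \<omega> j))"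

lemma nonneg: "0 \<le> D K k" "0 \<le> N K k" "0 \<le> Er K k" "0 \<le> A K k" "0 \<le> T K k"
  unfolding D_def N_def Er_def A_def T_def
  by (auto intro!: avg_nonneg divide_nonneg_nonneg sum_nonneg)

lemma D_le: assumes "k < K" shows "D K k \<le> M1\<^sup>2 * N K k"
proof -
  have "D K k \<le> avg (\<Omega> K) (\<lambda>\<omega>. M1\<^sup>2 * (norm (\<eta> k \<omega>))\<^sup>2)" unfolding D_def
  proof (rule avg_mono)
    fix \<omega> assume "\<omega> \<in> \<Omega> K"
    then have v: "valid k \<omega>" using assms by (intro valid_space) auto
    from power_mono[OF retraction_step'(3)[OF v v v], of 2]
    show "(norm (x (Suc k) \<omega> - x k \<omega>))\<^sup>2 \<le> M1\<^sup>2 * (norm (\<eta> k \<omega>))\<^sup>2" by (simp add: power_mult_distrib)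
  qed
  then show ?thesis by (simp add: avg_cmult N_def)
qed

lemma Er_0: "Er K 0 = 0"
  by (simp add: Er_def err_def init avg_def)

section \<open>Mean-square errors of the four estimators\<close>

lemma mean_sq_le:
  assumes "\<And>j. j \<in> {1..n} \<Longrightarrow> norm (v j) \<le> c"
  shows "mean_sq n v \<le> c\<^sup>2"
proof -
  have "(\<Sum>j=1..n. (norm (v j))\<^sup>2) \<le> (\<Sum>j=1..n. c\<^sup>2)" using assms by (intro sum_mono power_mono) auto
  then show ?thesis using n by (simp add: divide_le_eq mult.commute)
qed

lemma length_batch: "\<omega> \<in> \<Omega> K \<Longrightarrow> k \<in> {1..K} \<Longrightarrow> length (\<omega> k) = b"
  by (rule length_batches[OF batch_space_valid])

text \<open>The common form of three estimators: a part fixed before the draw plus a centred batch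
  deviation. The fixed part is zero for SVRG and SAGA, and the transported previous error for
  SARAH.\<close>

lemma deviation_error:
  assumes k: "k \<in> {1..K}"
    and err: "\<And>\<omega>. \<omega> \<in> \<Omega> K \<Longrightarrow> err k \<omega> = a \<omega> + batch_deviation n (\<omega> k) (\<xi> \<omega>)"
    and indep: "\<And>\<omega> js. \<omega> \<in> \<Omega> K \<Longrightarrow> js \<in> batches smp n b \<Longrightarrow> a (\<omega> (k := js)) = a \<omega> \<and> \<xi> (\<omega> (k := js)) = \<xi> \<omega>"
    and le: "\<And>\<omega>. \<omega> \<in> \<Omega> K \<Longrightarrow> (norm (a \<omega>))\<^sup>2 \<le> g \<omega> \<and> mean_sq n (\<xi> \<omega>) \<le> c \<omega>"
  shows "Er K k \<le> avg (\<Omega> K) (\<lambda>\<omega>. g \<omega> + 1 / real b * c \<omega>)"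
proof -
  have "Er K k = avg (\<Omega> K) (\<lambda>\<omega>. (norm (a \<omega> + batch_deviation n (\<omega> k) (\<xi> \<omega>)))\<^sup>2)"
    unfolding Er_def by (rule avg_cong) (simp only: err)
  also have "\<dots> \<le> avg (\<Omega> K) (\<lambda>\<omega>. (norm (a \<omega>))\<^sup>2 + 1 / real b * mean_sq n (\<xi> \<omega>))"
    by (rule avg_batch_variance[OF b_pos b_le k indep])
  also have "\<dots> \<le> avg (\<Omega> K) (\<lambda>\<omega>. g \<omega> + 1 / real b * c \<omega>)"
    using le by (intro avg_mono add_mono mult_left_mono) auto
  finally show ?thesis .
qed

lemma mean_rgrad_difference:
  assumes "y \<in> M" "w \<in> M"
  shows "(1 / real n) *\<^sub>R (\<Sum>j=1..n. rgrad M (f j) y - tangent_proj M y (rgrad M (f j) w)) =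
    rgrad M F y - tangent_proj M y (rgrad M F w)"
  by (simp add: sum_subtractf scaleR_diff_right rgrad_F[OF assms(1)] rgrad_F[OF assms(2)]
      linear_scale[OF proj_linear[OF assms(1)]] linear_sum[OF proj_linear[OF assms(1)]])

text \<open>The variance is governed by the distance to the reference point of the epoch;
  Cauchy-Schwarz over at most q displacements produces the factor q.\<close>

lemma svrg_error:
  assumes est: "est = SVRG" and k: "k < K"
  shows "Er K k \<le> LG\<^sup>2 * real q / real b * (\<Sum>i\<in>{k div q * q..<k}. D K i)"
proof (cases "k = 0")
  case True then show ?thesis by (simp add: Er_0)
next
  case False
  then have kK: "k \<in> {1..K}" using k by auto
  define s where "s = k div q * q"
  have s: "s \<le> k" "k - s \<le> q"
  proof -
    show "s \<le> k" by (simp add: s_def)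
    have "k = s + k mod q" "k mod q < q" using q_pos by (auto simp: s_def)
    then show "k - s \<le> q" by linarith
  qed
  define \<xi> where "\<xi> \<omega> j = rgrad M (f j) (x k \<omega>) - tangent_proj M (x k \<omega>) (rgrad M (f j) (x s \<omega>))" for \<omega> j
  define S where "S \<omega> = (\<Sum>i\<in>{s..<k}. (norm (x (Suc i) \<omega> - x i \<omega>))\<^sup>2)" for \<omega>
  have v: "valid k \<omega>" "valid s \<omega>" if "\<omega> \<in> \<Omega> K" for \<omega> using that k s by (auto intro!: valid_space)
  have "Er K k \<le> avg (\<Omega> K) (\<lambda>\<omega>. 0 + 1 / real b * (LG\<^sup>2 * (real q * S \<omega>)))"
  proof (rule deviation_error[OF kK, where a = "\<lambda>_. 0" and \<xi> = \<xi>])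
    fix \<omega> assume \<omega>: "\<omega> \<in> \<Omega> K"
    note x = x_in[OF v(1)[OF \<omega>]] x_in[OF v(2)[OF \<omega>]]
    show "err k \<omega> = 0 + batch_deviation n (\<omega> k) (\<xi> \<omega>)"
      using mean_rgrad_difference[OF x]
      unfolding err_def step(6)[OF v(1)[OF \<omega>] False] est length_batch[OF \<omega> kK]
      by (simp add: Let_def s_def[symmetric] \<xi>_def)
    have "mean_sq n (\<xi> \<omega>) \<le> (LG * norm (x k \<omega> - x s \<omega>))\<^sup>2"
      unfolding \<xi>_def by (rule mean_sq_le) (intro rgrad_transport x f_lipschitz f_bound)
    also have "\<dots> = LG\<^sup>2 * (norm (x k \<omega> - x s \<omega>))\<^sup>2" by (simp add: power_mult_distrib)
    also have "\<dots> \<le> LG\<^sup>2 * (real (k - s) * S \<omega>)"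
      unfolding S_def by (intro mult_left_mono norm_path_sq_le[OF s(1)]) simp
    also have "\<dots> \<le> LG\<^sup>2 * (real q * S \<omega>)"
      using s(2) by (intro mult_left_mono mult_right_mono) (auto simp: S_def intro: sum_nonneg)
    finally show "(norm (0 :: real^'d))\<^sup>2 \<le> 0 \<and> mean_sq n (\<xi> \<omega>) \<le> LG\<^sup>2 * (real q * S \<omega>)" by simp
    fix js assume "js \<in> batches smp n b"
    note i = resample_indep(1)[OF \<omega> this kK]
    show "(0 :: real^'d) = 0 \<and> \<xi> (\<omega> (k := js)) = \<xi> \<omega>"
      unfolding \<xi>_def using i[of k] i[of s] s by simp
  qed
  also have "\<dots> = avg (\<Omega> K) (\<lambda>\<omega>. LG\<^sup>2 * real q / real b * S \<omega>)" by (simp add: mult_ac)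
  finally show ?thesis by (simp only: avg_cmult avg_sum D_def S_def s_def)
qed

text \<open>The new fluctuation is centred given the past, so its mean square is added to that of
  the old error without a cross term.\<close>

lemma sarah_step:
  assumes est: "est = SARAH" and k: "k < K" "\<not> q dvd k"
  shows "Er K k \<le> Er K (k - 1) + LG\<^sup>2 / real b * D K (k - 1)"
proof -
  have k0: "k \<noteq> 0" using k(2) by (metis dvd_0_right)
  then have kK: "k \<in> {1..K}" using k by auto
  let ?P = "\<lambda>\<omega>. tangent_proj M (x k \<omega>)"
  define \<xi> where "\<xi> \<omega> j = rgrad M (f j) (x k \<omega>) - ?P \<omega> (rgrad M (f j) (x (k - 1) \<omega>))" for \<omega> j
  have "Er K k \<le> avg (\<Omega> K) (\<lambda>\<omega>. (norm (err (k - 1) \<omega>))\<^sup>2 + 1 / real b * (LG * norm (x k \<omega> - x (k - 1) \<omega>))\<^sup>2)"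
  proof (rule deviation_error[OF kK, where a = "\<lambda>\<omega>. ?P \<omega> (err (k - 1) \<omega>)" and \<xi> = \<xi>])
    fix \<omega> assume \<omega>: "\<omega> \<in> \<Omega> K"
    have v: "valid k \<omega>" "valid (k - 1) \<omega>" using \<omega> k by (auto intro!: valid_space)
    note x = x_in[OF v(1)] x_in[OF v(2)]
    show "err k \<omega> = ?P \<omega> (err (k - 1) \<omega>) + batch_deviation n (\<omega> k) (\<xi> \<omega>)"
      using mean_rgrad_difference[OF x] k(2) linear_diff[OF proj_linear[OF x(1)]]
      unfolding err_def step(6)[OF v(1) k0] est length_batch[OF \<omega> kK] by (simp add: Let_def \<xi>_def)
    have "mean_sq n (\<xi> \<omega>) \<le> (LG * norm (x k \<omega> - x (k - 1) \<omega>))\<^sup>2"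
      unfolding \<xi>_def by (rule mean_sq_le) (intro rgrad_transport x f_lipschitz f_bound)
    moreover have "(norm (?P \<omega> (err (k - 1) \<omega>)))\<^sup>2 \<le> (norm (err (k - 1) \<omega>))\<^sup>2"
      by (intro power_mono proj_norm x) simp
    ultimately show "(norm (?P \<omega> (err (k - 1) \<omega>)))\<^sup>2 \<le> (norm (err (k - 1) \<omega>))\<^sup>2 \<and>
        mean_sq n (\<xi> \<omega>) \<le> (LG * norm (x k \<omega> - x (k - 1) \<omega>))\<^sup>2" by (rule conjI[rotated])
    fix js assume "js \<in> batches smp n b"
    note i = resample_indep(1,2)[OF \<omega> this kK]
    show "tangent_proj M (x k (\<omega> (k := js))) (err (k - 1) (\<omega> (k := js))) = ?P \<omega> (err (k - 1) \<omega>) \<and>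
        \<xi> (\<omega> (k := js)) = \<xi> \<omega>"
      unfolding \<xi>_def err_def using i(1)[of k] i(1)[of "k - 1"] i(2)[of "k - 1"] k0 by simp
  qed
  also have "\<dots> = avg (\<Omega> K) (\<lambda>\<omega>. (norm (err (k - 1) \<omega>))\<^sup>2 + LG\<^sup>2 / real b * (norm (x (Suc (k - 1)) \<omega> - x (k - 1) \<omega>))\<^sup>2)"
    using k0 by (simp add: power_mult_distrib)
  finally show ?thesis by (simp only: avg_add avg_cmult Er_def D_def)
qed

text \<open>Errors accumulate additively from the exact gradient at the start of the epoch. Only
  neighbouring iterates are compared, so the factor q of SVRG is absent.\<close>

lemma sarah_error:
  assumes est: "est = SARAH"
  shows "k < K \<Longrightarrow> Er K k \<le> LG\<^sup>2 / real b * (\<Sum>i\<in>{k div q * q..<k}. D K i)"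
proof (induction k)
  case 0 then show ?case by (simp add: Er_0)
next
  case (Suc k)
  show ?case
  proof (cases "q dvd Suc k")
    case True
    have "err (Suc k) \<omega> = 0" if "\<omega> \<in> \<Omega> K" for \<omega>
    proof -
      have v: "valid (Suc k) \<omega>" using that Suc.prems by (intro valid_space) auto
      show ?thesis unfolding err_def step(6)[OF v nat.simps(3)] est using True by (simp add: Let_def)
    qed
    then have "Er K (Suc k) = avg (\<Omega> K) (\<lambda>_. 0)" unfolding Er_def by (intro avg_cong) simp
    then show ?thesis using True by (simp add: avg_def)
  next
    case False
    have d: "Suc k div q * q = k div q * q" using False by (simp add: div_Suc mod_eq_0_iff_dvd)
    have "Er K (Suc k) \<le> Er K k + LG\<^sup>2 / real b * D K k"
      using sarah_step[OF est Suc.prems False] by simp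
    also have "\<dots> \<le> LG\<^sup>2 / real b * (\<Sum>i\<in>{k div q * q..<k}. D K i) + LG\<^sup>2 / real b * D K k"
      using Suc by simp
    also have "\<dots> = LG\<^sup>2 / real b * (\<Sum>i\<in>{k div q * q..<Suc k}. D K i)"
      unfolding sum.atLeastLessThan_Suc[OF div_times_less_eq_dividend] by (simp add: distrib_left)
    finally show ?thesis unfolding d .
  qed
qed

lemma epoch_error:
  assumes "\<And>k. k < K \<Longrightarrow> Er K k \<le> c * (\<Sum>i\<in>{k div q * q..<k}. D K i)" "0 \<le> c"
  shows "(\<Sum>k<K. Er K k) \<le> c * real q * (\<Sum>k<K. D K k)"
proof -
  have "(\<Sum>k<K. Er K k) \<le> (\<Sum>k<K. c * (\<Sum>i\<in>{k div q * q..<k}. D K i))"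
    using assms(1) by (intro sum_mono) auto
  also have "\<dots> = c * (\<Sum>k<K. \<Sum>i\<in>{k div q * q..<k}. D K i)" by (simp add: sum_distrib_left)
  also have "\<dots> \<le> c * (real q * (\<Sum>k<K. D K k))"
    using q_pos by (intro mult_left_mono epoch_sum_le nonneg assms(2))
  finally show ?thesis by simp
qed

section \<open>Staleness of the gradient table\<close>

lemma z_in: "valid k \<omega> \<Longrightarrow> z k \<omega> j \<in> M"
  unfolding z_def by (intro table_in x_in) (rule valid_mono)

lemma table_step:
  assumes "Suc k < K"
  shows "T K (Suc k) \<le> (1 - real b / (4 * real n)) * T K k + 6 * real n / real b * D K k"
proof -
  \<comment> \<open>A lower bound for the probability that a given entry is refreshed.\<close>
  define p where "p = real b / (2 * real n)"
  have nb: "0 < real n" "0 < real b" "real b \<le> real n" using n b_pos b_le by auto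
  have p: "0 < p" "p \<le> 1" using nb by (auto simp: p_def)
  \<comment> \<open>With this Young weight, (1 + s)(1 - p) is still at most 1 - p/2, while 1 + 1/s
    costs at most 3/p = 6 n/b.\<close>
  define s where "s = p / 2"
  have s: "0 < s" using p by (simp add: s_def)
  show ?thesis
  proof (cases "k = 0")
    case True
    \<comment> \<open>No batch is drawn at iteration 0, so the table still holds the starting point
      and there is no refresh to exploit.\<close>
    have "T K (Suc 0) = avg (\<Omega> K) (\<lambda>\<omega>. (norm (x (Suc 0) \<omega> - x 0 \<omega>))\<^sup>2)"
      unfolding T_def by (rule avg_cong) (use n in \<open>simp add: z_def\<close>)
    then have "T K (Suc 0) = D K 0" by (simp add: D_def)
    moreover have "T K 0 = 0" by (simp add: T_def z_def avg_def)
    moreover have "1 * D K 0 \<le> 6 * real n / real b * D K 0"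
      using nb by (intro mult_right_mono nonneg) (simp add: field_simps)
    ultimately show ?thesis using True by simp
  next
    case False
    then have kK: "k \<in> {1..K}" using assms by auto
    define \<phi> where "\<phi> \<omega> j = (norm (x k \<omega> - z k \<omega> j))\<^sup>2" for \<omega> j
    have zS: "z (Suc k) \<omega> j = (if j \<in> set (\<omega> k) then x k \<omega> else z k \<omega> j)" for \<omega> j
      using False by (simp add: z_def)
    have "T K (Suc k) \<le> avg (\<Omega> K) (\<lambda>\<omega>. (1 + 1 / s) * (norm (x (Suc k) \<omega> - x k \<omega>))\<^sup>2 +
        (1 + s) * (1 / real n * (\<Sum>j=1..n. if j \<in> set (\<omega> k) then 0 else \<phi> \<omega> j)))"
      unfolding T_def
    proof (rule avg_mono)
      fix \<omega>
      let ?d = "(norm (x (Suc k) \<omega> - x k \<omega>))\<^sup>2"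
      have "(\<Sum>j=1..n. (norm (x (Suc k) \<omega> - z (Suc k) \<omega> j))\<^sup>2) \<le>
          (\<Sum>j=1..n. (1 + 1 / s) * ?d + (1 + s) * (if j \<in> set (\<omega> k) then 0 else \<phi> \<omega> j))"
      proof (rule sum_mono)
        fix j
        have "x (Suc k) \<omega> - z (Suc k) \<omega> j = (x (Suc k) \<omega> - x k \<omega>) + (x k \<omega> - z (Suc k) \<omega> j)" by simp
        then have "(norm (x (Suc k) \<omega> - z (Suc k) \<omega> j))\<^sup>2 \<le> (1 + 1 / s) * ?d + (1 + s) * (norm (x k \<omega> - z (Suc k) \<omega> j))\<^sup>2"
          using norm_add_sq_weighted[OF s, of "x (Suc k) \<omega> - x k \<omega>" "x k \<omega> - z (Suc k) \<omega> j"] by simp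
        also have "(norm (x k \<omega> - z (Suc k) \<omega> j))\<^sup>2 = (if j \<in> set (\<omega> k) then 0 else \<phi> \<omega> j)"
          by (simp add: zS \<phi>_def)
        finally show "(norm (x (Suc k) \<omega> - z (Suc k) \<omega> j))\<^sup>2 \<le> (1 + 1 / s) * ?d + (1 + s) * (if j \<in> set (\<omega> k) then 0 else \<phi> \<omega> j)" .
      qed
      also have "\<dots> = real n * ((1 + 1 / s) * ?d) + (1 + s) * (\<Sum>j=1..n. if j \<in> set (\<omega> k) then 0 else \<phi> \<omega> j)"
        by (simp add: sum.distrib sum_distrib_left)
      finally have le: "(\<Sum>j=1..n. (norm (x (Suc k) \<omega> - z (Suc k) \<omega> j))\<^sup>2) \<le> \<dots>" .
      from divide_right_mono[OF le, of "real n"]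
      show "(\<Sum>j=1..n. (norm (x (Suc k) \<omega> - z (Suc k) \<omega> j))\<^sup>2) / real n \<le> (1 + 1 / s) * ?d +
          (1 + s) * (1 / real n * (\<Sum>j=1..n. if j \<in> set (\<omega> k) then 0 else \<phi> \<omega> j))"
        using nb(1) by (simp add: add_divide_distrib)
    qed
    also have "\<dots> = (1 + 1 / s) * D K k + (1 + s) * (1 / real n *
        avg (\<Omega> K) (\<lambda>\<omega>. \<Sum>j=1..n. if j \<in> set (\<omega> k) then 0 else \<phi> \<omega> j))"
      by (simp only: avg_add avg_cmult D_def)
    also have "\<dots> \<le> (1 + 1 / s) * D K k + (1 + s) * (1 / real n *
        avg (\<Omega> K) (\<lambda>\<omega>. (1 - real b / (2 * real n)) * (\<Sum>j=1..n. \<phi> \<omega> j)))"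
    proof (intro add_left_mono mult_left_mono avg_batch_avoid[OF b_pos b_le kK])
      fix \<omega> js assume "\<omega> \<in> \<Omega> K" "js \<in> batches smp n b"
      note i = resample_indep(1,3)[OF this kK]
      show "\<phi> (\<omega> (k := js)) = \<phi> \<omega>" unfolding \<phi>_def z_def using i by simp
    qed (use s in \<open>auto simp: \<phi>_def\<close>)
    also have "\<dots> = (1 + 1 / s) * D K k + ((1 + s) * (1 - p)) * T K k"
      unfolding T_def \<phi>_def p_def avg_cmult by (simp add: avg_cmult[of _ "1 / real n", simplified] mult_ac)
    also have "\<dots> \<le> (6 * real n / real b) * D K k + (1 - real b / (4 * real n)) * T K k"
    proof (intro add_mono mult_right_mono nonneg)
      have "1 + 1 / s \<le> 3 / p" using p by (simp add: s_def field_simps)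
      then show "1 + 1 / s \<le> 6 * real n / real b" by (simp add: p_def)
      have "(1 + s) * (1 - p) = 1 - p / 2 - p\<^sup>2 / 2" by (simp add: s_def field_simps power2_eq_square)
      also have "\<dots> \<le> 1 - p / 2" by simp
      finally show "(1 + s) * (1 - p) \<le> 1 - real b / (4 * real n)" by (simp add: p_def)
    qed
    finally show ?thesis by simp
  qed
qed

text \<open>The contraction rate b/(4n) turns the inflow 6 n/b per squared displacement into 24
  times the square of n/b.\<close>

lemma table_sum: "(\<Sum>k<K. T K k) \<le> 24 * (real n / real b)\<^sup>2 * (\<Sum>k<K. D K k)"
proof -
  define \<theta> where "\<theta> = real b / (4 * real n)"
  have nb: "0 < real n" "0 < real b" "real b \<le> real n" using n b_pos b_le by auto
  have \<theta>: "0 < \<theta>" "\<theta> \<le> 1" using nb by (auto simp: \<theta>_def)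
  let ?c = "\<lambda>k. if k = 0 then 0 else 6 * real n / real b * D K (k - 1)"
  have "\<theta> * (\<Sum>k<K. T K k) \<le> (\<Sum>k<K. ?c k)"
  proof (rule contraction_sum)
    show "T K 0 = 0" by (simp add: T_def z_def avg_def)
    fix k assume "Suc k < K"
    then show "T K (Suc k) \<le> (1 - \<theta>) * T K k + ?c (Suc k)" using table_step[of k K] by (simp add: \<theta>_def)
  qed (use \<theta> nonneg in auto)
  also have "\<dots> \<le> (\<Sum>k<K. 6 * real n / real b * D K k)"
    by (rule sum_shift_le) (use nonneg nb in auto)
  finally have "\<theta> * (\<Sum>k<K. T K k) \<le> 6 * real n / real b * (\<Sum>k<K. D K k)" by (simp add: sum_distrib_left)
  then have "(\<Sum>k<K. T K k) \<le> 6 * real n / real b * (\<Sum>k<K. D K k) / \<theta>" by (rule le_divide_of_mult_le[OF \<theta>(1)])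
  also have "\<dots> = 24 * (real n / real b)\<^sup>2 * (\<Sum>k<K. D K k)"
    using nb by (simp add: \<theta>_def field_simps power2_eq_square)
  finally show ?thesis .
qed

lemma grad_table_le:
  assumes v: "valid k \<omega>" and j: "j \<in> {1..n}"
  shows "norm (gradient (f j) (x k \<omega>) - gradient (f j) (z k \<omega> j)) \<le> Lf * norm (x k \<omega> - z k \<omega> j)"
  using lipschitz_onD[OF f_lipschitz[OF j] M_subset_U[OF x_in[OF v]] M_subset_U[OF z_in[OF v]]]
  by (simp add: dist_norm)

lemma sum_grad_table_le:
  assumes v: "valid k \<omega>" and d: "\<And>j. j \<in> {1..n} \<Longrightarrow> norm (d j) \<le> norm (gradient (f j) (x k \<omega>) - gradient (f j) (z k \<omega> j))"
  shows "mean_sq n d \<le> Lf\<^sup>2 * mean_sq n (\<lambda>j. x k \<omega> - z k \<omega> j)"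
proof -
  have "(\<Sum>j=1..n. (norm (d j))\<^sup>2) \<le> (\<Sum>j=1..n. Lf\<^sup>2 * (norm (x k \<omega> - z k \<omega> j))\<^sup>2)"
  proof (rule sum_mono)
    fix j assume j: "j \<in> {1..n}"
    have "norm (d j) \<le> Lf * norm (x k \<omega> - z k \<omega> j)" using d[OF j] grad_table_le[OF v j] by linarith
    from power_mono[OF this, of 2] show "(norm (d j))\<^sup>2 \<le> Lf\<^sup>2 * (norm (x k \<omega> - z k \<omega> j))\<^sup>2"
      by (simp add: power_mult_distrib)
  qed
  from divide_right_mono[OF this, of "real n"] show ?thesis by (simp add: sum_distrib_left sum_divide_distrib)
qed

text \<open>Fresh and stored gradients are projected at the same point, so the estimator is unbiased
  and \<open>Lf\<close> suffices: no transport constant enters.\<close>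

lemma saga_error:
  assumes est: "est = SAGA" and k: "k < K"
  shows "Er K k \<le> Lf\<^sup>2 / real b * T K k"
proof (cases "k = 0")
  case True then show ?thesis using nonneg(5)[of K 0] by (simp add: Er_0)
next
  case False
  then have kK: "k \<in> {1..K}" using k by auto
  let ?P = "\<lambda>\<omega>. tangent_proj M (x k \<omega>)"
  define \<xi> where "\<xi> \<omega> j = ?P \<omega> (gradient (f j) (x k \<omega>) - gradient (f j) (z k \<omega> j))" for \<omega> j
  have "Er K k \<le> avg (\<Omega> K) (\<lambda>\<omega>. 0 + 1 / real b * (Lf\<^sup>2 * mean_sq n (\<lambda>j. x k \<omega> - z k \<omega> j)))"
  proof (rule deviation_error[OF kK, where a = "\<lambda>_. 0" and \<xi> = \<xi>])
    fix \<omega> assume \<omega>: "\<omega> \<in> \<Omega> K"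
    have v: "valid k \<omega>" using \<omega> k by (auto intro!: valid_space)
    note L = proj_linear[OF x_in[OF v]]
    have 1: "(\<Sum>j\<leftarrow>js. \<xi> \<omega> j) = ?P \<omega> (\<Sum>j\<leftarrow>js. gradient (f j) (x k \<omega>) - gradient (f j) (z k \<omega> j))" for js
      by (induction js) (simp_all add: \<xi>_def linear_0[OF L] linear_add[OF L])
    have 2: "(1 / real n) *\<^sub>R (\<Sum>j=1..n. \<xi> \<omega> j) = ?P \<omega> (gradient F (x k \<omega>) - (1 / real n) *\<^sub>R (\<Sum>j=1..n. gradient (f j) (z k \<omega> j)))"
      unfolding \<xi>_def linear_sum[OF L, symmetric] linear_scale[OF L, symmetric] gradient_F
      by (simp add: sum_subtractf scaleR_diff_right)
    show "err k \<omega> = 0 + batch_deviation n (\<omega> k) (\<xi> \<omega>)"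
      unfolding err_def step(6)[OF v False] est 1 2 rgrad_def length_batch[OF \<omega> kK]
      by (simp add: Let_def z_def linear_diff[OF L] linear_add[OF L] linear_scale[OF L])
    have "mean_sq n (\<xi> \<omega>) \<le> Lf\<^sup>2 * mean_sq n (\<lambda>j. x k \<omega> - z k \<omega> j)"
      unfolding \<xi>_def by (rule sum_grad_table_le[OF v]) (rule proj_norm[OF x_in[OF v]])
    then show "(norm (0 :: real^'d))\<^sup>2 \<le> 0 \<and> mean_sq n (\<xi> \<omega>) \<le> Lf\<^sup>2 * mean_sq n (\<lambda>j. x k \<omega> - z k \<omega> j)"
      by simp
    fix js assume "js \<in> batches smp n b"
    note i = resample_indep(1,3)[OF \<omega> this kK]
    show "(0 :: real^'d) = 0 \<and> \<xi> (\<omega> (k := js)) = \<xi> \<omega>" unfolding \<xi>_def z_def using i by simp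
  qed
  also have "\<dots> = 1 / real b * (Lf\<^sup>2 * T K k)" by (simp only: avg_cmult T_def add_0)
  finally show ?thesis by simp
qed

text \<open>The weight 1/n on the batch sum makes the estimator biased, so the batch part and the
  table part are bounded separately, without a gain of 1/b. Boundedness must then come from a batch
  proportional to n.\<close>

lemma sag_error:
  assumes est: "est = SAG" and k: "k < K"
  shows "Er K k \<le> 4 * Lf\<^sup>2 * T K k"
proof (cases "k = 0")
  case True then show ?thesis using nonneg(5)[of K 0] by (simp add: Er_0)
next
  case False
  then have kK: "k \<in> {1..K}" using k by auto
  define d where "d \<omega> j = gradient (f j) (x k \<omega>) - gradient (f j) (z k \<omega> j)" for \<omega> j
  define l where "l \<omega> = (\<Sum>j\<leftarrow>\<omega> k. (norm (d \<omega> j))\<^sup>2)" for \<omega> :: "nat \<Rightarrow> nat list"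
  define v where "v = avg (\<Omega> K) (\<lambda>\<omega>. mean_sq n (d \<omega>))"
  have nb: "0 < real n" "0 < real b" "real b \<le> real n" using n b_pos b_le by auto
  have pointwise: "(norm (err k \<omega>))\<^sup>2 \<le> 2 * mean_sq n (d \<omega>) + 2 * (real b / (real n)\<^sup>2) * l \<omega>"
    if \<omega>: "\<omega> \<in> \<Omega> K" for \<omega>
  proof -
    have v: "valid k \<omega>" using \<omega> k by (auto intro!: valid_space)
    note x = x_in[OF v]
    note L = proj_linear[OF x]
    let ?u = "(1 / real n) *\<^sub>R (\<Sum>j\<leftarrow>\<omega> k. d \<omega> j)" and ?w = "(1 / real n) *\<^sub>R (\<Sum>j=1..n. d \<omega> j)"
    have w: "?w = gradient F (x k \<omega>) - (1 / real n) *\<^sub>R (\<Sum>j=1..n. gradient (f j) (z k \<omega> j))"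
      by (simp add: d_def gradient_F sum_subtractf scaleR_diff_right)
    have "err k \<omega> = tangent_proj M (x k \<omega>) (?u - ?w)"
      unfolding err_def step(6)[OF v False] est w rgrad_def
      by (simp add: Let_def z_def d_def linear_diff[OF L] linear_add[OF L])
    then have "norm (err k \<omega>) \<le> norm (?u - ?w)" using proj_norm[OF x] by simp
    then have "(norm (err k \<omega>))\<^sup>2 \<le> (norm (?u + - ?w))\<^sup>2" by (intro power_mono) auto
    also have "\<dots> \<le> 2 * (norm ?u)\<^sup>2 + 2 * (norm ?w)\<^sup>2"
      using norm_add_sq_weighted[of 1 ?u "- ?w"] by simp
    also have "(norm ?u)\<^sup>2 \<le> (real b / (real n)\<^sup>2) * l \<omega>"
    proof -
      have "(norm ?u)\<^sup>2 = (norm (\<Sum>j\<leftarrow>\<omega> k. d \<omega> j))\<^sup>2 / (real n)\<^sup>2" by (simp add: power_divide)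
      also have "\<dots> \<le> (real b * l \<omega>) / (real n)\<^sup>2"
        using norm_sum_list_sq_le[of "d \<omega>" "\<omega> k"]
        by (intro divide_right_mono) (auto simp: length_batch[OF \<omega> kK] l_def)
      finally show ?thesis by simp
    qed
    also have "(norm ?w)\<^sup>2 \<le> mean_sq n (d \<omega>)"
    proof -
      have "(norm (\<Sum>j=1..n. d \<omega> j))\<^sup>2 \<le> (\<Sum>j=1..n. norm (d \<omega> j))\<^sup>2" by (intro power_mono norm_sum) simp
      also have "\<dots> \<le> (\<Sum>j=1..n. (norm (d \<omega> j))\<^sup>2) * real (card {1..n})" by (rule sum_squared_le_sum_of_squares)
      finally have "(norm (\<Sum>j=1..n. d \<omega> j))\<^sup>2 / (real n)\<^sup>2 \<le> ((\<Sum>j=1..n. (norm (d \<omega> j))\<^sup>2) * real n) / (real n)\<^sup>2"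
        by (intro divide_right_mono) auto
      then show ?thesis using nb(1) by (simp add: power_divide power2_eq_square)
    qed
    finally show ?thesis by (simp add: mult.assoc)
  qed
  have "avg (\<Omega> K) l \<le> avg (\<Omega> K) (\<lambda>\<omega>. real b * mean_sq n (d \<omega>))"
    unfolding l_def
  proof (rule avg_batch_sum_list[OF b_le kK])
    fix \<omega> js assume "\<omega> \<in> \<Omega> K" "js \<in> batches smp n b"
    note i = resample_indep(1,3)[OF this kK]
    show "(\<lambda>j. (norm (d (\<omega> (k := js)) j))\<^sup>2) = (\<lambda>j. (norm (d \<omega> j))\<^sup>2)"
      unfolding d_def z_def using i by simp
  qed
  then have l: "avg (\<Omega> K) l \<le> real b * v" unfolding v_def avg_cmult .
  have "Er K k \<le> avg (\<Omega> K) (\<lambda>\<omega>. 2 * mean_sq n (d \<omega>) + 2 * (real b / (real n)\<^sup>2) * l \<omega>)"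
    unfolding Er_def by (rule avg_mono[OF pointwise])
  also have "\<dots> = 2 * v + 2 * (real b / (real n)\<^sup>2) * avg (\<Omega> K) l" by (simp only: avg_add avg_cmult v_def)
  also have "\<dots> \<le> 2 * v + 2 * (real b / (real n)\<^sup>2) * (real b * v)"
    by (intro add_left_mono mult_left_mono l) auto
  also have "\<dots> = (2 + 2 * (real b / real n)\<^sup>2) * v"
    by (simp add: distrib_right power_divide power2_eq_square)
  also have "\<dots> \<le> 4 * (Lf\<^sup>2 * T K k)"
  proof (rule mult_mono)
    have "(real b / real n)\<^sup>2 \<le> 1" using nb by (intro power_le_one) auto
    then show "2 + 2 * (real b / real n)\<^sup>2 \<le> 4" by simp
    have "v \<le> avg (\<Omega> K) (\<lambda>\<omega>. Lf\<^sup>2 * mean_sq n (\<lambda>j. x k \<omega> - z k \<omega> j))"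
      unfolding v_def d_def using k by (intro avg_mono sum_grad_table_le valid_space) auto
    then show "v \<le> Lf\<^sup>2 * T K k" by (simp only: avg_cmult T_def)
    show "0 \<le> v" unfolding v_def by (intro avg_nonneg divide_nonneg_nonneg sum_nonneg) auto
  qed simp
  finally show ?thesis by simp
qed

text \<open>The defining balance of the SAGA batch size: variance reduction 1/b against staleness of
  order (n/b) squared.\<close>

lemma b_SAGA: "est = SAGA \<Longrightarrow> (real n)\<^sup>2 \<le> real b ^ 3"
proof -
  assume "est = SAGA"
  then have "real n powr (2/3) \<le> real b" by (simp add: b_def real_nat_ceiling_ge)
  then have "(real n powr (2/3)) ^ 3 \<le> real b ^ 3" by (intro power_mono) auto
  moreover have "(real n powr (2/3)) ^ 3 = (real n)\<^sup>2" using n by (simp add: powr_power)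
  ultimately show ?thesis by simp
qed

text \<open>Up to fixed factors the errors cost q^2/b for SVRG, q/b for SARAH, n^2/b^3 for SAGA and
  (n/b)^2 for SAG. The prescribed parameters are exactly those keeping these ratios bounded in
  n.\<close>

lemma estimator_error: "(\<Sum>k<K. Er K k) \<le> CE \<kappa>b * (\<Sum>k<K. D K k)"
proof -
  have S: "0 \<le> (\<Sum>k<K. D K k)" by (intro sum_nonneg nonneg)
  have nb: "0 < real n" "0 < real b" "real b \<le> real n" using n b_pos b_le by auto
  have c: "c \<le> CE \<kappa>b" if "c \<le> 4 * LG\<^sup>2 \<or> c \<le> 24 * Lf\<^sup>2 \<or> c \<le> 96 * Lf\<^sup>2 / \<kappa>b\<^sup>2" for c
  proof -
    have "0 \<le> 4 * LG\<^sup>2" "0 \<le> 24 * Lf\<^sup>2" "0 \<le> 96 * Lf\<^sup>2 / \<kappa>b\<^sup>2" by auto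
    then show ?thesis using that unfolding CE_def by linarith
  qed
  have "\<exists>c. (\<Sum>k<K. Er K k) \<le> c * (\<Sum>k<K. D K k) \<and> c \<le> CE \<kappa>b"
  proof (cases est)
    case SVRG
    have "(\<Sum>k<K. Er K k) \<le> LG\<^sup>2 * real q / real b * real q * (\<Sum>k<K. D K k)"
      by (rule epoch_error[OF svrg_error[OF SVRG]]) auto
    moreover have "LG\<^sup>2 * real q / real b * real q \<le> 4 * LG\<^sup>2"
    proof -
      have "real q \<le> 2 * real n powr (1/3)"
        using nat_ceiling_le_twice(2)[OF n_powr[of "1/3"]] SVRG by (simp add: q_def)
      then have "(real q)\<^sup>2 \<le> (2 * real n powr (1/3))\<^sup>2" by (intro power_mono) auto
      also have "\<dots> = 4 * real n powr (2/3)" using n by (simp add: power_mult_distrib powr_power)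
      also have "\<dots> \<le> 4 * real b" using SVRG by (simp add: b_def real_nat_ceiling_ge)
      finally have "LG\<^sup>2 * (real q)\<^sup>2 \<le> LG\<^sup>2 * (4 * real b)" by (intro mult_left_mono) auto
      then show ?thesis using nb by (simp add: divide_le_eq power2_eq_square mult_ac)
    qed
    ultimately show ?thesis using c by blast
  next
    case SARAH
    have "(\<Sum>k<K. Er K k) \<le> LG\<^sup>2 / real b * real q * (\<Sum>k<K. D K k)"
      by (rule epoch_error[OF sarah_error[OF SARAH]]) auto
    moreover have "LG\<^sup>2 / real b * real q \<le> 4 * LG\<^sup>2"
    proof -
      have "q = b" using SARAH by (simp add: q_def b_def)
      then show ?thesis using nb by simp
    qed
    ultimately show ?thesis using c by blast
  next
    case SAGA
    have "(\<Sum>k<K. Er K k) \<le> (\<Sum>k<K. Lf\<^sup>2 / real b * T K k)" by (intro sum_mono saga_error[OF SAGA]) simp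
    also have "\<dots> = Lf\<^sup>2 / real b * (\<Sum>k<K. T K k)" by (simp add: sum_distrib_left)
    also have "\<dots> \<le> Lf\<^sup>2 / real b * (24 * (real n / real b)\<^sup>2 * (\<Sum>k<K. D K k))"
      by (intro mult_left_mono table_sum) auto
    also have "\<dots> = 24 * Lf\<^sup>2 * ((real n)\<^sup>2 / real b ^ 3) * (\<Sum>k<K. D K k)"
      by (simp add: power2_eq_square power3_eq_cube mult_ac)
    finally have "(\<Sum>k<K. Er K k) \<le> 24 * Lf\<^sup>2 * ((real n)\<^sup>2 / real b ^ 3) * (\<Sum>k<K. D K k)" .
    moreover have "24 * Lf\<^sup>2 * ((real n)\<^sup>2 / real b ^ 3) \<le> 24 * Lf\<^sup>2 * 1"
      using b_SAGA[OF SAGA] nb by (intro mult_left_mono) auto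
    ultimately show ?thesis using c by (metis mult.right_neutral)
  next
    case SAG
    have "(\<Sum>k<K. Er K k) \<le> (\<Sum>k<K. 4 * Lf\<^sup>2 * T K k)" by (intro sum_mono sag_error[OF SAG]) simp
    also have "\<dots> = 4 * Lf\<^sup>2 * (\<Sum>k<K. T K k)" by (simp add: sum_distrib_left)
    also have "\<dots> \<le> 4 * Lf\<^sup>2 * (24 * (real n / real b)\<^sup>2 * (\<Sum>k<K. D K k))"
      by (intro mult_left_mono table_sum) auto
    finally have "(\<Sum>k<K. Er K k) \<le> 96 * Lf\<^sup>2 * (real n / real b)\<^sup>2 * (\<Sum>k<K. D K k)" by simp
    moreover have "96 * Lf\<^sup>2 * (real n / real b)\<^sup>2 \<le> 96 * Lf\<^sup>2 / \<kappa>b\<^sup>2"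
    proof -
      have "\<kappa>b * real n \<le> real b" using SAG by (simp add: b_def real_nat_ceiling_ge)
      then have "real n / real b \<le> 1 / \<kappa>b" using nb \<kappa>b by (simp add: field_simps)
      then have "(real n / real b)\<^sup>2 \<le> (1 / \<kappa>b)\<^sup>2" using nb by (intro power_mono) auto
      then have "96 * Lf\<^sup>2 * (real n / real b)\<^sup>2 \<le> 96 * Lf\<^sup>2 * (1 / \<kappa>b)\<^sup>2" by (intro mult_left_mono) auto
      then show ?thesis by (simp add: power_divide)
    qed
    ultimately show ?thesis using c by blast
  qed
  then show ?thesis using S mult_right_mono order_trans by blast
qed

text \<open>Summing the contraction costs a factor 2/(1 - \<open>\<chi>bar\<close>); both of its
  inputs, transport and estimator error, are controlled by the steps themselves.\<close>

lemma momentum_error: "(\<Sum>k<K. A K k) \<le> CA \<chi>bar \<kappa>b * (\<Sum>k<K. N K k)"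
proof -
  define \<theta> where "\<theta> = (1 - \<chi>bar) / 2"
  have \<theta>: "0 < \<theta>" "\<theta> \<le> 1" using \<chi>bar by (auto simp: \<theta>_def)
  let ?a = "(1 + 1 / \<theta>) * (LG * M1)\<^sup>2"
  let ?c = "\<lambda>k. (if k = 0 then 0 else ?a * N K (k - 1)) + Er K k"
  have a: "0 \<le> ?a" using \<theta> by simp
  have "\<theta> * (\<Sum>k<K. A K k) \<le> (\<Sum>k<K. ?c k)"
  proof (rule contraction_sum)
    show "A K 0 = 0" by (simp add: A_def e_0 avg_def)
    fix k assume k: "Suc k < K"
    have "A K (Suc k) \<le> avg (\<Omega> K) (\<lambda>\<omega>. (1 - \<theta>) * (norm (e k \<omega>))\<^sup>2 + ?a * (norm (\<eta> k \<omega>))\<^sup>2 + (norm (err (Suc k) \<omega>))\<^sup>2)"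
      unfolding A_def
    proof (rule avg_mono)
      fix \<omega> assume "\<omega> \<in> \<Omega> K"
      then have "valid (Suc k) \<omega>" using k by (intro valid_space) auto
      from momentum[OF this] show "(norm (e (Suc k) \<omega>))\<^sup>2 \<le>
          (1 - \<theta>) * (norm (e k \<omega>))\<^sup>2 + ?a * (norm (\<eta> k \<omega>))\<^sup>2 + (norm (err (Suc k) \<omega>))\<^sup>2"
        unfolding \<theta>_def .
    qed
    also have "\<dots> = (1 - \<theta>) * A K k + ?a * N K k + Er K (Suc k)"
      by (simp only: avg_add avg_cmult A_def N_def Er_def)
    finally show "A K (Suc k) \<le> (1 - \<theta>) * A K k + ?c (Suc k)" by simp
  qed (use \<theta> nonneg in auto)
  also have "\<dots> = (\<Sum>k<K. if k = 0 then 0 else ?a * N K (k - 1)) + (\<Sum>k<K. Er K k)" by (rule sum.distrib)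
  also have "\<dots> \<le> (\<Sum>k<K. ?a * N K k) + CE \<kappa>b * (\<Sum>k<K. D K k)"
    by (intro add_mono sum_shift_le estimator_error mult_nonneg_nonneg a nonneg)
  also have "\<dots> \<le> (\<Sum>k<K. ?a * N K k) + CE \<kappa>b * (\<Sum>k<K. M1\<^sup>2 * N K k)"
    by (intro add_left_mono mult_left_mono sum_mono D_le CE) simp
  also have "\<dots> = (?a + CE \<kappa>b * M1\<^sup>2) * (\<Sum>k<K. N K k)"
  proof -
    have "(\<Sum>k<K. r * N K k) + s * (\<Sum>k<K. t * N K k) = (r + s * t) * (\<Sum>k<K. N K k)" for r s t :: real
      by (simp add: sum_distrib_left[symmetric] distrib_right)
    then show ?thesis .
  qed
  finally have "(\<Sum>k<K. A K k) \<le> (?a + CE \<kappa>b * M1\<^sup>2) * (\<Sum>k<K. N K k) / \<theta>"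
    by (rule le_divide_of_mult_le[OF \<theta>(1)])
  also have "\<dots> = CA \<chi>bar \<kappa>b * (\<Sum>k<K. N K k)"
    by (simp add: CA_def \<theta>_def)
  finally show ?thesis .
qed

section \<open>Total step length and total criticality\<close>

definition "tolE K k = avg (\<Omega> K) (\<lambda>\<omega>. tol (Y k \<omega>))"

lemma tol_sum: "(\<Sum>k<K. tolE K k) \<le> \<kappa> * (\<Sum>k<K. N K k) + Csum"
proof -
  have "(\<Sum>k<K. tolE K k) \<le> (\<Sum>k<K. (if k = 0 then 0 else \<kappa> * N K (k - 1)) + \<sigma> k)"
  proof (rule sum_mono)
    fix k assume k: "k \<in> {..<K}"
    have "tolE K k \<le> avg (\<Omega> K) (\<lambda>\<omega>. (if k = 0 then 0 else \<kappa> * (norm (\<eta> (k - 1) \<omega>))\<^sup>2) + \<sigma> k)"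
      unfolding tolE_def by (rule avg_mono, rule tol_le, erule valid_space) (use k in simp)
    also have "\<dots> = (if k = 0 then 0 else \<kappa> * N K (k - 1)) + \<sigma> k"
      by (cases "k = 0") (simp_all add: avg_add avg_cmult avg_const batch_space_nonempty b_le N_def)
    finally show "tolE K k \<le> (if k = 0 then 0 else \<kappa> * N K (k - 1)) + \<sigma> k" .
  qed
  also have "\<dots> = (\<Sum>k<K. if k = 0 then 0 else \<kappa> * N K (k - 1)) + (\<Sum>k<K. \<sigma> k)" by (rule sum.distrib)
  also have "\<dots> \<le> (\<Sum>k<K. \<kappa> * N K k) + Csum"
    using sum_le_suminf[OF \<sigma>(2), of "{..<K}"] \<sigma>(1,3)
    by (intro add_mono sum_shift_le mult_nonneg_nonneg \<kappa> nonneg) auto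
  finally show ?thesis by (simp add: sum_distrib_left)
qed

text \<open>Telescoping of the averaged descent. The errors return multiples of the same sum of
  squared steps, and the summand 1 in the hypothesis is the coefficient that remains after they are
  absorbed.\<close>

lemma step_sum:
  assumes \<alpha>_small: "1 + Cd + Ct * \<kappa> + \<alpha> / 2 * CA \<chi>bar \<kappa>b \<le> \<gamma> / (2 * \<alpha>)"
  shows "(\<Sum>k<K. N K k) \<le> osc + Ct * Csum"
proof -
  let ?S = "\<Sum>k<K. N K k"
  have S: "0 \<le> ?S" by (intro sum_nonneg nonneg)
  have "- osc \<le> avg (\<Omega> K) (\<lambda>\<omega>. \<Phi> (x K \<omega>) - \<Phi> (x 0 \<omega>))"
  proof -
    have "avg (\<Omega> K) (\<lambda>_. - osc) \<le> avg (\<Omega> K) (\<lambda>\<omega>. \<Phi> (x K \<omega>) - \<Phi> (x 0 \<omega>))"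
    proof (rule avg_mono)
      fix \<omega> assume "\<omega> \<in> \<Omega> K"
      then have "valid K \<omega>" by (rule valid_space) simp
      from Phi_oscillation[OF this] show "- osc \<le> \<Phi> (x K \<omega>) - \<Phi> (x 0 \<omega>)" by linarith
    qed
    then show ?thesis by (simp add: avg_const batch_space_nonempty b_le)
  qed
  also have "\<dots> = avg (\<Omega> K) (\<lambda>\<omega>. \<Sum>k<K. \<Phi> (x (Suc k) \<omega>) - \<Phi> (x k \<omega>))"
    by (rule avg_cong) (rule sum_lessThan_telescope[symmetric])
  also have "\<dots> \<le> avg (\<Omega> K) (\<lambda>\<omega>. \<Sum>k<K. - (\<gamma> / (2 * \<alpha>) - Cd) * (norm (\<eta> k \<omega>))\<^sup>2 + \<alpha> / 2 * (norm (e k \<omega>))\<^sup>2 + Ct * tol (Y k \<omega>))"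
    by (intro avg_mono sum_mono descent valid_space) auto
  also have "\<dots> = (\<Sum>k<K. - (\<gamma> / (2 * \<alpha>) - Cd) * N K k + \<alpha> / 2 * A K k + Ct * tolE K k)"
    by (simp only: avg_sum avg_add avg_cmult N_def A_def tolE_def)
  also have "\<dots> = - (\<gamma> / (2 * \<alpha>) - Cd) * ?S + \<alpha> / 2 * (\<Sum>k<K. A K k) + Ct * (\<Sum>k<K. tolE K k)"
    by (simp only: sum.distrib sum_distrib_left)
  also have "\<dots> \<le> - (\<gamma> / (2 * \<alpha>) - Cd) * ?S + \<alpha> / 2 * (CA \<chi>bar \<kappa>b * ?S) + Ct * (\<kappa> * ?S + Csum)"
    using \<alpha> by (intro add_mono mult_left_mono momentum_error tol_sum Ct order_refl) auto
  finally have "(\<gamma> / (2 * \<alpha>) - Cd - Ct * \<kappa> - \<alpha> / 2 * CA \<chi>bar \<kappa>b) * ?S \<le> osc + Ct * Csum"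
    by (simp add: algebra_simps)
  moreover have "1 * ?S \<le> (\<gamma> / (2 * \<alpha>) - Cd - Ct * \<kappa> - \<alpha> / 2 * CA \<chi>bar \<kappa>b) * ?S"
    using \<alpha>_small by (intro mult_right_mono S) simp
  ultimately show ?thesis by simp
qed

lemma expected_Theta_sq_eq:
  assumes "k \<le> K"
  shows "expected_Theta_sq smp M R n f b \<alpha> Y k = avg (\<Omega> K) (\<lambda>\<omega>. (Theta M F R (x k \<omega>) (ch k \<omega>))\<^sup>2)"
  unfolding expected_Theta_sq_def ch_def
proof (rule avg_batch_law_restrict[OF b_le assms])
  fix \<omega> assume \<omega>: "\<omega> \<in> \<Omega> K"
  let ?\<omega> = "\<lambda>i. if i \<in> {1..k} then \<omega> i else []"
  have v: "valid k \<omega>" by (rule valid_space[OF \<omega> assms])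
  then have v': "valid k ?\<omega>" by (simp add: valid_def)
  have "x k ?\<omega> = x k \<omega> \<and> m k ?\<omega> = m k \<omega>" using adapted[OF v' v] by simp
  then show "(Theta M F R (x k ?\<omega>) (exact_step M \<alpha> R (x k ?\<omega>) (m k ?\<omega>)))\<^sup>2 =
      (Theta M F R (x k \<omega>) (exact_step M \<alpha> R (x k \<omega>) (m k \<omega>)))\<^sup>2" by simp
qed

text \<open>The optimality residual contains the step divided by \<alpha>, so this bound, and with
  it the final constant, depends on the fixed \<alpha> but not on n.\<close>

lemma Theta_sum:
  assumes "1 + Cd + Ct * \<kappa> + \<alpha> / 2 * CA \<chi>bar \<kappa>b \<le> \<gamma> / (2 * \<alpha>)"
  defines "S \<equiv> osc + Ct * Csum"
  shows "(\<Sum>k<K. expected_Theta_sq smp M R n f b \<alpha> Y k) \<le>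
    (3 * Lf\<^sup>2 + 3 / \<alpha>\<^sup>2 + 1) * (2 * S + 2 * (\<alpha> * (Ct * (\<kappa> * S + Csum)))) + 3 * (CA \<chi>bar \<kappa>b * S)"
proof -
  let ?c = "3 * Lf\<^sup>2 + 3 / \<alpha>\<^sup>2 + 1"
  let ?N = "\<Sum>k<K. N K k"
  have c: "0 \<le> ?c" by simp
  have NS: "?N \<le> S" unfolding S_def by (rule step_sum[OF assms(1)])
  have "(\<Sum>k<K. expected_Theta_sq smp M R n f b \<alpha> Y k) = avg (\<Omega> K) (\<lambda>\<omega>. \<Sum>k<K. (Theta M F R (x k \<omega>) (ch k \<omega>))\<^sup>2)"
    unfolding avg_sum by (intro sum.cong expected_Theta_sq_eq) auto
  also have "\<dots> \<le> avg (\<Omega> K) (\<lambda>\<omega>. \<Sum>k<K. ?c * (2 * (norm (\<eta> k \<omega>))\<^sup>2 + 2 * (\<alpha> * (Ct * tol (Y k \<omega>)))) + 3 * (norm (e k \<omega>))\<^sup>2)"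
    by (intro avg_mono sum_mono Theta_le valid_space) auto
  also have "\<dots> = (\<Sum>k<K. ?c * (2 * N K k + 2 * (\<alpha> * (Ct * tolE K k))) + 3 * A K k)"
    by (simp only: avg_sum avg_add avg_cmult N_def A_def tolE_def)
  also have "\<dots> = ?c * (2 * ?N + 2 * (\<alpha> * (Ct * (\<Sum>k<K. tolE K k)))) + 3 * (\<Sum>k<K. A K k)"
    by (simp only: sum.distrib sum_distrib_left[symmetric])
  also have "\<dots> \<le> ?c * (2 * S + 2 * (\<alpha> * (Ct * (\<kappa> * S + Csum)))) + 3 * (CA \<chi>bar \<kappa>b * S)"
  proof (intro add_mono mult_left_mono c NS)
    show "(\<Sum>k<K. tolE K k) \<le> \<kappa> * S + Csum"
      using tol_sum[of K] mult_left_mono[OF NS \<kappa>] by linarith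
    show "(\<Sum>k<K. A K k) \<le> CA \<chi>bar \<kappa>b * S"
      using momentum_error[of K] mult_left_mono[OF NS CA[OF \<chi>bar(2)]] by (rule order_trans)
  qed (use \<alpha> Ct in auto)
  finally show ?thesis .
qed

text \<open>The leading n is the gradient at the start; everything later is charged to the
  iterations.\<close>

lemma ifo_total: "real (\<Sum>i\<le>k. ifo_calls est n b q i) \<le> real n + 5 * ifo_rate est n * real k"
proof -
  \<comment> \<open>With r s = n and an epoch of length at least s, full gradients cost at most r
    per iteration on average; a batch evaluated at two points costs at most 4 r, in total 5
    r.\<close>
  have epoch: "real (\<Sum>i\<le>k. ifo_calls est n b q i) \<le> real n + 5 * r * real k"
    if calls: "\<And>i. ifo_calls est n b q i \<le> (if q dvd i then n else 0) + (if i = 0 then 0 else 2 * b)"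
      and r: "real b \<le> 2 * r" "s \<le> real q" "r * s = real n" "0 \<le> r" for r s
  proof -
    have full: "(\<Sum>i\<le>k. if q dvd i then n else 0) = n + n * (k div q)"
      by (induction k) (auto simp: div_Suc mod_eq_0_iff_dvd)
    have batch: "(\<Sum>i\<le>k. if i = 0 then 0 else 2 * b) = 2 * b * k"
      by (induction k) auto
    have "real (k div q * q) \<le> real k" by (rule of_nat_mono) simp
    then have kq: "real (k div q) \<le> real k / real q" using q_pos by (simp add: le_divide_eq)
    have "real n / real q \<le> r" using mult_left_mono[OF r(2,4)] r(3) q_pos by (simp add: divide_le_eq)
    then have nq: "real n / real q * real k \<le> r * real k" by (intro mult_right_mono) auto
    have "(\<Sum>i\<le>k. ifo_calls est n b q i) \<le> n + n * (k div q) + 2 * b * k"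
      unfolding full[symmetric] batch[symmetric] sum.distrib[symmetric] by (intro sum_mono calls)
    then have "real (\<Sum>i\<le>k. ifo_calls est n b q i) \<le> real (n + n * (k div q) + 2 * b * k)"
      by (rule of_nat_mono)
    also have "\<dots> = real n + real n * real (k div q) + 2 * real b * real k" by simp
    also have "\<dots> \<le> real n + real n * (real k / real q) + 2 * (2 * r) * real k"
      using kq r(1) by (intro add_mono mult_left_mono mult_right_mono) auto
    finally show ?thesis using nq by (simp add: algebra_simps)
  qed
  have linear: "real (\<Sum>i\<le>k. ifo_calls est n b q i) \<le> real n + 5 * r * real k"
    if calls: "\<And>i. ifo_calls est n b q i = (if i = 0 then n else b)" and r: "real b \<le> 5 * r" for r
  proof -
    have "(\<Sum>i\<le>k. ifo_calls est n b q i) = n + b * k" unfolding calls by (induction k) auto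
    then show ?thesis using mult_right_mono[OF r, of "real k"] by simp
  qed
  have powr_split: "real n powr a * real n powr (1 - a) = real n" for a
    using n by (simp add: powr_add[symmetric])
  note b23 = nat_ceiling_le_twice(2)[OF n_powr[of "2/3"]]
  show ?thesis
  proof (cases est)
    case SVRG
    show ?thesis
      unfolding SVRG ifo_rate.simps
      by (rule epoch[unfolded SVRG, where s = "real n powr (1/3)"])
         (use b23 SVRG powr_split[of "2/3"] in \<open>auto simp: b_def q_def real_nat_ceiling_ge\<close>)
  next
    case SARAH
    show ?thesis
      unfolding SARAH ifo_rate.simps
      by (rule epoch[unfolded SARAH, where s = "real n powr (1/2)"])
         (use nat_ceiling_le_twice(2)[OF n_powr[of "1/2"]] SARAH powr_split[of "1/2"]
          in \<open>auto simp: b_def q_def real_nat_ceiling_ge\<close>)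
  next
    case SAGA
    show ?thesis
      unfolding SAGA ifo_rate.simps
      by (rule linear[unfolded SAGA]) (use order_trans[OF b23] SAGA in \<open>auto simp: b_def\<close>)
  next
    case SAG
    show ?thesis
      unfolding SAG ifo_rate.simps
      by (rule linear[unfolded SAG]) (use b_le in auto)
  qed
qed

text \<open>Some iterate is no worse than the average over the first K. In the constant, 1 covers
  the initial gradient and 5 S the calls of the iterations.\<close>

lemma complexity:
  assumes sum: "\<And>K. (\<Sum>k<K. expected_Theta_sq smp M R n f b \<alpha> Y k) \<le> S" and S: "0 < S" and \<epsilon>: "0 < \<epsilon>"
  shows "\<exists>k. expected_Theta_sq smp M R n f b \<alpha> Y k \<le> \<epsilon>\<^sup>2 \<and> real k \<le> (5 * S + 1) / \<epsilon>\<^sup>2 \<and>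
    real (\<Sum>i\<le>k. ifo_calls est n b q i) \<le> (5 * S + 1) * (real n + ifo_rate est n / \<epsilon>\<^sup>2)"
proof -
  define K where "K = nat \<lceil>S / \<epsilon>\<^sup>2\<rceil>"
  have Se: "0 < S / \<epsilon>\<^sup>2" using S \<epsilon> by simp
  have K: "S / \<epsilon>\<^sup>2 \<le> real K" "real K < S / \<epsilon>\<^sup>2 + 1" "0 < K" using Se unfolding K_def by linarith+
  have "\<exists>k<K. expected_Theta_sq smp M R n f b \<alpha> Y k \<le> \<epsilon>\<^sup>2"
  proof (rule ccontr)
    assume "\<not> ?thesis"
    then have "(\<Sum>k<K. \<epsilon>\<^sup>2) < (\<Sum>k<K. expected_Theta_sq smp M R n f b \<alpha> Y k)"
      using K(3) by (intro sum_strict_mono) (auto simp: not_le)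
    then have "real K * \<epsilon>\<^sup>2 < S" using sum[of K] by simp
    then show False using K(1) \<epsilon> by (simp add: divide_le_eq)
  qed
  then obtain k where k: "k < K" "expected_Theta_sq smp M R n f b \<alpha> Y k \<le> \<epsilon>\<^sup>2" by blast
  \<comment> \<open>As k is below K, the rounding in K is absorbed and no additive constant remains,
    even for large \<epsilon>.\<close>
  have kS: "real k \<le> S / \<epsilon>\<^sup>2" using k(1) K(2) by linarith
  have r: "0 \<le> ifo_rate est n" by (cases est) auto
  have "real k \<le> (5 * S + 1) / \<epsilon>\<^sup>2"
    using S \<epsilon> by (intro order_trans[OF kS] divide_right_mono) auto
  moreover have "real (\<Sum>i\<le>k. ifo_calls est n b q i) \<le> (5 * S + 1) * (real n + ifo_rate est n / \<epsilon>\<^sup>2)"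
  proof -
    have "real (\<Sum>i\<le>k. ifo_calls est n b q i) \<le> real n + 5 * ifo_rate est n * (S / \<epsilon>\<^sup>2)"
      using r kS by (intro order_trans[OF ifo_total] add_left_mono mult_left_mono) auto
    also have "\<dots> = 1 * real n + (5 * S) * (ifo_rate est n / \<epsilon>\<^sup>2)" by simp
    also have "\<dots> \<le> (5 * S + 1) * real n + (5 * S + 1) * (ifo_rate est n / \<epsilon>\<^sup>2)"
      using S r by (intro add_mono mult_right_mono) auto
    finally show ?thesis by (simp add: distrib_left)
  qed
  ultimately show ?thesis using k(2) by blast
qed

end

theorem theorem5p4:
  fixes M U :: "(real^'d) set" and retr :: "real^'d \<Rightarrow> real^'d \<Rightarrow> real^'d" and R :: "real^'d \<Rightarrow> real"
    and I :: "nat set" and V W :: "nat \<Rightarrow> (real^'d) set" and \<psi> :: "nat \<Rightarrow> real^'d \<Rightarrow> real^'p"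
    and sel :: "real^'d \<Rightarrow> nat"
    and Lf Mf LR \<gamma> \<Delta>bar \<chi>bar cf \<kappa> \<kappa>b Csum :: real
  assumes "compact M"
    and "defining_cover M I V W \<psi>"
    and "\<forall>x\<in>M. sel x \<in> I \<and> x \<in> V (sel x)"
    and "manifold_retraction M retr"
    and "open U" and "M \<subseteq> U"
    and "0 \<le> Lf" and "0 < Mf"
    and "convex_on UNIV R" and "LR-lipschitz_on UNIV R"
    and "0 < \<gamma>" and "\<gamma> \<le> 1" and "0 \<le> \<Delta>bar" and "0 \<le> \<chi>bar" and "\<chi>bar < 1" and "1 \<le> cf"
    and "0 \<le> \<kappa>" and "0 < \<kappa>b" and "\<kappa>b < 1"
  shows "\<exists>\<alpha>0>0. \<forall>\<alpha> \<alpha>bar. 0 < \<alpha> \<and> \<alpha> \<le> \<alpha>bar \<and> \<alpha>bar \<le> \<alpha>0 \<longrightarrow>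
    (\<exists>C>0. \<forall>est smp n f x0 \<sigma> Y b q.
       1 \<le> n \<and> admissible_components M U Lf Mf n f \<and> x0 \<in> M \<and>
       (\<forall>k. \<sigma> k \<in> {0..\<Delta>bar}) \<and> summable \<sigma> \<and> suminf \<sigma> \<le> Csum \<and>
       b = batch_size est \<kappa>b n \<and> q = epoch_length est n \<and>
       iRPMVR_run est smp M (\<lambda>x. frechet_derivative (\<psi> (sel x)) (at x)) retr R n f b q
         \<alpha> \<gamma> \<Delta>bar \<chi>bar (cf * Mf) x0 Y \<and>
       tolerance_rule smp n b \<Delta>bar \<kappa> \<sigma> Y \<longrightarrow>
       (\<forall>\<epsilon>>0. \<exists>k. expected_Theta_sq smp M R n f b \<alpha> Y k \<le> \<epsilon>\<^sup>2 \<and>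
          real k \<le> C / \<epsilon>\<^sup>2 \<and>
          real (\<Sum>i\<le>k. ifo_calls est n b q i) \<le> C * (real n + ifo_rate est n / \<epsilon>\<^sup>2)))"
proof -
  let ?B = "\<lambda>x. frechet_derivative (\<psi> (sel x)) (at x)"
  interpret emb: embedded_submanifold M I V W \<psi> by unfold_locales (fact assms)+
  have sel: "sel x \<in> I" "x \<in> V (sel x)" "x \<in> W (sel x)" if "x \<in> M" for x
    using assms(3) that emb.chart(4)[of "sel x"] closure_subset[of "V (sel x)"] by blast+
  obtain cB where cB: "0 \<le> cB" "\<And>i x v. i \<in> I \<Longrightarrow> x \<in> M \<Longrightarrow> x \<in> V i \<Longrightarrow> v \<in> normal_space M x \<Longrightarrow>
      norm v \<le> cB * norm (emb.D i x v)"
    by (rule emb.normal_norm_le) blast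
  obtain LP where LP: "0 \<le> LP" "\<And>x y v. x \<in> M \<Longrightarrow> y \<in> M \<Longrightarrow> v \<in> normal_space M y \<Longrightarrow>
      norm (tangent_proj M x v) \<le> LP * norm (x - y) * norm v"
    by (rule emb.tangent_proj_normal) blast
  obtain \<rho> L2 where \<rho>: "0 < \<rho>" and L2: "0 \<le> L2" "\<And>x \<eta>. x \<in> M \<Longrightarrow> \<eta> \<in> tangent_space M x \<Longrightarrow>
      norm \<eta> < \<rho> \<Longrightarrow> norm (retr x \<eta> - x - \<eta>) \<le> L2 * (norm \<eta>)\<^sup>2"
    by (rule emb.retraction_bounds[OF assms(4)]) blast
  obtain r0 where r0: "0 < r0" "\<And>x. x \<in> M \<Longrightarrow> ball x r0 \<subseteq> U"
    by (rule open_neighbourhood_uniform[OF assms(1,5,6)]) blast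
  \<comment> \<open>The half radius guarantees that two points of one ball are closer than
    \<open>r0\<close>, as the oscillation argument requires.\<close>
  have "M \<subseteq> (\<Union>c\<in>M. ball c (r0 / 2))" using r0(1) by force
  then obtain C where C: "finite C" "M \<subseteq> (\<Union>c\<in>C. ball c (r0 / 2))"
    by (rule compactE_image[OF assms(1) open_ball]) blast
  obtain dM where dM: "\<And>x y. x \<in> M \<Longrightarrow> y \<in> M \<Longrightarrow> dist x y \<le> dM"
    using compact_imp_bounded[OF assms(1)] unfolding bounded_two_points by blast
  interpret G: run_geometry M U retr R ?B C Lf Mf LR cf cB LP \<rho> L2 r0 dM
  proof (rule run_geometry.intro)
    fix x assume x: "x \<in> M"
    show "subspace (tangent_space M x)" by (rule emb.subspace_tangent_space[OF x])
    show "linear (?B x)" by (rule emb.linear_D[OF sel(1,3)[OF x]])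
    show "ball x r0 \<subseteq> U" by (rule r0(2)[OF x])
    fix v
    show "v \<in> tangent_space M x \<Longrightarrow> ?B x v = 0"
      using emb.tangent_space_kernel[OF sel(1)[OF x] x sel(3)[OF x]] by blast
    show "v \<in> normal_space M x \<Longrightarrow> norm v \<le> cB * norm (?B x v)"
      by (rule cB(2)[OF sel(1)[OF x] x sel(2)[OF x]])
    show "v \<in> tangent_space M x \<Longrightarrow> norm v < \<rho> \<Longrightarrow> norm (retr x v - x - v) \<le> L2 * (norm v)\<^sup>2"
      by (rule L2(2)[OF x])
    show "retr x v \<in> M" if "v \<in> tangent_space M x"
    proof -
      have "(x, v) \<in> tangent_bundle M" using x that by (simp add: tangent_bundle_def)
      then show ?thesis using assms(4) unfolding manifold_retraction_def by blast
    qed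
  qed (fact cB(1) LP \<rho> L2(1) r0(1) C dM assms(7-10,16))+
  define H where "H = cf * Mf + LR"
  \<comment> \<open>The momentum term of the step condition, \<alpha>/2 times \<open>G.CA\<close>,
    is bounded by \<open>G.CA\<close> using \<alpha> at most 1; so Q does not depend on
    \<alpha>.\<close>
  define Q where "Q = 1 + G.Cd + G.Ct * \<kappa> + G.CA \<chi>bar \<kappa>b"
  have H: "0 < H" unfolding H_def using G.Mf G.Mf_le_Mu[unfolded G.Mu_def] G.LR by linarith
  have "0 \<le> G.Cd" using G.Mf G.L2 G.LR G.Lf by (simp add: G.Cd_def)
  moreover have "0 \<le> G.Ct * \<kappa>" using G.Ct assms(17) by simp
  moreover have CA: "0 \<le> G.CA \<chi>bar \<kappa>b" by (rule G.CA[OF assms(15)])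
  ultimately have Q: "0 < Q" by (simp add: Q_def)
  have M1: "0 < G.M1" using G.M1 by simp
  \<comment> \<open>The four entries secure, in order, the bound used in Q, the range of the
    retraction, the radius \<open>r0\<close> and the absorption of errors by descent; the factor 2
    makes the second and third strict.\<close>
  define \<alpha>0 where "\<alpha>0 = Min {1, \<rho> / (2 * H), r0 / (2 * (G.M1 * H)), \<gamma> / (2 * Q)}"
  have pos: "0 < \<alpha>0" using \<rho> H r0(1) M1 Q assms(11) by (simp add: \<alpha>0_def)
  have main: "\<exists>C>0. \<forall>est smp n f x0 \<sigma> Y b q.
       1 \<le> n \<and> admissible_components M U Lf Mf n f \<and> x0 \<in> M \<and>
       (\<forall>k. \<sigma> k \<in> {0..\<Delta>bar}) \<and> summable \<sigma> \<and> suminf \<sigma> \<le> Csum \<and>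
       b = batch_size est \<kappa>b n \<and> q = epoch_length est n \<and>
       iRPMVR_run est smp M ?B retr R n f b q \<alpha> \<gamma> \<Delta>bar \<chi>bar (cf * Mf) x0 Y \<and>
       tolerance_rule smp n b \<Delta>bar \<kappa> \<sigma> Y \<longrightarrow>
       (\<forall>\<epsilon>>0. \<exists>k. expected_Theta_sq smp M R n f b \<alpha> Y k \<le> \<epsilon>\<^sup>2 \<and>
          real k \<le> C / \<epsilon>\<^sup>2 \<and>
          real (\<Sum>i\<le>k. ifo_calls est n b q i) \<le> C * (real n + ifo_rate est n / \<epsilon>\<^sup>2))"
    if \<alpha>: "0 < \<alpha>" "\<alpha> \<le> \<alpha>bar" "\<alpha>bar \<le> \<alpha>0" for \<alpha> \<alpha>bar
  proof -
    have le: "\<alpha> \<le> 1" "\<alpha> \<le> \<rho> / (2 * H)" "\<alpha> \<le> r0 / (2 * (G.M1 * H))" "\<alpha> \<le> \<gamma> / (2 * Q)"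
      using \<alpha> by (auto simp: \<alpha>0_def)
    have small1: "\<alpha> * H < \<rho>" using le(2) H \<rho> by (simp add: field_simps)
    have "\<alpha> * (2 * (G.M1 * H)) \<le> r0" using le(3) H M1 by (simp add: pos_le_divide_eq)
    moreover have "0 < \<alpha> * (G.M1 * H)" using \<alpha>(1) H M1 by simp
    ultimately have small2: "G.M1 * (\<alpha> * H) < r0" by (simp add: mult_ac)
    have "\<alpha> * (2 * Q) \<le> \<gamma>" using le(4) Q by (simp add: pos_le_divide_eq)
    then have "Q \<le> \<gamma> / (2 * \<alpha>)" using \<alpha>(1) by (simp add: pos_le_divide_eq mult_ac)
    moreover have "\<alpha> / 2 * G.CA \<chi>bar \<kappa>b \<le> 1 * G.CA \<chi>bar \<kappa>b" using le(1) by (intro mult_right_mono CA) simp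
    ultimately have small3: "1 + G.Cd + G.Ct * \<kappa> + \<alpha> / 2 * G.CA \<chi>bar \<kappa>b \<le> \<gamma> / (2 * \<alpha>)"
      by (simp add: Q_def)
    define S0 where "S0 = G.osc + G.Ct * Csum"
    \<comment> \<open>Fixed before the estimator, n and the run are chosen; the maximum with 1 only
      ensures positivity.\<close>
    define S where "S = max 1 ((3 * Lf\<^sup>2 + 3 / \<alpha>\<^sup>2 + 1) * (2 * S0 + 2 * (\<alpha> * (G.Ct * (\<kappa> * S0 + Csum))))
      + 3 * (G.CA \<chi>bar \<kappa>b * S0))"
    have S: "0 < S" by (simp add: S_def)
    show ?thesis
    proof (intro exI[of _ "5 * S + 1"] conjI allI impI)
      show "0 < 5 * S + 1" using S by simp
      fix est smp n f x0 \<sigma> and Y :: "nat \<Rightarrow> (nat \<Rightarrow> nat list) \<Rightarrow> (real^'d, real^'p) iterate" and b q and \<epsilon> :: real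
      assume a: "1 \<le> n \<and> admissible_components M U Lf Mf n f \<and> x0 \<in> M \<and>
        (\<forall>k. \<sigma> k \<in> {0..\<Delta>bar}) \<and> summable \<sigma> \<and> suminf \<sigma> \<le> Csum \<and>
        b = batch_size est \<kappa>b n \<and> q = epoch_length est n \<and>
        iRPMVR_run est smp M ?B retr R n f b q \<alpha> \<gamma> \<Delta>bar \<chi>bar (cf * Mf) x0 Y \<and>
        tolerance_rule smp n b \<Delta>bar \<kappa> \<sigma> Y"
      assume \<epsilon>: "0 < \<epsilon>"
      interpret run: algorithm_run M U retr R ?B C Lf Mf LR cf cB LP \<rho> L2 r0 dM
        \<alpha> \<gamma> \<Delta>bar \<chi>bar \<kappa> \<kappa>b Csum est smp n f x0 \<sigma> Y b q
        by unfold_locales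
          (use a \<alpha>(1) small1 small2 assms(11,12,14,15,17-19) in \<open>auto simp: H_def G.M1_def\<close>)
      have sum: "(\<Sum>k<K. expected_Theta_sq smp M R n f b \<alpha> Y k) \<le> S" for K
        using run.Theta_sum[OF small3, of K] unfolding S_def S0_def by linarith
      show "\<exists>k. expected_Theta_sq smp M R n f b \<alpha> Y k \<le> \<epsilon>\<^sup>2 \<and> real k \<le> (5 * S + 1) / \<epsilon>\<^sup>2 \<and>
          real (\<Sum>i\<le>k. ifo_calls est n b q i) \<le> (5 * S + 1) * (real n + ifo_rate est n / \<epsilon>\<^sup>2)"
        by (rule run.complexity[OF sum S \<epsilon>])
    qed
  qed
  show ?thesis
  proof (rule exI[of _ \<alpha>0], rule conjI[OF pos], rule allI, rule allI, rule impI, elim conjE)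
  qed (rule main)
qed

end
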